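(* Let $M$ be the $8\times8$ Latin square of the multiplication table of the Quaternion group given, row by row, by $$12345678/21678345/36257184/47823516/58762431/63184257/74516823/85431762.$$ Then $M$ is realizable by $(3,8)$-nets in $\mathbb{P}^2_{\mathbb{C}}$; the moduli space of $(3,8)$-nets over $\mathbb{C}$ with combinatorial data $M$ is three-dimensional, parametrized by a nonempty Zariski-open subset of $\mathbb{A}^3_{\mathbb{C}}$; and there are $(3,8)$-nets with combinatorial data $M$ defined over $\mathbb{Q}$.
   Context: A $(3,q)$-net in $\mathbb{P}^2$ ($q\ge2$) is a tuple $(\mathcal{A}_1,\mathcal{A}_2,\mathcal{A}_3,\mathcal{X})$ where each $\mathcal{A}_i$ is a set of $q$ lines of $\mathbb{P}^2$ and $\mathcal{X}$ is a finite set of points of $\mathbb{P}^2$ such that: (i) the $\mathcal{A}_i$ are pairwise disjoint; (ii) for $i\ne j$ the intersection point of any line of $\mathcal{A}_i$ with any line of $\mathcal{A}_j$ belongs to $\mathcal{X}$; (iii) through every point of $\mathcal{X}$ there passes exactly one line of each $\mathcal{A}_i$. (Then $|\mathcal{X}|=q^2$.) Label the lines so that $\mathcal{A}_i=\{L_{q(i-1)+1},\ldots,L_{qi}\}$. For a $q\times q$ Latin square $M$ (a table with entries in $\{1,\ldots,q\}$, each symbol occurring exactly once in each row and column; rows are separated by $/$ in the claim), a labeled $(3,q)$-net has combinatorial data $M$ if for every row $r$ and column $c$ the lines $L_c$, $L_{q+r}$ and $L_{2q+M(r,c)}$ have a common point (these points are exactly the points of $\mathcal{X}$). $M$ is realizable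 over a field $\mathbb{K}$ if there is a labeled $(3,q)$-net in $\mathbb{P}^2_{\mathbb{K}}$ with combinatorial data $M$; the net is said to be defined over $\mathbb{K}$ if its lines can be given by equations with coefficients in $\mathbb{K}$. The moduli space of $(3,q)$-nets over $\mathbb{C}$ with combinatorial data $M$ is the set of labeled $(3,q)$-nets in $\mathbb{P}^2_{\mathbb{C}}$ with combinatorial data $M$ modulo projective automorphisms of $\mathbb{P}^2_{\mathbb{C}}$; it is a quasi-projective variety. (In any such net the lines $L_1,L_2,L_{q+1},L_{q+2}$ are in general position, so the moduli space can be identified with the locally closed set of such labeled nets for which these four lines are a fixed quadruple of lines in general position.) "Parametrized by" an open set $U$ means that there is a morphism from $U$ to the moduli space that is bijective on $\mathbb{C}$-points. *)

theory Defs
  imports "HOL-Analysis.Analysis"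
begin

section \<open>The projective plane and 3-nets\<close>

text \<open>Points and lines of the projective plane over a field are the one- and two-dimensional
  linear subspaces of the space of vectors of length three; a point lies on a line iff it is
  contained in it, and two distinct lines meet in the point that is their set-theoretic
  intersection.\<close>

definition proj_points :: "('a::field ^ 3) set set" where
  "proj_points = {vec.span {v} | v. v \<noteq> 0}"

definition line_of :: "'a::field ^ 3 \<Rightarrow> ('a ^ 3) set" where
  "line_of a = {v. scalar_product a v = 0}"

definition proj_lines :: "('a::field ^ 3) set set" where
  "proj_lines = {line_of a | a. a \<noteq> 0}"

definition net3 :: "nat \<Rightarrow> (nat \<Rightarrow> ('a::field ^ 3) set set) \<Rightarrow> ('a ^ 3) set set \<Rightarrow> bool" where
  "net3 q A X \<longleftrightarrow>
     2 \<le> q \<and>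
     (\<forall>i\<in>{1..3}. A i \<subseteq> proj_lines \<and> card (A i) = q) \<and>
     finite X \<and> X \<subseteq> proj_points \<and>
     disjoint_family_on A {1..3} \<and>
     (\<forall>i\<in>{1..3}. \<forall>j\<in>{1..3}. i \<noteq> j \<longrightarrow> (\<forall>l\<in>A i. \<forall>m\<in>A j. l \<inter> m \<in> X)) \<and>
     (\<forall>P\<in>X. \<forall>i\<in>{1..3}. \<exists>!l. l \<in> A i \<and> P \<subseteq> l)"

text \<open>A labeled net is the family of its lines, indexed by \<open>{1..3 * q}\<close>; the set of points need
  not be recorded, since it consists of the intersections of lines of different classes.\<close>

definition labeled_net3 :: "nat \<Rightarrow> (nat \<Rightarrow> ('a::field ^ 3) set) \<Rightarrow> bool" where
  "labeled_net3 q L \<longleftrightarrow>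
     L \<in> {1..3 * q} \<rightarrow>\<^sub>E proj_lines \<and>
     (\<exists>X. net3 q (\<lambda>i. L ` {q * (i - 1) + 1..q * i}) X)"

definition latin_square :: "nat \<Rightarrow> (nat \<Rightarrow> nat \<Rightarrow> nat) \<Rightarrow> bool" where
  "latin_square q M \<longleftrightarrow>
     (\<forall>r\<in>{1..q}. bij_betw (\<lambda>c. M r c) {1..q} {1..q}) \<and>
     (\<forall>c\<in>{1..q}. bij_betw (\<lambda>r. M r c) {1..q} {1..q})"

definition nets_with_data ::
    "nat \<Rightarrow> (nat \<Rightarrow> nat \<Rightarrow> nat) \<Rightarrow> (nat \<Rightarrow> ('a::field ^ 3) set) set" where
  "nets_with_data q M =
     {L. labeled_net3 q L \<and>
         (\<forall>r\<in>{1..q}. \<forall>c\<in>{1..q}. \<exists>P\<in>proj_points.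
            P \<subseteq> L c \<and> P \<subseteq> L (q + r) \<and> P \<subseteq> L (2 * q + M r c))}"

definition realizable :: "'a::field itself \<Rightarrow> nat \<Rightarrow> (nat \<Rightarrow> nat \<Rightarrow> nat) \<Rightarrow> bool" where
  "realizable K q M \<longleftrightarrow> (nets_with_data q M :: (nat \<Rightarrow> ('a ^ 3) set) set) \<noteq> {}"

definition defined_over :: "'a::field set \<Rightarrow> nat \<Rightarrow> (nat \<Rightarrow> ('a ^ 3) set) \<Rightarrow> bool" where
  "defined_over K q L \<longleftrightarrow>
     (\<forall>k\<in>{1..3 * q}. \<exists>a. a \<noteq> 0 \<and> (\<forall>i. a $ i \<in> K) \<and> L k = line_of a)"


section \<open>Zariski topologies and Krull dimension\<close>

text \<open>\<open>polynomial_fun X\<close> holds of the polynomial expressions in the functions from \<open>X\<close>.\<close>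

inductive polynomial_fun :: "('x \<Rightarrow> 'a::comm_ring_1) set \<Rightarrow> ('x \<Rightarrow> 'a) \<Rightarrow> bool"
  for X :: "('x \<Rightarrow> 'a) set" where
  coord: "f \<in> X \<Longrightarrow> polynomial_fun X f"
| const: "polynomial_fun X (\<lambda>x. c)"
| add: "polynomial_fun X f \<Longrightarrow> polynomial_fun X g \<Longrightarrow> polynomial_fun X (\<lambda>x. f x + g x)"
| mult: "polynomial_fun X f \<Longrightarrow> polynomial_fun X g \<Longrightarrow> polynomial_fun X (\<lambda>x. f x * g x)"

definition affine_polynomial :: "(complex ^ 'n \<Rightarrow> complex) \<Rightarrow> bool" where
  "affine_polynomial = polynomial_fun {\<lambda>x. x $ i | i. True}"

text \<open>The complements of hypersurfaces form a basis of the Zariski topology.\<close>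

definition zariski_affine :: "(complex ^ 'n) topology" where
  "zariski_affine = topology_generated_by {{x. p x \<noteq> 0} | p. affine_polynomial p}"

text \<open>Families of lines indexed by \<open>I\<close> are the points of a product of copies of the dual projective
  plane; the coefficients of a line are its homogeneous coordinates there. Closed subsets are
  the zero loci of sets of multihomogeneous polynomials. As the base field is infinite,
  multihomogeneity can be expressed for polynomial functions.\<close>

definition coordinates_of ::
    "nat set \<Rightarrow> (nat \<Rightarrow> complex ^ 3) \<Rightarrow> (nat \<Rightarrow> (complex ^ 3) set) \<Rightarrow> bool" where
  "coordinates_of I a L \<longleftrightarrow> (\<forall>k\<in>I. a k \<noteq> 0 \<and> L k = line_of (a k))"

definition multihomogeneous_polynomial ::
    "nat set \<Rightarrow> ((nat \<Rightarrow> complex ^ 3) \<Rightarrow> complex) \<Rightarrow> bool" where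
  "multihomogeneous_polynomial I F \<longleftrightarrow>
     polynomial_fun {\<lambda>a. a k $ i | k i. k \<in> I} F \<and>
     (\<exists>d :: nat \<Rightarrow> nat. \<forall>s a. F (\<lambda>k. s k *s a k) = (\<Prod>k\<in>I. s k ^ d k) * F a)"

definition zariski_lines :: "nat set \<Rightarrow> (nat \<Rightarrow> (complex ^ 3) set) topology" where
  "zariski_lines I =
     topology_generated_by
       {{L \<in> I \<rightarrow>\<^sub>E proj_lines. \<forall>a. coordinates_of I a L \<longrightarrow> F a \<noteq> 0} | F.
          multihomogeneous_polynomial I F}"

definition regular_to_lines ::
    "nat set \<Rightarrow> (complex ^ 'n) set \<Rightarrow> (complex ^ 'n \<Rightarrow> nat \<Rightarrow> (complex ^ 3) set) \<Rightarrow> bool" where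
  "regular_to_lines I U \<psi> \<longleftrightarrow>
     \<psi> ` U \<subseteq> I \<rightarrow>\<^sub>E proj_lines \<and>
     (\<forall>u\<in>U. \<exists>W p. openin zariski_affine W \<and> u \<in> W \<and>
        (\<forall>k\<in>I. \<forall>i. affine_polynomial (\<lambda>x. p x k $ i)) \<and>
        (\<forall>x\<in>U \<inter> W. coordinates_of I (p x) (\<psi> x)))"

definition irreducible_in :: "'x topology \<Rightarrow> 'x set \<Rightarrow> bool" where
  "irreducible_in T Z \<longleftrightarrow>
     Z \<noteq> {} \<and> Z \<subseteq> topspace T \<and>
     (\<forall>A B. closedin T A \<and> closedin T B \<and> Z \<subseteq> A \<union> B \<longrightarrow> Z \<subseteq> A \<or> Z \<subseteq> B)"

text \<open>With values in \<^typ>\<open>enat\<close>, the empty space gets dimension 0.\<close>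

definition krull_dim :: "'x topology \<Rightarrow> enat" where
  "krull_dim T =
     Sup {enat n | n. \<exists>Z :: nat \<Rightarrow> 'x set.
       (\<forall>i\<le>n. closedin T (Z i) \<and> irreducible_in T (Z i)) \<and> (\<forall>i<n. Z i \<subset> Z (Suc i))}"


section \<open>The moduli space\<close>

text \<open>Automorphisms of the projective plane are induced by invertible matrices.\<close>

definition proj_equiv ::
    "nat \<Rightarrow> (nat \<Rightarrow> nat \<Rightarrow> nat) \<Rightarrow> ((nat \<Rightarrow> (complex ^ 3) set) \<times> (nat \<Rightarrow> (complex ^ 3) set)) set" where
  "proj_equiv q M =
     {(L, L'). L \<in> nets_with_data q M \<and> L' \<in> nets_with_data q M \<and>
        (\<exists>g :: complex ^ 3 ^ 3. invertible g \<and> (\<forall>k\<in>{1..3 * q}. L' k = (\<lambda>v. g *v v) ` L k))}"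

definition moduli_space ::
    "nat \<Rightarrow> (nat \<Rightarrow> nat \<Rightarrow> nat) \<Rightarrow> (nat \<Rightarrow> (complex ^ 3) set) set set" where
  "moduli_space q M = nets_with_data q M // proj_equiv q M"

text \<open>In every net the lines 1, 2, \<open>q + 1\<close>, \<open>q + 2\<close> are in general position, so each class in the
  moduli space contains exactly one net for which they are the standard quadruple below. This
  identifies the moduli space with a locally closed subset of a product of projective planes,
  whence its topology and the morphisms into it. A different choice of the quadruple would change
  the representatives by one fixed projective automorphism only.\<close>

definition in_standard_position :: "nat \<Rightarrow> (nat \<Rightarrow> (complex ^ 3) set) \<Rightarrow> bool" where
  "in_standard_position q L \<longleftrightarrow>
     L 1 = line_of (vector [1, 0, 0]) \<and>
     L 2 = line_of (vector [0, 1, 0]) \<and>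
     L (q + 1) = line_of (vector [0, 0, 1]) \<and>
     L (q + 2) = line_of (vector [1, 1, 1])"

definition standard_net :: "nat \<Rightarrow> (nat \<Rightarrow> (complex ^ 3) set) set \<Rightarrow> (nat \<Rightarrow> (complex ^ 3) set)" where
  "standard_net q C = (THE L. L \<in> C \<and> in_standard_position q L)"

definition moduli_topology ::
    "nat \<Rightarrow> (nat \<Rightarrow> nat \<Rightarrow> nat) \<Rightarrow> (nat \<Rightarrow> (complex ^ 3) set) set topology" where
  "moduli_topology q M =
     pullback_topology (moduli_space q M) (standard_net q) (zariski_lines {1..3 * q})"

definition moduli_morphism ::
    "nat \<Rightarrow> (nat \<Rightarrow> nat \<Rightarrow> nat) \<Rightarrow> (complex ^ 'n) set \<Rightarrow>
      (complex ^ 'n \<Rightarrow> (nat \<Rightarrow> (complex ^ 3) set) set) \<Rightarrow> bool" where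
  "moduli_morphism q M U f \<longleftrightarrow>
     f ` U \<subseteq> moduli_space q M \<and> regular_to_lines {1..3 * q} U (\<lambda>u. standard_net q (f u))"


section \<open>The Latin square\<close>

text \<open>As printed in the source. Despite its name there, it is not literally the multiplication table
  of the quaternion group (with 1, 2 as units and 3, 4, 5 as \<open>i\<close>, \<open>j\<close>, \<open>k\<close>): the entries 4 and 7 in
  rows 5 and 8, columns 3 and 6, are interchanged, and the resulting loop is not associative.\<close>

definition quaternion_square :: "nat \<Rightarrow> nat \<Rightarrow> nat" where
  "quaternion_square r c =
     [[1, 2, 3, 4, 5, 6, 7, 8],
      [2, 1, 6, 7, 8, 3, 4, 5],
      [3, 6, 2, 5, 7, 1, 8, 4],
      [4, 7, 8, 2, 3, 5, 1, 6],
      [5, 8, 7, 6, 2, 4, 3, 1],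
      [6, 3, 1, 8, 4, 2, 5, 7],
      [7, 4, 5, 1, 6, 8, 2, 3],
      [8, 5, 4, 3, 1, 7, 6, 2]] ! (r - 1) ! (c - 1)"

lemma latin_square_quaternion_square: "latin_square 8 quaternion_square"
proof -
  have "{1..8} = {1, 2, 3, 4, 5, 6, 7, 8::nat}" by auto
  then show ?thesis
    by (simp add: latin_square_def bij_betw_def quaternion_square_def insert_commute)
qed

end

theory Submission
  imports Defs "HOL-Library.Function_Algebras"
begin

text \<open>
  The columns 3, 6, the rows 5, 8 and the symbols 4, 7 form a subsquare of order 2 of the Latin
  square, so in a net the six corresponding lines are the sides of a complete quadrangle; in
  suitable coordinates they are \<open>x \<plusminus> y\<close>, \<open>y \<plusminus> z\<close> and \<open>x \<plusminus> z\<close>. This subsquare is contained in three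
  subsquares of order 4, all of them multiplication tables of the Klein four-group, and the six
  further lines of each of these have the form \<open>x \<plusminus> l\<close>, \<open>y \<plusminus> l\<close>, \<open>z \<plusminus> l\<close> for a single linear form \<open>l\<close>
  (\<open>klein_subnet_form\<close>). Together these account for all 24 lines, so a net is given by three linear
  forms \<open>p\<close>, \<open>q\<close>, \<open>r\<close>. The incidences inside of the three subsquares hold for any choice of the
  forms; the remaining 24 incidences say that the matrix with the rows \<open>p\<close>, \<open>q\<close>, \<open>r\<close> has determinant
  1 and equals its matrix of cofactors (\<open>four_brackets\<close>), in other words, that it is a rotation.

  The lines \<open>x + p\<close>, \<open>y + q\<close>, \<open>z + r\<close> of a net are not concurrent, hence \<open>- 1\<close> is not an eigenvalue of
  this rotation, and the rotation is the Cayley transform of exactly one skew-symmetric matrix, with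
  three free entries \<open>u\<close> (\<open>cayley\<close>). So every net is projectively equivalent to a net
  \<open>rotation_net u\<close> (\<open>rotation_net_normal_form\<close>). Conversely these lines satisfy all incidences for
  every \<open>u\<close>, and nondegeneracy excludes the zeros of finitely many polynomials. This gives the open set
  \<open>rotation_params\<close>, which contains a rational point.

  The vector \<open>u\<close> can be read off from the intersections of the lines \<open>x + p\<close>, \<open>y + q\<close>, \<open>z + r\<close>; its
  components are quotients of multihomogeneous functions of the lines of the net that are invariant
  under projective maps (\<open>param_num\<close>, \<open>param_den\<close>). Therefore the parametrization of the moduli space is
  injective, and even a homeomorphism (\<open>homeomorphic_rotation_class\<close>). The dimension of the moduli
  space is then the dimension of a nonempty open subset of affine space (\<open>krull_dim_open_affine\<close>).
\<close>

section \<open>Lines of the projective plane in coordinates\<close>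

definition cross :: "'a::field ^ 3 \<Rightarrow> 'a ^ 3 \<Rightarrow> 'a ^ 3" where
  "cross a b = vector [a$2 * b$3 - a$3 * b$2, a$3 * b$1 - a$1 * b$3, a$1 * b$2 - a$2 * b$1]"

text \<open>The determinant of three vectors: it vanishes iff the three lines with these coefficients are
  concurrent. The components of \<^const>\<open>cross\<close> are the coordinates of the common point of two lines.\<close>

definition bracket :: "'a::field ^ 3 \<Rightarrow> 'a ^ 3 \<Rightarrow> 'a ^ 3 \<Rightarrow> 'a" where
  "bracket a b c = a$1 * (b$2 * c$3 - b$3 * c$2) + a$2 * (b$3 * c$1 - b$1 * c$3)
     + a$3 * (b$1 * c$2 - b$2 * c$1)"

lemma vec3_eq_iff: "v = w \<longleftrightarrow> v$1 = w$1 \<and> v$2 = w$2 \<and> v$3 = w$3" for v w :: "'a ^ 3"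
  by (simp add: vec_eq_iff forall_3)

lemma vector3_arith:
  "vector [a, b, c] + vector [a', b', c'] = (vector [a + a', b + b', c + c'] :: 'a::field ^ 3)"
  "vector [a, b, c] - vector [a', b', c'] = (vector [a - a', b - b', c - c'] :: 'a::field ^ 3)"
  "s *s vector [a, b, c] = (vector [s * a, s * b, s * c] :: 'a::field ^ 3)"
  by (simp_all add: vec3_eq_iff)

lemma scalar_product_3:
  "scalar_product a v = a$1 * v$1 + a$2 * v$2 + a$3 * v$3" for a v :: "'a::semiring_1 ^ 3"
  by (simp add: scalar_product_def sum_3)

lemma scalar_product_smult: "scalar_product a (s *s v) = s * scalar_product a v"
  for a v :: "'a::comm_semiring_1 ^ 3"
  by (simp add: scalar_product_3 algebra_simps)

lemma mem_line_of: "v \<in> line_of a \<longleftrightarrow> a$1 * v$1 + a$2 * v$2 + a$3 * v$3 = 0"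
  by (simp add: line_of_def scalar_product_3)

lemma bracket_eq_scalar_product: "bracket a b c = scalar_product a (cross b c)"
  by (simp add: bracket_def scalar_product_3 cross_def)

lemma bracket_rotate: "bracket a b c = bracket b c a"
  by (simp add: bracket_def algebra_simps)

lemma bracket_swap: "bracket a b c = - bracket b a c"
  by (simp add: bracket_def algebra_simps)

lemma bracket_swap': "bracket a b c = - bracket a c b"
  by (simp add: bracket_def algebra_simps)

lemma bracket_same [simp]: "bracket a a b = 0" "bracket a b a = 0" "bracket b a a = 0"
  by (simp_all add: bracket_def algebra_simps)

lemma bracket_smult:
  "bracket (s *s a) b c = s * bracket a b c"
  "bracket a (s *s b) c = s * bracket a b c"
  "bracket a b (s *s c) = s * bracket a b c"
  by (simp_all add: bracket_def algebra_simps)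

lemma bracket_add:
  "bracket (a + a') b c = bracket a b c + bracket a' b c"
  "bracket a (b + b') c = bracket a b c + bracket a b' c"
  "bracket a b (c + c') = bracket a b c + bracket a b c'"
  "bracket (a - a') b c = bracket a b c - bracket a' b c"
  "bracket a (b - b') c = bracket a b c - bracket a b' c"
  "bracket a b (c - c') = bracket a b c - bracket a b c'"
  by (simp_all add: bracket_def algebra_simps)

lemma bracket_matrix: "bracket (T *v a) (T *v b) (T *v c) = det T * bracket a b c"
  for T :: "'a::field ^ 3 ^ 3"
  by (simp add: bracket_def matrix_vector_mult_def sum_3 det_3 algebra_simps)

lemma cross_smult: "cross (s *s a) b = s *s cross a b" "cross a (s *s b) = s *s cross a b"
  by (simp_all add: vec3_eq_iff cross_def algebra_simps)

lemma cross_eq_0_iff: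
  assumes "a \<noteq> 0"
  shows "cross a b = 0 \<longleftrightarrow> (\<exists>s. b = s *s a)"
proof
  assume c: "cross a b = 0"
  then have e: "a$2 * b$3 = a$3 * b$2" "a$3 * b$1 = a$1 * b$3" "a$1 * b$2 = a$2 * b$1"
    by (simp_all add: vec3_eq_iff cross_def)
  consider "a$1 \<noteq> 0" | "a$2 \<noteq> 0" | "a$3 \<noteq> 0"
    using assms by (auto simp: vec3_eq_iff)
  then show "\<exists>s. b = s *s a"
  proof cases
    case 1
    then have "b = (b$1 / a$1) *s a" using e by (simp add: vec3_eq_iff field_simps)
    then show ?thesis ..
  next
    case 2
    then have "b = (b$2 / a$2) *s a" using e by (simp add: vec3_eq_iff field_simps)
    then show ?thesis ..
  next
    case 3
    then have "b = (b$3 / a$3) *s a" using e by (simp add: vec3_eq_iff field_simps)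
    then show ?thesis ..
  qed
next
  assume "\<exists>s. b = s *s a"
  then show "cross a b = 0" by (auto simp: vec3_eq_iff cross_def)
qed

lemma orthogonal_to_two:
  assumes "cross a b \<noteq> 0"
  shows "scalar_product a v = 0 \<and> scalar_product b v = 0 \<longleftrightarrow> (\<exists>s. v = s *s cross a b)"
proof
  assume o: "scalar_product a v = 0 \<and> scalar_product b v = 0"
  have "cross (cross a b) v = scalar_product a v *s b - scalar_product b v *s a"
    by (simp add: vec3_eq_iff cross_def scalar_product_3 algebra_simps)
  then have "cross (cross a b) v = 0" using o by simp
  then show "\<exists>s. v = s *s cross a b" using cross_eq_0_iff[OF assms] by simp
next
  assume "\<exists>s. v = s *s cross a b"
  then show "scalar_product a v = 0 \<and> scalar_product b v = 0"
    by (auto simp: cross_def scalar_product_3 algebra_simps)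
qed

lemma bracket_eq_0_iff:
  "bracket a b c = 0 \<longleftrightarrow> scalar_product c (cross a b) = 0"
  by (simp add: bracket_def scalar_product_3 cross_def algebra_simps)

definition proportional :: "'a::field ^ 3 \<Rightarrow> 'a ^ 3 \<Rightarrow> bool" where
  "proportional v w \<longleftrightarrow> (\<exists>s. s \<noteq> 0 \<and> v = s *s w)"

lemma proportional_sym: "proportional v w \<Longrightarrow> proportional w v"
  unfolding proportional_def by (metis inverse_nonzero_iff_nonzero left_inverse vector_smult_assoc vector_smult_lid)

lemma proportional_trans: "proportional u v \<Longrightarrow> proportional v w \<Longrightarrow> proportional u w"
  unfolding proportional_def by (metis mult_eq_0_iff vector_smult_assoc)

lemma proportional_refl [simp]: "proportional v v"
  unfolding proportional_def by (metis one_neq_zero vector_smult_lid)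

lemma proportionalI: "v = s *s w \<Longrightarrow> v \<noteq> 0 \<Longrightarrow> proportional v w"
  unfolding proportional_def by (metis vector_smult_lzero)

lemma matrix_proportional:
  fixes T :: "'a::field ^ 3 ^ 3"
  shows "proportional v w \<Longrightarrow> proportional (T *v v) (T *v w)"
  unfolding proportional_def by (metis vector_scalar_commute)

lemma cross_eq_0_iff_proportional:
  assumes "a \<noteq> 0" "b \<noteq> 0"
  shows "cross a b = 0 \<longleftrightarrow> proportional a b"
proof -
  have "cross a b = 0 \<longleftrightarrow> (\<exists>s. b = s *s a)" by (rule cross_eq_0_iff[OF assms(1)])
  also have "\<dots> \<longleftrightarrow> proportional b a"
    using proportionalI[OF _ assms(2)] by (auto simp: proportional_def)
  finally show ?thesis using proportional_sym by blast
qed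

lemma line_of_proportional:
  fixes a b :: "'a::field ^ 3"
  assumes "proportional a b"
  shows "line_of a = line_of b"
proof -
  obtain s where s: "s \<noteq> 0" "a = s *s b" using assms by (auto simp: proportional_def)
  have "a$1 * v$1 + a$2 * v$2 + a$3 * v$3 = s * (b$1 * v$1 + b$2 * v$2 + b$3 * v$3)" for v :: "'a ^ 3"
    unfolding s(2) by (simp add: algebra_simps)
  then show ?thesis using s(1) by (auto simp: mem_line_of)
qed

lemma line_of_inter:
  assumes "cross a b \<noteq> 0"
  shows "line_of a \<inter> line_of b = vec.span {cross a b}"
  using orthogonal_to_two[OF assms] by (auto simp: line_of_def vec.span_singleton)

lemma span_subset_line_of: "vec.span {v} \<subseteq> line_of a \<longleftrightarrow> scalar_product a v = 0"
proof
  assume "vec.span {v} \<subseteq> line_of a"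
  then show "scalar_product a v = 0"
    using vec.span_base[of v "{v}"] by (auto simp: line_of_def)
next
  assume "scalar_product a v = 0"
  then show "vec.span {v} \<subseteq> line_of a"
    by (auto simp: vec.span_singleton line_of_def scalar_product_smult)
qed

lemma line_of_eq_iff:
  assumes "a \<noteq> 0" "b \<noteq> 0"
  shows "line_of a = line_of b \<longleftrightarrow> proportional a b"
proof
  assume e: "line_of a = line_of b"
  have "vector [0, a$3, - a$2] \<in> line_of a" "vector [- a$3, 0, a$1] \<in> line_of a"
    "vector [a$2, - a$1, 0] \<in> line_of a"
    by (simp_all add: mem_line_of algebra_simps)
  then have "cross a b = 0"
    unfolding e by (simp add: mem_line_of vec3_eq_iff cross_def algebra_simps)
  then show "proportional a b" using cross_eq_0_iff_proportional assms by blast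
qed (rule line_of_proportional)

text \<open>Passing to the adjoint with respect to the scalar product moves a map from the points to the
  coefficients of the lines.\<close>

lemma image_line_of:
  fixes T g :: "'a::field ^ 3 ^ 3"
  assumes i: "transpose T ** g = mat 1"
  shows "(\<lambda>v. g *v v) ` line_of a = line_of (T *v a)"
proof -
  have i': "g ** transpose T = mat 1" using i by (simp add: matrix_left_right_inverse)
  have dual: "scalar_product (T *v a) v = scalar_product a (transpose T *v v)" for v
    by (simp add: scalar_product_3 matrix_vector_mult_def sum_3 transpose_def algebra_simps)
  show ?thesis
  proof (intro equalityI subsetI)
    fix w assume "w \<in> line_of (T *v a)"
    then have "transpose T *v w \<in> line_of a" by (simp add: line_of_def dual)
    moreover have "g *v (transpose T *v w) = w"
      unfolding matrix_vector_mul_assoc i' by simp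
    ultimately show "w \<in> (\<lambda>v. g *v v) ` line_of a" by force
  next
    fix w assume "w \<in> (\<lambda>v. g *v v) ` line_of a"
    then obtain v where v: "v \<in> line_of a" "w = g *v v" by blast
    have "transpose T *v w = v" unfolding v(2) matrix_vector_mul_assoc i by simp
    then show "w \<in> line_of (T *v a)" using v(1) by (simp add: line_of_def dual)
  qed
qed

lemma obtain_image_of_lines:
  fixes T :: "'a::field ^ 3 ^ 3"
  assumes "invertible T"
  obtains g where "invertible g" "\<And>a. (\<lambda>v. g *v v) ` line_of a = line_of (T *v a)"
proof -
  have "invertible (transpose T)" using assms by (simp add: invertible_det_nz)
  then obtain g where g: "transpose T ** g = mat 1" "g ** transpose T = mat 1"
    by (auto simp: invertible_def)
  then have "invertible g" unfolding invertible_def by blast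
  then show thesis using image_line_of[OF g(1)] that by blast
qed

lemma obtain_coordinates_of_image:
  fixes g :: "'a::field ^ 3 ^ 3"
  assumes "invertible g"
  obtains T where "invertible T" "\<And>a. (\<lambda>v. g *v v) ` line_of a = line_of (T *v a)"
proof -
  obtain h where h: "h ** g = mat 1" "g ** h = mat 1" using assms by (auto simp: invertible_def)
  then have "invertible h" unfolding invertible_def by blast
  then have "invertible (transpose h)" by (simp add: invertible_det_nz)
  moreover have "transpose (transpose h) ** g = mat 1" using h(1) by simp
  ultimately show thesis using image_line_of that by blast
qed

lemma bracket_eq_0_of_common_point:
  assumes "v \<noteq> 0" "scalar_product a v = 0" "scalar_product b v = 0" "scalar_product c v = 0"
  shows "bracket a b c = 0"
proof (cases "cross b c = 0")
  case False
  then obtain s where s: "v = s *s cross b c" using orthogonal_to_two assms by blast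
  then have "s * bracket a b c = 0" "s \<noteq> 0"
    using assms(1,2) by (auto simp: bracket_eq_scalar_product scalar_product_smult)
  then show ?thesis by simp
qed (simp add: bracket_eq_scalar_product scalar_product_def)

lemma cross_antisym: "cross a b = - cross b a"
  by (simp add: vec3_eq_iff cross_def)

lemma cross_eq_0_sym: "cross a b = 0 \<longleftrightarrow> cross b a = 0"
  by (metis cross_antisym neg_equal_0_iff_equal)

lemma bracket_eq_0_of_cross: "cross a b = 0 \<Longrightarrow> bracket a b c = 0"
  by (simp add: bracket_eq_0_iff scalar_product_def)

lemma bracket_0_permute:
  "bracket a b c = 0 \<longleftrightarrow> bracket a c b = 0"
  "bracket a b c = 0 \<longleftrightarrow> bracket b a c = 0"
  "bracket a b c = 0 \<longleftrightarrow> bracket b c a = 0"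
  using bracket_swap'[of a b c] bracket_swap[of a b c] bracket_rotate[of a b c] by auto

lemma concurrent_trans:
  assumes "cross a b \<noteq> 0" "bracket a b c = 0" "bracket a b d = 0"
  shows "bracket c d a = 0"
proof (rule bracket_eq_0_of_common_point)
  show "scalar_product c (cross a b) = 0" "scalar_product d (cross a b) = 0"
    using assms by (simp_all add: bracket_eq_0_iff)
  show "scalar_product a (cross a b) = 0"
    by (simp add: scalar_product_3 cross_def algebra_simps)
qed (rule assms(1))

text \<open>The coefficients are determinants of pairs of components, by Cramer's rule; a component of the
  cross product that does not vanish serves as the denominator.\<close>

lemma in_pencil:
  assumes c: "cross p q \<noteq> 0" and 0: "bracket p q v = 0"
  shows "\<exists>s t. v = s *s p + t *s q"
proof -
  let ?n = "cross p q"
  have *: "?n$3 *s v = (v$1 * q$2 - v$2 * q$1) *s p + (p$1 * v$2 - p$2 * v$1) *s q"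
    "?n$1 *s v = (v$2 * q$3 - v$3 * q$2) *s p + (p$2 * v$3 - p$3 * v$2) *s q"
    "?n$2 *s v = (v$3 * q$1 - v$1 * q$3) *s p + (p$3 * v$1 - p$1 * v$3) *s q"
    using 0 by (simp_all add: vec3_eq_iff cross_def bracket_def; algebra)+
  have **: "\<exists>s t. v = s *s p + t *s q" if "n \<noteq> 0" "n *s v = s *s p + t *s q" for n s t
  proof -
    have "v = (1 / n) *s (n *s v)" using that(1) by simp
    also have "\<dots> = (s / n) *s p + (t / n) *s q" unfolding that(2) by (simp add: vec3_eq_iff field_simps)
    finally show ?thesis by blast
  qed
  have "?n$1 \<noteq> 0 \<or> ?n$2 \<noteq> 0 \<or> ?n$3 \<noteq> 0" using c by (auto simp: vec3_eq_iff)
  then show ?thesis using **[OF _ *(1)] **[OF _ *(2)] **[OF _ *(3)] by blast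
qed

text \<open>Two distinct pencils have only one line in common, so that a line of a net is known as soon as
  two of its points are known as intersections of known lines.\<close>

lemma proportional_if_in_two_pencils:
  assumes v: "v \<noteq> 0" "bracket v p q = 0" "bracket v r s = 0"
    and w: "w \<noteq> 0" "bracket w p q = 0" "bracket w r s = 0"
    and pqr: "bracket p q r \<noteq> 0" and rs: "cross r s \<noteq> 0"
  shows "proportional v w"
proof -
  let ?m = "cross p q" and ?n = "cross r s"
  have n: "cross ?m ?n \<noteq> 0"
  proof
    assume "cross ?m ?n = 0"
    then have "cross ?n ?m = 0" using cross_eq_0_sym by blast
    then obtain t where "?m = t *s ?n" using cross_eq_0_iff[OF rs] by blast
    then have "bracket r p q = t * bracket r r s"
      by (simp only: bracket_eq_scalar_product scalar_product_smult)
    then show False using pqr by (simp add: bracket_rotate[of r])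
  qed
  have *: "\<exists>t. u = t *s cross ?m ?n" if "bracket u p q = 0" "bracket u r s = 0" for u
    using that orthogonal_to_two[OF n, of u] bracket_eq_0_iff[of p q u] bracket_eq_0_iff[of r s u]
    by (simp add: bracket_eq_scalar_product scalar_product_def mult.commute)
  obtain t where t: "v = t *s cross ?m ?n" using * v by blast
  obtain t' where t': "w = t' *s cross ?m ?n" using * w by blast
  have "t' \<noteq> 0" using w(1) t' by auto
  then have "v = (t / t') *s w" unfolding t t' by simp
  then show ?thesis using v(1) by (rule proportionalI)
qed

lemma span_smult:
  assumes "s \<noteq> 0"
  shows "vec.span {s *s v} = vec.span {v :: 'a::field ^ 3}"
proof -
  have 1: "k *s v = (k / s) *s (s *s v)" for k using assms by simp
  have 2: "k *s (s *s v) = (k * s) *s v" for k by simp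
  show ?thesis
    unfolding vec.span_singleton by (intro equalityI image_subsetI) (subst 2 1, rule rangeI)+
qed

lemma concurrent_inter:
  assumes ab: "cross a b \<noteq> 0" and ac: "cross a c \<noteq> 0" and "bracket a b c = 0"
  shows "line_of a \<inter> line_of b = line_of a \<inter> line_of c"
proof -
  have "scalar_product c (cross a b) = 0" using assms(3) by (simp add: bracket_eq_0_iff)
  moreover have "scalar_product a (cross a b) = 0"
    by (simp add: scalar_product_3 cross_def algebra_simps)
  ultimately obtain s where s: "cross a b = s *s cross a c"
    using orthogonal_to_two[OF ac] by blast
  then have "s \<noteq> 0" using ab by auto
  then have "vec.span {cross a b} = vec.span {cross a c}"
    by (simp add: s span_smult)
  then show ?thesis by (simp add: line_of_inter ab ac)
qed

section \<open>Nets in coordinates\<close>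

text \<open>This captures a labeled net without mentioning points. The second condition, that two lines of
  one class never meet on a line of another class, makes all the lines distinct and gives the
  uniqueness in the third axiom of a net.\<close>

definition net_coordinates :: "nat \<Rightarrow> (nat \<Rightarrow> nat \<Rightarrow> nat) \<Rightarrow> (nat \<Rightarrow> 'a::field ^ 3) \<Rightarrow> bool" where
  "net_coordinates q M a \<longleftrightarrow>
     (\<forall>r\<in>{1..q}. \<forall>c\<in>{1..q}. bracket (a c) (a (q + r)) (a (2 * q + M r c)) = 0) \<and>
     (\<forall>k\<in>{1..3 * q}. \<forall>k'\<in>{1..3 * q}. \<forall>m\<in>{1..3 * q}.
        (k - 1) div q = (k' - 1) div q \<longrightarrow> k \<noteq> k' \<longrightarrow> (m - 1) div q \<noteq> (k - 1) div q \<longrightarrow>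
        bracket (a k) (a k') (a m) \<noteq> 0)"

lemma class_iff:
  fixes q k i :: nat
  assumes "0 < q" "1 \<le> i"
  shows "k \<in> {q * (i - 1) + 1..q * i} \<longleftrightarrow> 1 \<le> k \<and> (k - 1) div q = i - 1"
proof -
  obtain j where j: "i = Suc j" using assms(2) by (cases i) auto
  show ?thesis
  proof (cases k)
    case (Suc n)
    have "n div q = j \<longleftrightarrow> q * j \<le> n \<and> n < q * j + q"
    proof -
      have "n div q = j \<longleftrightarrow> j \<le> n div q \<and> n div q < Suc j" by auto
      also have "\<dots> \<longleftrightarrow> j * q \<le> n \<and> n < Suc j * q"
        using assms(1) by (simp only: less_eq_div_iff_mult_less_eq div_less_iff_less_mult)
      finally show ?thesis by (simp add: algebra_simps)
    qed
    then show ?thesis using Suc j by auto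
  qed (use j in auto)
qed

lemma card_image_interval_inj:
  "card (L ` {q * (i - 1) + 1..q * i}) = q \<Longrightarrow> 1 \<le> i \<Longrightarrow> inj_on L {q * (i - 1) + 1..q * i}"
  for q i :: nat
proof (rule eq_card_imp_inj_on)
  assume "card (L ` {q * (i - 1) + 1..q * i}) = q" "1 \<le> i"
  moreover have "q * i = q * (i - 1) + q" using \<open>1 \<le> i\<close> by (cases i) auto
  ultimately show "card (L ` {q * (i - 1) + 1..q * i}) = card {q * (i - 1) + 1..q * i}" by simp
qed simp

lemma latin_square_mem: "latin_square q M \<Longrightarrow> r \<in> {1..q} \<Longrightarrow> c \<in> {1..q} \<Longrightarrow> M r c \<in> {1..q}"
  unfolding latin_square_def by (metis bij_betw_apply)

text \<open>If two lines of one class met a line of another class in the same point, then this point, which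
  belongs to the net, would lie on two lines of one class.\<close>

lemma net_imp_coordinates:
  assumes L: "L \<in> nets_with_data q M"
    and a0: "\<And>k. k \<in> {1..3 * q} \<Longrightarrow> a k \<noteq> 0 \<and> L k = line_of (a k)"
    and M: "latin_square q M"
  shows "net_coordinates q M a"
proof -
  obtain X where "net3 q (\<lambda>i. L ` {q * (i - 1) + 1..q * i}) X"
    using L by (auto simp: nets_with_data_def labeled_net3_def)
  note X = this[unfolded net3_def]
  have q: "2 \<le> q" using X by blast
  have unique_line: "\<forall>P\<in>X. \<forall>i\<in>{1..3}. \<exists>!l. l \<in> L ` {q * (i - 1) + 1..q * i} \<and> P \<subseteq> l"
    using X by (elim conjE) assumption
  have in_class: "k \<in> {q * (i - 1) + 1..q * i}" "i \<in> {1..3}"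
    if "k \<in> {1..3 * q}" "i = Suc ((k - 1) div q)" for k i
  proof -
    show "k \<in> {q * (i - 1) + 1..q * i}"
      using q that by (subst class_iff) auto
    have "(k - 1) div q < 3" using q that(1) by (auto simp: less_mult_imp_div_less)
    then show "i \<in> {1..3}" using that by auto
  qed
  have Mr: "M r c \<in> {1..q}" if "r \<in> {1..q}" "c \<in> {1..q}" for r c
    using latin_square_mem M that by blast
  have concurrent: "\<exists>P\<in>proj_points. P \<subseteq> L c \<and> P \<subseteq> L (q + r) \<and> P \<subseteq> L (2 * q + M r c)"
    if "r \<in> {1..q}" "c \<in> {1..q}" for r c
  proof -
    have "\<forall>r\<in>{1..q}. \<forall>c\<in>{1..q}.
        \<exists>P\<in>proj_points. P \<subseteq> L c \<and> P \<subseteq> L (q + r) \<and> P \<subseteq> L (2 * q + M r c)"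
      using L unfolding nets_with_data_def by simp
    then show ?thesis using that by blast
  qed
  have "bracket (a c) (a (q + r)) (a (2 * q + M r c)) = 0" if rc: "r \<in> {1..q}" "c \<in> {1..q}" for r c
  proof -
    obtain P where P: "P \<in> proj_points" "P \<subseteq> L c" "P \<subseteq> L (q + r)" "P \<subseteq> L (2 * q + M r c)"
      using concurrent[OF rc] by blast
    then obtain v where v: "v \<noteq> 0" "P = vec.span {v}" by (auto simp: proj_points_def)
    have "c \<in> {1..3*q}" "q + r \<in> {1..3*q}" "2 * q + M r c \<in> {1..3*q}"
      using rc Mr[OF rc] by auto
    then show ?thesis
      using P(2-) a0 v by (intro bracket_eq_0_of_common_point[of v]) (auto simp flip: span_subset_line_of)
  qed
  moreover have "bracket (a k) (a k') (a m) \<noteq> 0"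
    if k: "k \<in> {1..3 * q}" "k' \<in> {1..3 * q}" "m \<in> {1..3 * q}"
      and c: "(k - 1) div q = (k' - 1) div q" "k \<noteq> k'" "(m - 1) div q \<noteq> (k - 1) div q" for k k' m
  proof
    assume 0: "bracket (a k) (a k') (a m) = 0"
    define i j where "i = Suc ((k - 1) div q)" and "j = Suc ((m - 1) div q)"
    have i': "i = Suc ((k' - 1) div q)" unfolding i_def c(1) ..
    have i: "k \<in> {q * (i - 1) + 1..q * i}" "k' \<in> {q * (i - 1) + 1..q * i}" "i \<in> {1..3}"
      using in_class(1)[OF k(1) i_def] in_class(1)[OF k(2) i'] in_class(2)[OF k(1) i_def] .
    have j: "m \<in> {q * (j - 1) + 1..q * j}" "j \<in> {1..3}"
      using in_class[OF k(3) j_def] .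
    have ij: "i \<noteq> j" using c(3) by (simp add: i_def j_def)
    let ?A = "\<lambda>i. L ` {q * (i - 1) + 1..q * i}"
    have "?A i \<inter> ?A j = {}"
      using X i(3) j(2) ij by (meson disjoint_family_onD)
    then have "L k \<noteq> L m" using i j by blast
    then have km: "cross (a k) (a m) \<noteq> 0"
      using a0 k line_of_eq_iff cross_eq_0_iff_proportional by metis
    have P: "L k \<inter> L m \<in> X" using X i j ij by blast
    have e: "L k \<inter> L m = vec.span {cross (a k) (a m)}" using km line_of_inter a0 k by metis
    have "scalar_product (a k') (cross (a k) (a m)) = 0"
      using 0 by (simp add: bracket_swap'[of "a k" "a k'"] bracket_eq_0_iff)
    then have "L k \<inter> L m \<subseteq> L k'" using a0 k e span_subset_line_of by metis
    moreover have "\<exists>!l. l \<in> ?A i \<and> L k \<inter> L m \<subseteq> l" by (rule unique_line[THEN bspec, OF P, THEN bspec, OF i(3)])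
    ultimately have "L k = L k'" using i by blast
    moreover have "inj_on L {q * (i - 1) + 1..q * i}"
      using X i(3) by (intro card_image_interval_inj) auto
    ultimately show False using i c(2) by (auto dest: inj_onD)
  qed
  ultimately show ?thesis by (simp add: net_coordinates_def)
qed

context
  fixes q :: nat and M :: "nat \<Rightarrow> nat \<Rightarrow> nat" and a :: "nat \<Rightarrow> 'a::field ^ 3"
  assumes a: "net_coordinates q M a" and q: "2 \<le> q"
begin

lemma net_bracket_0:
  "r \<in> {1..q} \<Longrightarrow> c \<in> {1..q} \<Longrightarrow> bracket (a c) (a (q + r)) (a (2 * q + M r c)) = 0"
  using a by (simp add: net_coordinates_def)

lemma net_bracket_ne_0:
  assumes "k \<in> {1..3 * q}" "k' \<in> {1..3 * q}" "m \<in> {1..3 * q}"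
    "(k - 1) div q = (k' - 1) div q" "k \<noteq> k'" "(m - 1) div q \<noteq> (k - 1) div q"
  shows "bracket (a k) (a k') (a m) \<noteq> 0"
  using a assms by (simp add: net_coordinates_def)

text \<open>For lines of different classes, a further line of one of the classes shows that they differ.\<close>

lemma net_cross_ne_0:
  assumes k: "k \<in> {1..3 * q}" "k' \<in> {1..3 * q}" "k \<noteq> k'"
  shows "cross (a k) (a k') \<noteq> 0"
proof (cases "(k - 1) div q = (k' - 1) div q")
  case True
  define m where "m = (if (k - 1) div q = 0 then q + 1 else 1)"
  have "m \<in> {1..3 * q}" "(m - 1) div q \<noteq> (k - 1) div q" using q by (auto simp: m_def)
  then show ?thesis using net_bracket_ne_0[of k k' m] k True bracket_eq_0_of_cross by blast
next
  case False
  define i where "i = (k - 1) div q"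
  have ki: "k \<in> {q * (Suc i - 1) + 1..q * Suc i}" using k q i_def by (subst class_iff) auto
  have "i < 3" using q k(1) by (auto simp: i_def less_mult_imp_div_less)
  then have "q * Suc i \<le> q * 3" by (intro mult_le_mono) auto
  define l where "l = (if k = q * i + 1 then q * i + 2 else q * i + 1)"
  have "l \<in> {q * (Suc i - 1) + 1..q * Suc i}" "l \<noteq> k" using q by (auto simp: l_def)
  moreover then have "(l - 1) div q = i" using q class_iff[of q "Suc i" l] by simp
  moreover have "l \<in> {1..3 * q}"
    using \<open>q * Suc i \<le> q * 3\<close> calculation(1)
    by (metis One_nat_def Suc_eq_plus1 atLeastAtMost_iff diff_Suc_1 le_add2 le_trans mult.commute)
  ultimately have "bracket (a k) (a l) (a k') \<noteq> 0"
    using net_bracket_ne_0[of k l k'] k False by (auto simp: i_def)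
  then show ?thesis using bracket_eq_0_of_cross bracket_swap'[of "a k" "a l"] by fastforce
qed

lemma net_coordinates_ne_0: "k \<in> {1..3 * q} \<Longrightarrow> a k \<noteq> 0"
proof
  assume k: "k \<in> {1..3 * q}" "a k = 0"
  define l where "l = (if k = 1 then 2 else 1 :: nat)"
  have "cross (a k) (a l) \<noteq> 0" using k q by (intro net_cross_ne_0) (auto simp: l_def)
  then show False using k by (simp add: vec3_eq_iff cross_def)
qed

lemma net_lines_inj: "inj_on (\<lambda>k. line_of (a k)) {1..3 * q}"
proof (rule inj_onI, rule ccontr)
  fix k l assume *: "k \<in> {1..3 * q}" "l \<in> {1..3 * q}" "line_of (a k) = line_of (a l)" "k \<noteq> l"
  then have "a k \<noteq> 0" "a l \<noteq> 0" "cross (a k) (a l) \<noteq> 0"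
    using net_cross_ne_0 net_coordinates_ne_0 by blast+
  then show False using *(3) by (simp add: line_of_eq_iff cross_eq_0_iff_proportional)
qed

end

text \<open>The points of the net are the intersections of the columns with the rows. Since the data form a
  Latin square, each of them is also the intersection of a column, or of a row, with a symbol, and
  all such intersections arise in this way.\<close>

lemma coordinates_imp_net:
  assumes a: "net_coordinates q M a" and q: "2 \<le> q" and M: "latin_square q M"
  shows "(\<lambda>k\<in>{1..3 * q}. line_of (a k)) \<in> nets_with_data q M"
proof -
  note [simp del] = atLeastAtMost_iff One_nat_def
  define L where "L = (\<lambda>k\<in>{1..3 * q}. line_of (a k))"
  let ?A = "\<lambda>i. L ` {q * (i - 1) + 1..q * i}"
  define P where "P r c = vec.span {cross (a c) (a (q + r))}" for r c
  define X where "X = (\<lambda>(r, c). P r c) ` ({1..q} \<times> {1..q})"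
  have Lk: "L k = line_of (a k)" if "k \<in> {1..3 * q}" for k using that by (simp add: L_def)
  have inj: "inj_on L {1..3 * q}"
    using net_lines_inj[OF a q] by (simp add: L_def inj_on_def)
  have sub: "{q * (i - 1) + 1..q * i} \<subseteq> {1..3 * q}" if "i \<in> {1..3}" for i
  proof -
    have "q * i \<le> q * 3" using that by (intro mult_le_mono) (auto simp: atLeastAtMost_iff)
    then show ?thesis by (auto simp: atLeastAtMost_iff)
  qed
  have Mr: "M r c \<in> {1..q}" if "r \<in> {1..q}" "c \<in> {1..q}" for r c
    using latin_square_mem M that by blast
  have in1: "c \<in> {1..3 * q}" and in2: "q + c \<in> {1..3 * q}" and in3: "2 * q + c \<in> {1..3 * q}"
    if "c \<in> {1..q}" for c
    using that by (auto simp: atLeastAtMost_iff)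
  have cl1: "(c - 1) div q = 0" and cl2: "(q + c - 1) div q = 1" and cl3: "(2 * q + c - 1) div q = 2"
    if "c \<in> {1..q}" for c
  proof -
    have "c - 1 < q" "q + c - 1 = (c - 1) + 1 * q" "2 * q + c - 1 = (c - 1) + 2 * q"
      using that by (auto simp: atLeastAtMost_iff)
    then show "(c - 1) div q = 0" "(q + c - 1) div q = 1" "(2 * q + c - 1) div q = 2"
      using q by (simp_all only: div_mult_self1 div_less)
  qed
  have crc: "cross (a c) (a (q + r)) \<noteq> 0" if "r \<in> {1..q}" "c \<in> {1..q}" for r c
    using that in1 in2 by (intro net_cross_ne_0[OF a q]) (auto simp: atLeastAtMost_iff)
  have P12: "L c \<inter> L (q + r) = P r c" if "r \<in> {1..q}" "c \<in> {1..q}" for r c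
    using that by (simp add: Lk in1 in2 P_def line_of_inter crc)
  have P13: "L c \<inter> L (2 * q + M r c) = P r c" if "r \<in> {1..q}" "c \<in> {1..q}" for r c
  proof -
    have "cross (a c) (a (2 * q + M r c)) \<noteq> 0"
      using that in1 in3[OF Mr] by (intro net_cross_ne_0[OF a q]) (auto simp: atLeastAtMost_iff)
    then have "line_of (a c) \<inter> line_of (a (q + r)) = line_of (a c) \<inter> line_of (a (2 * q + M r c))"
      using that crc net_bracket_0[OF a q] by (intro concurrent_inter) auto
    then show ?thesis using that P12 in1 in2 in3 Mr Lk by metis
  qed
  have P23: "L (q + r) \<inter> L (2 * q + M r c) = P r c" if "r \<in> {1..q}" "c \<in> {1..q}" for r c
  proof -
    have "cross (a (q + r)) (a (2 * q + M r c)) \<noteq> 0"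
      using that in2 in3[OF Mr[OF that]] Mr[OF that]
      by (intro net_cross_ne_0[OF a q]) (auto simp: atLeastAtMost_iff)
    moreover have "cross (a (q + r)) (a c) \<noteq> 0" using crc that cross_eq_0_sym by blast
    moreover have "bracket (a (q + r)) (a c) (a (2 * q + M r c)) = 0"
      using net_bracket_0[OF a q that] bracket_swap[of "a c"] by simp
    ultimately have "line_of (a (q + r)) \<inter> line_of (a c) = line_of (a (q + r)) \<inter> line_of (a (2 * q + M r c))"
      by (intro concurrent_inter) auto
    then show ?thesis using that P12 in1 in2 in3 Mr Lk by (metis Int_commute)
  qed
  have inX: "P r c \<in> X" if "r \<in> {1..q}" "c \<in> {1..q}" for r c
    using that by (auto simp: X_def)
  have A1: "?A 1 = L ` {1..q}" by simp
  have A2: "?A 2 = (\<lambda>r. L (q + r)) ` {1..q}"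
  proof -
    have "{q * (2 - 1) + 1..q * 2} = (+) q ` {1..q}" by (simp add: mult_2_right)
    then show ?thesis by (simp only: image_image)
  qed
  have A3: "?A 3 = (\<lambda>s. L (2 * q + s)) ` {1..q}"
  proof -
    have "{q * (3 - 1) + 1..q * 3} = (+) (2 * q) ` {1..q}" by (simp add: algebra_simps)
    then show ?thesis by (simp only: image_image)
  qed
  have i3: "i = 1 \<or> i = 2 \<or> i = 3" if "i \<in> {1..3}" for i :: nat
    using that by (auto simp: atLeastAtMost_iff)
  have "net3 q ?A X"
    unfolding net3_def
  proof (intro conjI ballI impI)
    show "2 \<le> q" by (rule q)
    show "finite X" by (simp add: X_def)
    show "X \<subseteq> proj_points" using crc by (auto simp: X_def P_def proj_points_def)
    show "disjoint_family_on ?A {1..3}"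
    proof (unfold disjoint_family_on_def, intro ballI impI)
      fix i j :: nat assume ij: "i \<in> {1..3}" "j \<in> {1..3}" "i \<noteq> j"
      have "{q * (i - 1) + 1..q * i} \<inter> {q * (j - 1) + 1..q * j} = {}"
      proof -
        have "1 \<le> i" "1 \<le> j" using ij by (auto simp: atLeastAtMost_iff)
        then have "i - 1 \<noteq> j - 1" using ij by auto
        then show ?thesis using class_iff[of q i] class_iff[of q j] q \<open>1 \<le> i\<close> \<open>1 \<le> j\<close> by fastforce
      qed
      then show "?A i \<inter> ?A j = {}"
        using inj sub[OF ij(1)] sub[OF ij(2)] by (simp flip: inj_on_image_Int)
    qed
  next
    fix i :: nat assume i: "i \<in> {1..3}"
    show "?A i \<subseteq> proj_lines"
    proof (rule image_subsetI)
      fix k assume "k \<in> {q * (i - 1) + 1..q * i}"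
      then have "k \<in> {1..3 * q}" using sub[OF i] by blast
      then show "L k \<in> proj_lines"
        using net_coordinates_ne_0[OF a q] by (auto simp: proj_lines_def Lk)
    qed
    have "q * i = q * (i - 1) + q" using i by (cases i) (auto simp: atLeastAtMost_iff)
    moreover have "card (?A i) = card {q * (i - 1) + 1..q * i}"
      using inj sub[OF i] by (intro card_image) (rule inj_on_subset)
    ultimately show "card (?A i) = q" by simp
  next
    fix i j :: nat and l m assume ij: "i \<in> {1..3}" "j \<in> {1..3}" "i \<noteq> j" and lm: "l \<in> ?A i" "m \<in> ?A j"
    have 12: "l \<inter> m \<in> X" if "l \<in> ?A 1" "m \<in> ?A 2" for l m
      using that P12 inX unfolding A1 A2 by auto
    have 13: "l \<inter> m \<in> X" if lm: "l \<in> ?A 1" "m \<in> ?A 3" for l m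
    proof -
      obtain c s where cs: "c \<in> {1..q}" "s \<in> {1..q}" "l = L c" "m = L (2 * q + s)"
        using lm unfolding A1 A3 by blast
      then have "s \<in> (\<lambda>r. M r c) ` {1..q}" using M by (auto simp: latin_square_def bij_betw_def)
      then show ?thesis using cs P13 inX by auto
    qed
    have 23: "l \<inter> m \<in> X" if lm: "l \<in> ?A 2" "m \<in> ?A 3" for l m
    proof -
      obtain r s where cs: "r \<in> {1..q}" "s \<in> {1..q}" "l = L (q + r)" "m = L (2 * q + s)"
        using lm unfolding A2 A3 by blast
      then have "s \<in> (\<lambda>c. M r c) ` {1..q}" using M by (auto simp: latin_square_def bij_betw_def)
      then show ?thesis using cs P23 inX by auto
    qed
    show "l \<inter> m \<in> X"
      using i3[OF ij(1)] i3[OF ij(2)] ij(3) lm 12[of l m] 12[of m l] 13[of l m] 13[of m l]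
        23[of l m] 23[of m l] by (elim disjE) (auto simp: Int_commute simp del: One_nat_def)
  next
    fix Q and i :: nat assume "Q \<in> X" and i: "i \<in> {1..3}"
    then obtain r c where rc: "r \<in> {1..q}" "c \<in> {1..q}" "Q = P r c" by (auto simp: X_def)
    define k where "k = (if i = 1 then c else if i = 2 then q + r else 2 * q + M r c)"
    define m where "m = (if i = 1 then q + r else c)"
    have k: "k \<in> {1..3 * q}" "m \<in> {1..3 * q}" "(k - 1) div q = i - 1" "(m - 1) div q \<noteq> i - 1"
      and Pk: "Q \<subseteq> L k" "Q \<subseteq> L m"
      using i3[OF i] rc in1 in2 in3 Mr[OF rc(1,2)] cl1 cl2 cl3 P12[OF rc(1,2)] P13[OF rc(1,2)]
      by (auto simp: k_def m_def)
    have kA: "k \<in> {q * (i - 1) + 1..q * i}"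
      using k(1,3) q i by (subst class_iff) (auto simp: atLeastAtMost_iff)
    show "\<exists>!l. l \<in> ?A i \<and> Q \<subseteq> l"
    proof (rule ex1I[of _ "L k"])
      show "L k \<in> ?A i \<and> Q \<subseteq> L k" using kA Pk by blast
    next
      fix l assume "l \<in> ?A i \<and> Q \<subseteq> l"
      then obtain k' where k': "k' \<in> {q * (i - 1) + 1..q * i}" "l = L k'" "Q \<subseteq> L k'" by blast
      then have k'3: "k' \<in> {1..3 * q}" using sub[OF i] by blast
      have "(k' - 1) div q = i - 1"
        using k'(1) q i class_iff[of q i k'] by (auto simp: atLeastAtMost_iff)
      moreover have "bracket (a k) (a k') (a m) = 0"
        using Pk k'(3) k(1,2) k'3 crc[OF rc(1,2)]
        by (intro bracket_eq_0_of_common_point[of "cross (a c) (a (q + r))"])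
           (simp_all add: Lk rc(3) P_def span_subset_line_of)
      ultimately have "k = k'" using net_bracket_ne_0[OF a q k(1) k'3 k(2)] k by auto
      then show "l = L k" using k'(2) by simp
    qed
  qed
  then have "labeled_net3 q L"
    using net_coordinates_ne_0[OF a q] by (auto simp: labeled_net3_def L_def proj_lines_def)
  moreover have "\<exists>Q\<in>proj_points. Q \<subseteq> L c \<and> Q \<subseteq> L (q + r) \<and> Q \<subseteq> L (2 * q + M r c)"
    if "r \<in> {1..q}" "c \<in> {1..q}" for r c
    using that P12[OF that] P13[OF that] crc[OF that] by (intro bexI[of _ "P r c"]) (auto simp: P_def proj_points_def)
  ultimately have "L \<in> nets_with_data q M" by (simp add: nets_with_data_def)
  then show ?thesis by (simp add: L_def)
qed

lemma net_coordinates_proportional: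
  assumes a: "net_coordinates q M a" and M: "latin_square q M"
    and p: "\<And>k. k \<in> {1..3 * q} \<Longrightarrow> proportional (a k) (b k)"
  shows "net_coordinates q M b"
proof -
  have 0: "bracket (a i) (a j) (a k) = 0 \<longleftrightarrow> bracket (b i) (b j) (b k) = 0"
    if ijk: "i \<in> {1..3 * q}" "j \<in> {1..3 * q}" "k \<in> {1..3 * q}" for i j k
  proof -
    obtain r s t where "r \<noteq> 0" "s \<noteq> 0" "t \<noteq> 0" "a i = r *s b i" "a j = s *s b j" "a k = t *s b k"
      using p[OF ijk(1)] p[OF ijk(2)] p[OF ijk(3)] unfolding proportional_def by blast
    then show ?thesis by (simp add: bracket_smult)
  qed
  have "bracket (b c) (b (q + r)) (b (2 * q + M r c)) = 0" if "r \<in> {1..q}" "c \<in> {1..q}" for r c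
    using a that latin_square_mem[OF M that] by (subst 0[symmetric]) (auto simp: net_coordinates_def)
  moreover have "bracket (b k) (b k') (b m) \<noteq> 0"
    if "k \<in> {1..3 * q}" "k' \<in> {1..3 * q}" "m \<in> {1..3 * q}"
      "(k - 1) div q = (k' - 1) div q" "k \<noteq> k'" "(m - 1) div q \<noteq> (k - 1) div q" for k k' m
    using a that 0[OF that(1-3)] unfolding net_coordinates_def by blast
  ultimately show ?thesis by (simp add: net_coordinates_def)
qed

lemma net_coordinates_matrix:
  fixes T :: "'a::field ^ 3 ^ 3"
  assumes "net_coordinates q M a" "invertible T"
  shows "net_coordinates q M (\<lambda>k. T *v a k)"
  using assms by (auto simp: net_coordinates_def bracket_matrix invertible_det_nz)

definition net_of :: "nat \<Rightarrow> (nat \<Rightarrow> 'a::field ^ 3) \<Rightarrow> nat \<Rightarrow> ('a ^ 3) set" where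
  "net_of q a = (\<lambda>k\<in>{1..3 * q}. line_of (a k))"

lemma obtain_net_coordinates:
  assumes "L \<in> nets_with_data q M" "latin_square q M"
  obtains a where "net_coordinates q M a" "L = net_of q a" "2 \<le> q"
proof -
  have L: "L \<in> {1..3 * q} \<rightarrow>\<^sub>E proj_lines" and q: "2 \<le> q"
    using assms(1) by (auto simp: nets_with_data_def labeled_net3_def net3_def)
  have "\<forall>k\<in>{1..3 * q}. \<exists>a. a \<noteq> 0 \<and> L k = line_of a"
    using PiE_mem[OF L] unfolding proj_lines_def by blast
  then obtain a where a: "\<And>k. k \<in> {1..3 * q} \<Longrightarrow> a k \<noteq> 0 \<and> L k = line_of (a k)" by metis
  then have "net_coordinates q M a" using net_imp_coordinates[OF assms(1) _ assms(2)] by blast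
  moreover have "L = net_of q a"
    using L a by (auto simp: net_of_def restrict_def PiE_def extensional_def fun_eq_iff)
  ultimately show thesis using that q by blast
qed

lemma quaternion_bracket_0:
  assumes "net_coordinates 8 quaternion_square a" "c \<in> {1..8}" "j \<in> {9..16}"
    "16 + quaternion_square (j - 8) c = k"
  shows "bracket (a c) (a j) (a k) = 0"
proof -
  have "bracket (a c) (a (8 + (j - 8))) (a (2 * 8 + quaternion_square (j - 8) c)) = 0"
    using assms by (intro net_bracket_0[OF assms(1)]) auto
  then show ?thesis using assms(3,4) by simp
qed

lemma quaternion_bracket_ne_0:
  assumes "net_coordinates 8 quaternion_square a" "k \<in> {1..24}" "k' \<in> {1..24}" "m \<in> {1..24}"
    "(k - 1) div 8 = (k' - 1) div 8" "k \<noteq> k'" "(m - 1) div 8 \<noteq> (k - 1) div 8"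
  shows "bracket (a k) (a k') (a m) \<noteq> 0"
  using assms by (intro net_bracket_ne_0[OF assms(1)]) auto

lemma atLeastAtMost_24:
  "{1..24} = {1, 2, 3, 4, 5, 6, 7, 8, 9, 10, 11, 12, 13, 14, 15, 16, 17, 18, 19, 20, 21, 22, 23, 24 :: nat}"
proof -
  have "{1..24} = {1..8} \<union> ({9..16} \<union> {17..24 :: nat})" by auto
  moreover have "{1..8} = {1, 2, 3, 4, 5, 6, 7, 8 :: nat}" by auto
  moreover have "{9..16} = {9, 10, 11, 12, 13, 14, 15, 16 :: nat}" by auto
  moreover have "{17..24} = {17, 18, 19, 20, 21, 22, 23, 24 :: nat}" by auto
  ultimately show ?thesis by (simp only: Un_insert_left Un_empty_left)
qed

section \<open>The nets attached to rotations\<close>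

definition nrm :: "'a::field ^ 3 \<Rightarrow> 'a" where
  "nrm u = 1 + (u$1)^2 + (u$2)^2 + (u$3)^2"

text \<open>\<open>rot_x u\<close>, \<open>rot_y u\<close> and \<open>rot_z u\<close>, divided by \<open>nrm u\<close>, are the rows of the rotation matrix of
  the quaternion with real part 1 and imaginary part \<open>u\<close>, which is the Cayley transform of a
  skew-symmetric matrix whose entries are, up to sign, the components of \<open>u\<close>.\<close>

definition rot_x :: "'a::field ^ 3 \<Rightarrow> 'a ^ 3" where
  "rot_x u = vector [1 + (u$1)^2 - (u$2)^2 - (u$3)^2, 2 * u$1 * u$2 - 2 * u$3, 2 * u$1 * u$3 + 2 * u$2]"

definition rot_y :: "'a::field ^ 3 \<Rightarrow> 'a ^ 3" where
  "rot_y u = vector [2 * u$1 * u$2 + 2 * u$3, 1 - (u$1)^2 + (u$2)^2 - (u$3)^2, 2 * u$2 * u$3 - 2 * u$1]"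

definition rot_z :: "'a::field ^ 3 \<Rightarrow> 'a ^ 3" where
  "rot_z u = vector [2 * u$1 * u$3 - 2 * u$2, 2 * u$2 * u$3 + 2 * u$1, 1 - (u$1)^2 - (u$2)^2 + (u$3)^2]"

text \<open>With \<open>x\<close>, \<open>y\<close>, \<open>z\<close> for the coordinate forms, the entries 3, 6, 13, 16, 20 and 23 are \<open>x \<plusminus> y\<close>,
  \<open>y \<plusminus> z\<close> and \<open>x \<plusminus> z\<close>. The others are grouped in three Klein subsquares, one for each of the forms
  \<open>p\<close>, \<open>q\<close>, \<open>r\<close>. The Latin square fixes the signs up to the choice of the signs of the three forms,
  and these are chosen such that \<open>p\<close>, \<open>q\<close>, \<open>r\<close> will be the rows of a rotation in this order. The
  factor \<open>n\<close> clears the denominators of the Cayley transform.\<close>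

definition frame_net :: "'a::field \<Rightarrow> 'a ^ 3 \<Rightarrow> 'a ^ 3 \<Rightarrow> 'a ^ 3 \<Rightarrow> nat \<Rightarrow> 'a ^ 3" where
  "frame_net n p q r k =
     (let x = vector [n, 0, 0]; y = vector [0, n, 0]; z = vector [0, 0, n] in
      [z + p, z - p, vector [1, -1, 0], z + q, z - r, vector [1, 1, 0], z - q, z + r,
       x - q, x + q, x - r, x - p, vector [0, 1, -1], x + r, x + p, vector [0, 1, 1],
       y + r, y - r, y - q, vector [1, 0, 1], y + p, y + q, vector [1, 0, -1], y - p] ! (k - 1))"

definition rotation_net :: "'a::field ^ 3 \<Rightarrow> nat \<Rightarrow> 'a ^ 3" where
  "rotation_net u = frame_net (nrm u) (rot_x u) (rot_y u) (rot_z u)"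

text \<open>If a matrix agrees with its matrix of cofactors, then the terms of the expansions cancel in pairs.\<close>

lemma four_brackets_conv:
  fixes p q r a b c :: "'a::field ^ 3"
  assumes "bracket a b c = bracket p q r" "bracket a q r = bracket p b c"
    "bracket p b r = bracket a q c" "bracket p q c = bracket a b r"
  shows "bracket (p - a) (q - b) (r - c) = 0" "bracket (p - a) (q + b) (r + c) = 0"
    "bracket (p + a) (q - b) (r + c) = 0" "bracket (p + a) (q + b) (r - c) = 0"
  by (simp_all add: bracket_add assms)

lemma rotation_cofactors:
  fixes u :: "'a::field ^ 3"
  defines "n \<equiv> nrm u" and "p \<equiv> rot_x u" and "q \<equiv> rot_y u" and "r \<equiv> rot_z u"
  shows "n * p$1 = q$2 * r$3 - q$3 * r$2" "n * p$2 = q$3 * r$1 - q$1 * r$3" "n * p$3 = q$1 * r$2 - q$2 * r$1"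
      "n * q$1 = r$2 * p$3 - r$3 * p$2" "n * q$2 = r$3 * p$1 - r$1 * p$3" "n * q$3 = r$1 * p$2 - r$2 * p$1"
      "n * r$1 = p$2 * q$3 - p$3 * q$2" "n * r$2 = p$3 * q$1 - p$1 * q$3" "n * r$3 = p$1 * q$2 - p$2 * q$1"
      "bracket p q r = n * (n * n)"
  unfolding n_def p_def q_def r_def nrm_def rot_x_def rot_y_def rot_z_def bracket_def vector_3
  by algebra+

text \<open>Four of the 64 incidences concern \<open>x \<plusminus> y\<close>, \<open>y \<plusminus> z\<close>, \<open>x \<plusminus> z\<close> only, and 36 of them hold because of
  linear relations such as \<open>(x + p) - (y + p) = x - y\<close>. The remaining 24 belong to the six ways of
  distributing \<open>p\<close>, \<open>q\<close>, \<open>r\<close> over the three classes and use that a rotation equals its matrix of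
  cofactors. An odd permutation of the rows changes the sign of the determinant, which is why the
  signs of the lines are opposite for the odd distributions.\<close>

lemma frame_net_concurrent:
  fixes p q r :: "'a::field ^ 3"
  assumes cof: "n * p$1 = q$2 * r$3 - q$3 * r$2" "n * p$2 = q$3 * r$1 - q$1 * r$3" "n * p$3 = q$1 * r$2 - q$2 * r$1"
      "n * q$1 = r$2 * p$3 - r$3 * p$2" "n * q$2 = r$3 * p$1 - r$1 * p$3" "n * q$3 = r$1 * p$2 - r$2 * p$1"
      "n * r$1 = p$2 * q$3 - p$3 * q$2" "n * r$2 = p$3 * q$1 - p$1 * q$3" "n * r$3 = p$1 * q$2 - p$2 * q$1"
    and det: "bracket p q r = n * (n * n)"
    and k: "k \<in> {1..8}" "c \<in> {1..8}"
  shows "bracket (frame_net n p q r c) (frame_net n p q r (8 + k))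
    (frame_net n p q r (2 * 8 + quaternion_square k c)) = 0"
proof -
  define x y z :: "'a ^ 3" where xyz: "x = vector [n, 0, 0]" "y = vector [0, n, 0]" "z = vector [0, 0, n]"
  note F = frame_net_def Let_def xyz[symmetric]
  have perm: "bracket r p q = bracket p q r" "bracket q r p = bracket p q r" "bracket p r q = - bracket p q r"
    "bracket q p r = - bracket p q r" "bracket r q p = - bracket p q r"
    by (simp_all add: bracket_def algebra_simps)
  have e1: "bracket v x y = n * (n * v$3)" "bracket z v y = n * (n * v$1)" "bracket z x v = n * (n * v$2)" for v
    by (simp_all add: xyz bracket_def algebra_simps)
  have e2: "bracket z v w = n * (v$1 * w$2 - v$2 * w$1)" "bracket v x w = n * (w$2 * v$3 - w$3 * v$2)"
    "bracket v w y = n * (v$3 * w$1 - v$1 * w$3)" for v w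
    by (simp_all add: xyz bracket_def algebra_simps)
  have zz: "z$3 = n" by (simp add: xyz)
  have zxy: "bracket z x y = n * (n * n)" by (simp add: xyz bracket_def)
  have B1: "bracket (z - r) (x - p) (y - q) = 0" "bracket (z - r) (x + p) (y + q) = 0"
    "bracket (z + r) (x - p) (y + q) = 0" "bracket (z + r) (x + p) (y - q) = 0"
    by (rule four_brackets_conv; simp only: e1 zxy perm det; simp add: zz e2 cof)+
  have B2: "bracket (z - p) (x - q) (y - r) = 0" "bracket (z - p) (x + q) (y + r) = 0"
    "bracket (z + p) (x - q) (y + r) = 0" "bracket (z + p) (x + q) (y - r) = 0"
    by (rule four_brackets_conv; simp only: e1 zxy perm det; simp add: zz e2 cof)+
  have B3: "bracket (z - q) (x - r) (y - p) = 0" "bracket (z - q) (x + r) (y + p) = 0"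
    "bracket (z + q) (x - r) (y + p) = 0" "bracket (z + q) (x + r) (y - p) = 0"
    by (rule four_brackets_conv; simp only: e1 zxy perm det; simp add: zz e2 cof)+
  have odd: "bracket (z + a) (x + b) (y + c) = 0" "bracket (z + a) (x - b) (y - c) = 0"
    "bracket (z - a) (x + b) (y - c) = 0" "bracket (z - a) (x - b) (y + c) = 0"
    if "bracket a b c = - (n * (n * n))" "bracket a x y = - bracket z b c"
       "bracket z b y = - bracket a x c" "bracket z x c = - bracket a b y" for a b c
    by (simp_all add: bracket_add that zxy)
  have B4: "bracket (z + p) (x + r) (y + q) = 0" "bracket (z + p) (x - r) (y - q) = 0"
    "bracket (z - p) (x + r) (y - q) = 0" "bracket (z - p) (x - r) (y + q) = 0"
    by (rule odd; simp only: e1 perm det; simp add: zz e2 cof algebra_simps)+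
  have B5: "bracket (z + q) (x + p) (y + r) = 0" "bracket (z + q) (x - p) (y - r) = 0"
    "bracket (z - q) (x + p) (y - r) = 0" "bracket (z - q) (x - p) (y + r) = 0"
    by (rule odd; simp only: e1 perm det; simp add: zz e2 cof algebra_simps)+
  have B6: "bracket (z + r) (x + q) (y + p) = 0" "bracket (z + r) (x - q) (y - p) = 0"
    "bracket (z - r) (x + q) (y - p) = 0" "bracket (z - r) (x - q) (y + p) = 0"
    by (rule odd; simp only: e1 perm det; simp add: zz e2 cof algebra_simps)+
  have special: "bracket (vector [1, -1, 0]) (x + v) (y + v) = 0" "bracket (vector [1, -1, 0]) (x - v) (y - v) = 0"
    "bracket (vector [1, 1, 0]) (x + v) (y - v) = 0" "bracket (vector [1, 1, 0]) (x - v) (y + v) = 0"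
    "bracket (z + v) (vector [0, 1, -1]) (y + v) = 0" "bracket (z - v) (vector [0, 1, -1]) (y - v) = 0"
    "bracket (z + v) (vector [0, 1, 1]) (y - v) = 0" "bracket (z - v) (vector [0, 1, 1]) (y + v) = 0"
    "bracket (z + v) (x + v) (vector [1, 0, -1]) = 0" "bracket (z - v) (x - v) (vector [1, 0, -1]) = 0"
    "bracket (z + v) (x - v) (vector [1, 0, 1]) = 0" "bracket (z - v) (x + v) (vector [1, 0, 1]) = 0"
    for v
    by (simp_all add: xyz bracket_def algebra_simps)
  have special': "bracket (vector [1, -1, 0]) (vector [0, 1, -1]) (vector [1, 0, -1] :: 'a ^ 3) = 0"
    "bracket (vector [1, -1, 0]) (vector [0, 1, 1]) (vector [1, 0, 1] :: 'a ^ 3) = 0"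
    "bracket (vector [1, 1, 0]) (vector [0, 1, -1]) (vector [1, 0, 1] :: 'a ^ 3) = 0"
    "bracket (vector [1, 1, 0]) (vector [0, 1, 1]) (vector [1, 0, -1] :: 'a ^ 3) = 0"
    by (simp_all add: bracket_def)
  have "{1..8} = {1, 2, 3, 4, 5, 6, 7, 8 :: nat}" by auto
  then have "k \<in> {1, 2, 3, 4, 5, 6, 7, 8}" "c \<in> {1, 2, 3, 4, 5, 6, 7, 8}" using k by auto
  then show ?thesis
    by (elim insertE emptyE)
      (simp_all add: quaternion_square_def F B1 B2 B3 B4 B5 B6 special special')
qed

lemma rotation_net_concurrent:
  assumes "r \<in> {1..8}" "c \<in> {1..8}"
  shows "bracket (rotation_net u c) (rotation_net u (8 + r)) (rotation_net u (2 * 8 + quaternion_square r c)) = 0"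
  unfolding rotation_net_def using assms by (rule frame_net_concurrent[OF rotation_cofactors])

section \<open>Every net with the given data comes from a rotation\<close>

text \<open>The subnet belongs to the multiplication table of the Klein four-group. As \<open>C\<close> is in the pencil of
  \<open>x - y\<close> and \<open>B\<close>, scaling brings these two lines into the form \<open>y - l\<close> and \<open>x - l\<close>. Each of the
  other lines then belongs to two known pencils, and so does the line claimed for it.\<close>

lemma klein_subnet_form:
  fixes x y z :: "'a::field ^ 3"
  assumes nz: "A \<noteq> 0" "A' \<noteq> 0" "B' \<noteq> 0" "C' \<noteq> 0"
    and C: "bracket (x - y) B C = 0" "cross (x - y) B \<noteq> 0" "cross (x - y) C \<noteq> 0" "cross B C \<noteq> 0"
    and A': "bracket A' B (x - z) = 0" "bracket A' C (y - z) = 0" "bracket B (x - z) (y - z) \<noteq> 0"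
      "cross C (y - z) \<noteq> 0"
    and A: "bracket A B (x + z) = 0" "bracket A C (y + z) = 0" "bracket B (x + z) (y + z) \<noteq> 0"
      "cross C (y + z) \<noteq> 0"
    and B': "bracket B' A (x - z) = 0" "bracket B' A' (x + z) = 0" "bracket A (x - z) A' \<noteq> 0"
      "cross A' (x + z) \<noteq> 0"
    and C': "bracket C' A (y - z) = 0" "bracket C' A' (y + z) = 0" "bracket A (y - z) A' \<noteq> 0"
      "cross A' (y + z) \<noteq> 0"
  shows "\<exists>l. proportional A (z + l) \<and> proportional A' (z - l) \<and> proportional B (x - l) \<and>
    proportional B' (x + l) \<and> proportional C (y - l) \<and> proportional C' (y + l)"
proof -
  obtain s t where st: "C = s *s (x - y) + t *s B" using in_pencil[OF C(2,1)] by blast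
  have self: "cross w w = 0" for w :: "'a ^ 3" by (simp add: vec3_eq_iff cross_def)
  have "s \<noteq> 0"
  proof
    assume "s = 0"
    then have "C = t *s B" using st by simp
    then show False using C(4) by (simp add: cross_smult self)
  qed
  have "t \<noteq> 0"
  proof
    assume "t = 0"
    then have *: "C = s *s (x - y)" using st by simp
    then show False using C(3) unfolding * cross_smult self by simp
  qed
  \<comment> \<open>The form \<open>l\<close> is such that \<open>B\<close> and \<open>C\<close> become multiples of \<open>x - l\<close> and \<open>y - l\<close>.\<close>
  define l where "l = x + (t / s) *s B"
  define b c where "b = x - l" and "c = y - l"
  define \<beta> where "\<beta> = - (s / t)"
  have B: "B = \<beta> *s b" "\<beta> \<noteq> 0"
    using \<open>s \<noteq> 0\<close> \<open>t \<noteq> 0\<close> by (auto simp: b_def l_def \<beta>_def vec3_eq_iff)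
  define \<gamma> where "\<gamma> = - s"
  have C: "C = \<gamma> *s c" "\<gamma> \<noteq> 0"
    using \<open>s \<noteq> 0\<close> by (auto simp: \<gamma>_def st c_def l_def vec3_eq_iff field_simps)
  have crs: "cross c w \<noteq> 0" if "cross C w \<noteq> 0" for w
    using that unfolding C(1) cross_smult by auto
  have "proportional A' (z - l)"
  proof (rule proportional_if_in_two_pencils[where p = b and q = "x - z" and r = c and s = "y - z"])
    have e: "z - l = b - (x - z)" "z - l = c - (y - z)" by (simp_all add: b_def c_def)
    show "bracket (z - l) b (x - z) = 0" unfolding e(1) by (simp add: bracket_add(4))
    show "bracket (z - l) c (y - z) = 0" unfolding e(2) by (simp add: bracket_add(4))
    have "c = b - (x - z) + (y - z)" by (simp add: b_def c_def)
    then have "bracket b (x - z) c = bracket b (x - z) (y - z)" by (simp only: bracket_add bracket_same) simp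
    moreover have "bracket b (x - z) (y - z) \<noteq> 0"
      using A'(3) unfolding B(1) by (auto simp: bracket_smult)
    ultimately show "bracket b (x - z) c \<noteq> 0" by simp
    then show "z - l \<noteq> 0" unfolding e(1) by auto
  qed (use nz A' B C crs in \<open>auto simp: bracket_smult\<close>)
  moreover have "proportional A (z + l)"
  proof (rule proportional_if_in_two_pencils[where p = b and q = "x + z" and r = c and s = "y + z"])
    have e: "z + l = (x + z) - b" "z + l = (y + z) - c" by (simp_all add: b_def c_def)
    show "bracket (z + l) b (x + z) = 0" unfolding e(1) by (simp add: bracket_add(4))
    show "bracket (z + l) c (y + z) = 0" unfolding e(2) by (simp add: bracket_add(4))
    have "c = (y + z) - ((x + z) - b)" by (simp add: b_def c_def)
    then have "bracket b (x + z) c = bracket b (x + z) (y + z)" by (simp only: bracket_add bracket_same) simp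
    moreover have "bracket b (x + z) (y + z) \<noteq> 0"
      using A(3) unfolding B(1) by (auto simp: bracket_smult)
    ultimately show "bracket b (x + z) c \<noteq> 0" by simp
    then show "z + l \<noteq> 0" unfolding e(1) by auto
  qed (use nz A B C crs in \<open>auto simp: bracket_smult\<close>)
  ultimately obtain \<alpha> \<alpha>' where \<alpha>: "\<alpha> \<noteq> 0" "A = \<alpha> *s (z + l)" "\<alpha>' \<noteq> 0" "A' = \<alpha>' *s (z - l)"
    unfolding proportional_def by blast
  define a a' where "a = z + l" and "a' = z - l"
  note \<alpha> = \<alpha>[folded a_def a'_def]
  have crs': "cross a' w \<noteq> 0" if "cross A' w \<noteq> 0" for w
    using that unfolding \<alpha> cross_smult by auto
  have "proportional B' (x + l)"
  proof (rule proportional_if_in_two_pencils[where p = "a" and q = "x - z" and r = "a'" and s = "x + z"])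
    have e: "x + l = a + (x - z)" "x + l = (x + z) - a'" by (simp_all add: a_def a'_def)
    show "bracket (x + l) a (x - z) = 0" unfolding e(1) by (simp only: bracket_add(1) bracket_same) simp
    show "bracket (x + l) a' (x + z) = 0" unfolding e(2) by (simp only: bracket_add(4) bracket_same) simp
    show ne: "bracket a (x - z) a' \<noteq> 0"
      using B'(3) unfolding \<alpha> by (auto simp: bracket_smult)
    show "x + l \<noteq> 0"
    proof
      assume "x + l = 0"
      then have "a = (- 1) *s (x - z)" unfolding e(1) by (simp add: a_def vec3_eq_iff eq_neg_iff_add_eq_0 add.commute)
      then have "bracket a (x - z) a' = 0" by (simp only: bracket_smult bracket_same mult_zero_right)
      with ne show False by simp
    qed
  qed (use nz B' \<alpha> crs' in \<open>auto simp: bracket_smult\<close>)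
  moreover have "proportional C' (y + l)"
  proof (rule proportional_if_in_two_pencils[where p = "a" and q = "y - z" and r = "a'" and s = "y + z"])
    have e: "y + l = a + (y - z)" "y + l = (y + z) - a'" by (simp_all add: a_def a'_def)
    show "bracket (y + l) a (y - z) = 0" unfolding e(1) by (simp only: bracket_add(1) bracket_same) simp
    show "bracket (y + l) a' (y + z) = 0" unfolding e(2) by (simp only: bracket_add(4) bracket_same) simp
    show ne: "bracket a (y - z) a' \<noteq> 0"
      using C'(3) unfolding \<alpha> by (auto simp: bracket_smult)
    show "y + l \<noteq> 0"
    proof
      assume "y + l = 0"
      then have "a = (- 1) *s (y - z)" unfolding e(1) by (simp add: a_def vec3_eq_iff eq_neg_iff_add_eq_0 add.commute)
      then have "bracket a (y - z) a' = 0" by (simp only: bracket_smult bracket_same mult_zero_right)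
      with ne show False by simp
    qed
  qed (use nz C' \<alpha> crs' in \<open>auto simp: bracket_smult\<close>)
  ultimately show ?thesis
    using \<alpha> B C unfolding proportional_def b_def c_def a_def a'_def by blast
qed

text \<open>Adding up the four expansions with the signs of a character of the Klein four-group leaves only two
  terms. For the basis vectors \<open>p\<close>, \<open>q\<close>, \<open>r\<close> these are the determinant of the rows \<open>a\<close>, \<open>b\<close>, \<open>c\<close> and the
  constant 1, or an entry and its cofactor.\<close>

lemma four_brackets:
  fixes p q r a b c :: "'a::field_char_0 ^ 3"
  assumes "bracket (p - a) (q - b) (r - c) = 0" "bracket (p - a) (q + b) (r + c) = 0"
    "bracket (p + a) (q - b) (r + c) = 0" "bracket (p + a) (q + b) (r - c) = 0"
  shows "bracket a b c = bracket p q r" "bracket a q r = bracket p b c"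
    "bracket p b r = bracket a q c" "bracket p q c = bracket a b r"
proof -
  let ?e1 = "bracket (p - a) (q - b) (r - c)" and ?e2 = "bracket (p - a) (q + b) (r + c)"
    and ?e3 = "bracket (p + a) (q - b) (r + c)" and ?e4 = "bracket (p + a) (q + b) (r - c)"
  have "?e1 + ?e2 + ?e3 + ?e4 = 4 * (bracket p q r - bracket a b c)"
    "?e1 + ?e2 - ?e3 - ?e4 = 4 * (bracket p b c - bracket a q r)"
    "?e1 - ?e2 + ?e3 - ?e4 = 4 * (bracket a q c - bracket p b r)"
    "?e1 - ?e2 - ?e3 + ?e4 = 4 * (bracket a b r - bracket p q c)"
    by (simp_all add: bracket_add algebra_simps)
  then show "bracket a b c = bracket p q r" "bracket a q r = bracket p b c"
    "bracket p b r = bracket a q c" "bracket p q c = bracket a b r"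
    unfolding assms by simp_all
qed

text \<open>A matrix that equals its matrix of cofactors and has determinant 1 is a rotation. With \<open>t\<close> for 1
  plus its trace and \<open>p\<close>, \<open>q\<close>, \<open>r\<close> for its skew part, \<open>(t, p, q, r)\<close> is a multiple of the quaternion
  of the rotation; it can be scaled to real part 1 iff \<open>t\<close> does not vanish.\<close>

lemma cayley:
  fixes a1 a2 a3 b1 b2 b3 c1 c2 c3 :: "'a::field_char_0"
  assumes cof: "a1 = b2 * c3 - b3 * c2" "a2 = b3 * c1 - b1 * c3" "a3 = b1 * c2 - b2 * c1"
      "b1 = c2 * a3 - c3 * a2" "b2 = c3 * a1 - c1 * a3" "b3 = c1 * a2 - c2 * a1"
      "c1 = a2 * b3 - a3 * b2" "c2 = a3 * b1 - a1 * b3" "c3 = a1 * b2 - a2 * b1"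
    and det: "a1 * (b2 * c3 - b3 * c2) + a2 * (b3 * c1 - b1 * c3) + a3 * (b1 * c2 - b2 * c1) = 1"
    and ne: "1 + a1 + b2 + c3 \<noteq> 0"
  shows "\<exists>u. nrm u \<noteq> 0 \<and> rot_x u = nrm u *s vector [a1, a2, a3] \<and>
    rot_y u = nrm u *s vector [b1, b2, b3] \<and> rot_z u = nrm u *s vector [c1, c2, c3]"
proof -
  define t where "t = 1 + a1 + b2 + c3"
  define p q r where "p = c2 - b3" and "q = a3 - c1" and "r = b1 - a2"
  have rows: "a1^2 + a2^2 + a3^2 = 1" "b1^2 + b2^2 + b3^2 = 1" "c1^2 + c2^2 + c3^2 = 1"
    "a1 * b1 + a2 * b2 + a3 * b3 = 0" "a1 * c1 + a2 * c2 + a3 * c3 = 0" "b1 * c1 + b2 * c2 + b3 * c3 = 0"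
    using cof det by algebra+
  have cols: "a1 * a2 + b1 * b2 + c1 * c2 = 0" "a1 * a3 + b1 * b3 + c1 * c3 = 0"
    "a2 * a3 + b2 * b3 + c2 * c3 = 0"
    "a1^2 + b1^2 + c1^2 = 1" "a2^2 + b2^2 + c2^2 = 1" "a3^2 + b3^2 + c3^2 = 1"
    using cof det by algebra+
  have N: "t^2 + p^2 + q^2 + r^2 = 4 * t"
    using rows(1-3) cof(1,5,9) unfolding t_def p_def q_def r_def by algebra
  have d: "t^2 + p^2 - q^2 - r^2 = 4 * t * a1" "t^2 - p^2 + q^2 - r^2 = 4 * t * b2"
     "t^2 - p^2 - q^2 + r^2 = 4 * t * c3"
    using rows cols cof unfolding t_def p_def q_def r_def by algebra+
  have s: "p * q = t * (a2 + b1)" "p * r = t * (a3 + c1)" "q * r = t * (b3 + c2)"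
    using rows cols cof unfolding t_def p_def q_def r_def by algebra+
  have t: "t \<noteq> 0" using ne by (simp add: t_def)
  define u :: "'a ^ 3" where "u = vector [p / t, q / t, r / t]"
  have "nrm u = (t^2 + p^2 + q^2 + r^2) / t^2" using t by (simp add: nrm_def u_def field_simps)
  also have "\<dots> = 4 / t" unfolding N using t by (simp add: field_simps power2_eq_square)
  finally have nrm: "nrm u = 4 / t" .
  have diag: "1 + (p/t)^2 - (q/t)^2 - (r/t)^2 = 4 / t * a1" "1 - (p/t)^2 + (q/t)^2 - (r/t)^2 = 4 / t * b2"
     "1 - (p/t)^2 - (q/t)^2 + (r/t)^2 = 4 / t * c3"
  proof -
    have "1 + (p/t)^2 - (q/t)^2 - (r/t)^2 = (t^2 + p^2 - q^2 - r^2) / t^2"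
      "1 - (p/t)^2 + (q/t)^2 - (r/t)^2 = (t^2 - p^2 + q^2 - r^2) / t^2"
      "1 - (p/t)^2 - (q/t)^2 + (r/t)^2 = (t^2 - p^2 - q^2 + r^2) / t^2"
      using t by (simp_all add: field_simps)
    then show "1 + (p/t)^2 - (q/t)^2 - (r/t)^2 = 4 / t * a1" "1 - (p/t)^2 + (q/t)^2 - (r/t)^2 = 4 / t * b2"
     "1 - (p/t)^2 - (q/t)^2 + (r/t)^2 = 4 / t * c3"
      unfolding d using t by (simp_all add: field_simps power2_eq_square)
  qed
  have off: "2 * (p/t) * (q/t) = 2 * (a2 + b1) / t" "2 * (p/t) * (r/t) = 2 * (a3 + c1) / t"
    "2 * (q/t) * (r/t) = 2 * (b3 + c2) / t"
  proof -
    have "2 * (p/t) * (q/t) = 2 * (p * q) / t^2" "2 * (p/t) * (r/t) = 2 * (p * r) / t^2"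
      "2 * (q/t) * (r/t) = 2 * (q * r) / t^2"
      by (simp_all add: power2_eq_square)
    then show "2 * (p/t) * (q/t) = 2 * (a2 + b1) / t" "2 * (p/t) * (r/t) = 2 * (a3 + c1) / t"
    "2 * (q/t) * (r/t) = 2 * (b3 + c2) / t"
      unfolding s using t by (simp_all add: power2_eq_square)
  qed
  have "2 * (p/t) = 2 * (c2 - b3) / t" "2 * (q/t) = 2 * (a3 - c1) / t" "2 * (r/t) = 2 * (b1 - a2) / t"
    by (simp_all add: p_def q_def r_def)
  note lin = this
  have u: "u$1 = p / t" "u$2 = q / t" "u$3 = r / t" by (simp_all add: u_def)
  have "rot_x u = nrm u *s vector [a1, a2, a3]" "rot_y u = nrm u *s vector [b1, b2, b3]"
    "rot_z u = nrm u *s vector [c1, c2, c3]"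
    unfolding rot_x_def rot_y_def rot_z_def nrm u diag off
    unfolding lin by (simp_all add: vec3_eq_iff add_divide_distrib diff_divide_distrib algebra_simps)
  moreover have "nrm u \<noteq> 0" using nrm t by simp
  ultimately show ?thesis by blast
qed

text \<open>The lines \<open>i\<close>, \<open>i'\<close>, \<open>j\<close>, \<open>j'\<close>, \<open>k\<close>, \<open>k'\<close> belong to two columns, two rows and two symbols that
  extend the columns 3 and 6, the rows 5 and 8 and the symbols 4 and 7 to a Klein subsquare.\<close>

lemma klein_subnet_of_net:
  fixes b :: "nat \<Rightarrow> 'a::field ^ 3"
  assumes b: "net_coordinates 8 quaternion_square b"
    and xyz: "b 3 = x - y" "b 13 = y - z" "b 16 = y + z" "b 20 = x + z" "b 23 = x - z"
    and ijk: "i \<in> {1..8}" "i' \<in> {1..8}" "j \<in> {9..16}" "j' \<in> {9..16}" "k \<in> {17..24}" "k' \<in> {17..24}"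
    and neq: "i \<noteq> i'" "j \<noteq> 13" "j \<noteq> 16"
    and conc: "16 + quaternion_square (j - 8) 3 = k" "16 + quaternion_square (j - 8) i' = 23"
      "16 + quaternion_square 5 i' = k" "16 + quaternion_square (j - 8) i = 20"
      "16 + quaternion_square 8 i = k" "16 + quaternion_square (j' - 8) i = 23"
      "16 + quaternion_square (j' - 8) i' = 20" "16 + quaternion_square 5 i = k'"
      "16 + quaternion_square 8 i' = k'"
  shows "\<exists>l. proportional (b i) (z + l) \<and> proportional (b i') (z - l) \<and> proportional (b j) (x - l) \<and>
    proportional (b j') (x + l) \<and> proportional (b k) (y - l) \<and> proportional (b k') (y + l)"
proof -
  note zero = quaternion_bracket_0[OF b]
  note ne = quaternion_bracket_ne_0[OF b]
  have cls: "(i - 1) div 8 = 0" "(i' - 1) div 8 = 0" "(j - 1) div 8 = 1" "(j' - 1) div 8 = 1"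
      "(k - 1) div 8 = 2" "(k' - 1) div 8 = 2"
    using ijk by auto
  have in24: "i \<in> {1..24}" "i' \<in> {1..24}" "j \<in> {1..24}" "j' \<in> {1..24}" "k \<in> {1..24}" "k' \<in> {1..24}"
    using ijk by auto
  note in24' = in24[simplified] and cls' = cls[simplified]
  have cr: "cross (b m) (b n) \<noteq> 0" if "m \<in> {1..24}" "n \<in> {1..24}" "m \<noteq> n" for m n
    using net_cross_ne_0[OF b, of m n] that by simp
  have nz: "b m \<noteq> 0" if "m \<in> {1..24}" for m
    using net_coordinates_ne_0[OF b, of m] that by simp
  show ?thesis
    unfolding xyz[symmetric]
  proof (rule klein_subnet_form; (unfold xyz[symmetric])?)
    show "b i \<noteq> 0" "b i' \<noteq> 0" "b j' \<noteq> 0" "b k' \<noteq> 0" using nz in24 by blast+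
    show "bracket (b 3) (b j) (b k) = 0" by (rule zero) (use ijk conc in simp_all)
    show "cross (b 3) (b j) \<noteq> 0" by (rule cr) (use ijk in auto)
    show "cross (b 3) (b k) \<noteq> 0" by (rule cr) (use ijk in auto)
    show "cross (b j) (b k) \<noteq> 0" by (rule cr) (use ijk in auto)
    show "bracket (b i') (b j) (b 23) = 0" by (rule zero) (use ijk conc in simp_all)
    have "bracket (b i') (b 13) (b k) = 0" by (rule zero) (use ijk conc in simp_all)
    then show "bracket (b i') (b k) (b 13) = 0" using bracket_0_permute(1)[of "b i'" "b k" "b 13"] by blast
    have "bracket (b j) (b 13) (b 23) \<noteq> 0" by (rule ne) (simp_all add: in24' cls' neq)
    then show "bracket (b j) (b 23) (b 13) \<noteq> 0" using bracket_0_permute(1)[of "b j" "b 23" "b 13"] by blast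
    show "cross (b k) (b 13) \<noteq> 0" by (rule cr) (use ijk in auto)
    show "bracket (b i) (b j) (b 20) = 0" by (rule zero) (use ijk conc in simp_all)
    have "bracket (b i) (b 16) (b k) = 0" by (rule zero) (use ijk conc in simp_all)
    then show "bracket (b i) (b k) (b 16) = 0" using bracket_0_permute(1)[of "b i" "b k" "b 16"] by blast
    have "bracket (b j) (b 16) (b 20) \<noteq> 0" by (rule ne) (simp_all add: in24' cls' neq)
    then show "bracket (b j) (b 20) (b 16) \<noteq> 0" using bracket_0_permute(1)[of "b j" "b 20" "b 16"] by blast
    show "cross (b k) (b 16) \<noteq> 0" by (rule cr) (use ijk in auto)
    have "bracket (b i) (b j') (b 23) = 0" by (rule zero) (use ijk conc in simp_all)
    then show "bracket (b j') (b i) (b 23) = 0" using bracket_0_permute(2)[of "b j'" "b i" "b 23"] by blast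
    have "bracket (b i') (b j') (b 20) = 0" by (rule zero) (use ijk conc in simp_all)
    then show "bracket (b j') (b i') (b 20) = 0" using bracket_0_permute(2)[of "b j'" "b i'" "b 20"] by blast
    have "bracket (b i) (b i') (b 23) \<noteq> 0" by (rule ne) (simp_all add: in24' cls' neq)
    then show "bracket (b i) (b 23) (b i') \<noteq> 0" using bracket_0_permute(1)[of "b i" "b 23" "b i'"] by blast
    show "cross (b i') (b 20) \<noteq> 0" by (rule cr) (use ijk in auto)
    have "bracket (b i) (b 13) (b k') = 0" by (rule zero) (use ijk conc in simp_all)
    then show "bracket (b k') (b i) (b 13) = 0" using bracket_0_permute(3)[of "b k'" "b i" "b 13"] by blast
    have "bracket (b i') (b 16) (b k') = 0" by (rule zero) (use ijk conc in simp_all)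
    then show "bracket (b k') (b i') (b 16) = 0" using bracket_0_permute(3)[of "b k'" "b i'" "b 16"] by blast
    have "bracket (b i) (b i') (b 13) \<noteq> 0" by (rule ne) (simp_all add: in24' cls' neq)
    then show "bracket (b i) (b 13) (b i') \<noteq> 0" using bracket_0_permute(1)[of "b i" "b 13" "b i'"] by blast
    show "cross (b i') (b 16) \<noteq> 0" by (rule cr) (use ijk in auto)
  qed
qed

text \<open>Twelve of the 24 incidences that mix \<open>p\<close>, \<open>q\<close> and \<open>r\<close>, those of the even distributions, already say
  that the matrix with these rows is a rotation. That 1 plus its trace does not vanish is a
  consequence of nondegeneracy.\<close>

lemma frame_net_rotation:
  fixes p q r :: "'a::field_char_0 ^ 3"
  assumes w: "net_coordinates 8 quaternion_square (frame_net 1 p q r)"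
  shows "\<exists>u. nrm u \<noteq> 0 \<and> rot_x u = nrm u *s p \<and> rot_y u = nrm u *s q \<and> rot_z u = nrm u *s r"
proof -
  define x y z :: "'a ^ 3" where xyz: "x = vector [1, 0, 0]" "y = vector [0, 1, 0]" "z = vector [0, 0, 1]"
  note F = frame_net_def Let_def xyz[symmetric]
  note zero = quaternion_bracket_0[OF w, unfolded F]
  have 1: "bracket (z - r) (x - p) (y - q) = 0" "bracket (z - r) (x + p) (y + q) = 0"
    "bracket (z + r) (x - p) (y + q) = 0" "bracket (z + r) (x + p) (y - q) = 0"
    using zero[of 5 12 19] zero[of 5 15 22] zero[of 8 12 22] zero[of 8 15 19]
    by (simp_all add: quaternion_square_def)
  have 2: "bracket (z - p) (x - q) (y - r) = 0" "bracket (z - p) (x + q) (y + r) = 0"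
    "bracket (z + p) (x - q) (y + r) = 0" "bracket (z + p) (x + q) (y - r) = 0"
    using zero[of 2 9 18] zero[of 2 10 17] zero[of 1 9 17] zero[of 1 10 18]
    by (simp_all add: quaternion_square_def)
  have 3: "bracket (z - q) (x - r) (y - p) = 0" "bracket (z - q) (x + r) (y + p) = 0"
    "bracket (z + q) (x - r) (y + p) = 0" "bracket (z + q) (x + r) (y - p) = 0"
    using zero[of 7 11 24] zero[of 7 14 21] zero[of 4 11 21] zero[of 4 14 24]
    by (simp_all add: quaternion_square_def)
  \<comment> \<open>The lines 8, 15 and 19 are concurrent; the line 22 belongs to the class of 19 and cannot pass
    through the same point.\<close>
  have "bracket (x + p) (y + q) (z + r) \<noteq> 0"
  proof
    assume 0: "bracket (x + p) (y + q) (z + r) = 0"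
    let ?w = "frame_net 1 p q r"
    have "bracket (?w 8) (?w 15) (?w 22) = 0"
      using 0 by (simp add: F bracket_rotate[of "z + r"])
    moreover have "bracket (?w 8) (?w 15) (?w 19) = 0"
      using 1(4) by (simp add: F)
    moreover have "cross (?w 8) (?w 15) \<noteq> 0"
      using net_cross_ne_0[OF w, of 8 15] by simp
    moreover have "bracket (?w 19) (?w 22) (?w 8) \<noteq> 0"
      using quaternion_bracket_ne_0[OF w, of 19 22 8] by simp
    ultimately show False
      using concurrent_trans[of "?w 8" "?w 15" "?w 19" "?w 22"] by blast
  qed
  note ne = this
  note e = four_brackets[OF 1] four_brackets[OF 2] four_brackets[OF 3]
  have cof: "p$1 = q$2 * r$3 - q$3 * r$2" "p$2 = q$3 * r$1 - q$1 * r$3" "p$3 = q$1 * r$2 - q$2 * r$1"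
      "q$1 = r$2 * p$3 - r$3 * p$2" "q$2 = r$3 * p$1 - r$1 * p$3" "q$3 = r$1 * p$2 - r$2 * p$1"
      "r$1 = p$2 * q$3 - p$3 * q$2" "r$2 = p$3 * q$1 - p$1 * q$3" "r$3 = p$1 * q$2 - p$2 * q$1"
    using e unfolding xyz by (simp_all add: bracket_def algebra_simps)
  have det: "p$1 * (q$2 * r$3 - q$3 * r$2) + p$2 * (q$3 * r$1 - q$1 * r$3) + p$3 * (q$1 * r$2 - q$2 * r$1) = 1"
    using e(1) unfolding xyz by (simp add: bracket_def algebra_simps)
  have "bracket (x + p) (y + q) (z + r) = 1 + p$1 + q$2 + r$3 + (q$2 * r$3 - q$3 * r$2)
      + (r$3 * p$1 - r$1 * p$3) + (p$1 * q$2 - p$2 * q$1)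
      + (p$1 * (q$2 * r$3 - q$3 * r$2) + p$2 * (q$3 * r$1 - q$1 * r$3) + p$3 * (q$1 * r$2 - q$2 * r$1))"
    unfolding xyz by (simp add: bracket_def algebra_simps)
  also have "\<dots> = 1 + p$1 + q$2 + r$3 + p$1 + q$2 + r$3 + 1"
    by (intro arg_cong2[where f = "(+)"] refl cof(1)[symmetric] cof(5)[symmetric] cof(9)[symmetric] det)
  also have "\<dots> = 2 * (1 + p$1 + q$2 + r$3)" by simp
  finally have eq: "bracket (x + p) (y + q) (z + r) = 2 * (1 + p$1 + q$2 + r$3)" .
  have "1 + p$1 + q$2 + r$3 \<noteq> 0"
  proof
    assume 0: "1 + p$1 + q$2 + r$3 = 0"
    show False using ne unfolding eq 0 by simp
  qed
  note cayley = cayley[OF cof det this]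
  have vec: "vector [v$1, v$2, v$3] = v" for v :: "'a ^ 3" by (simp add: vec3_eq_iff)
  show ?thesis using cayley unfolding vec .
qed

text \<open>The lines 3, 6, 13 and 16 are a frame. They determine the lines 20 and 23, then the three Klein
  subsquares provide the forms \<open>p\<close>, \<open>q\<close>, \<open>r\<close>, and the Cayley transform provides \<open>u\<close>.\<close>

lemma rotation_net_normal_form:
  fixes b :: "nat \<Rightarrow> 'a::field_char_0 ^ 3"
  assumes b: "net_coordinates 8 quaternion_square b"
    and frame: "proportional (b 3) (vector [1, -1, 0])" "proportional (b 6) (vector [1, 1, 0])"
      "proportional (b 13) (vector [0, 1, -1])" "proportional (b 16) (vector [0, 1, 1])"
  shows "\<exists>u. \<forall>k\<in>{1..24}. proportional (b k) (rotation_net u k)"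
proof -
  define x y z :: "'a ^ 3" where xyz: "x = vector [1, 0, 0]" "y = vector [0, 1, 0]" "z = vector [0, 0, 1]"
  have sums: "vector [1, -1, 0] = x - y" "vector [1, 1, 0] = x + y" "vector [0, 1, -1] = y - z"
    "vector [0, 1, 1] = y + z" "vector [1, 0, -1] = x - z" "vector [1, 0, 1] = x + z"
    by (simp_all add: xyz vec3_eq_iff)
  note frame = frame[unfolded sums]
  note zero = quaternion_bracket_0[OF b]
  have nz: "b m \<noteq> 0" if "m \<in> {1..24}" for m
    using net_coordinates_ne_0[OF b, of m] that by simp
  obtain s3 s6 s13 s16 where s: "b 3 = s3 *s (x - y)" "b 6 = s6 *s (x + y)"
      "b 13 = s13 *s (y - z)" "b 16 = s16 *s (y + z)"
      and s0: "s3 \<noteq> 0" "s6 \<noteq> 0" "s13 \<noteq> 0" "s16 \<noteq> 0"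
    using frame unfolding proportional_def by blast
  have "proportional (b 23) (x - z)"
  proof (rule proportional_if_in_two_pencils[of _ "b 3" "b 13" "b 6" "b 16"])
    show "b 23 \<noteq> 0" using nz by simp
    show "bracket (b 23) (b 3) (b 13) = 0"
      using zero[of 3 13 23] by (simp add: quaternion_square_def bracket_rotate[of "b 23"])
    show "bracket (b 23) (b 6) (b 16) = 0"
      using zero[of 6 16 23] by (simp add: quaternion_square_def bracket_rotate[of "b 23"])
    show "x - z \<noteq> 0" by (simp add: xyz vec3_eq_iff)
    show "bracket (x - z) (b 3) (b 13) = 0" "bracket (x - z) (b 6) (b 16) = 0"
      unfolding s bracket_smult by (simp_all add: bracket_def xyz)
    show "bracket (b 3) (b 13) (b 6) \<noteq> 0" unfolding s bracket_smult using s0 by (simp add: bracket_def xyz)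
    show "cross (b 6) (b 16) \<noteq> 0" using net_cross_ne_0[OF b, of 6 16] by simp
  qed
  moreover have "proportional (b 20) (x + z)"
  proof (rule proportional_if_in_two_pencils[of _ "b 3" "b 16" "b 6" "b 13"])
    show "b 20 \<noteq> 0" using nz by simp
    show "bracket (b 20) (b 3) (b 16) = 0"
      using zero[of 3 16 20] by (simp add: quaternion_square_def bracket_rotate[of "b 20"])
    show "bracket (b 20) (b 6) (b 13) = 0"
      using zero[of 6 13 20] by (simp add: quaternion_square_def bracket_rotate[of "b 20"])
    show "x + z \<noteq> 0" by (simp add: xyz vec3_eq_iff)
    show "bracket (x + z) (b 3) (b 16) = 0" "bracket (x + z) (b 6) (b 13) = 0"
      unfolding s bracket_smult by (simp_all add: bracket_def xyz)
    show "bracket (b 3) (b 16) (b 6) \<noteq> 0" unfolding s bracket_smult using s0 by (simp add: bracket_def xyz)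
    show "cross (b 6) (b 13) \<noteq> 0" using net_cross_ne_0[OF b, of 6 13] by simp
  qed
  moreover define c where "c = b(3 := x - y, 6 := x + y, 13 := y - z, 16 := y + z, 20 := x + z, 23 := x - z)"
  ultimately have bc: "proportional (b k) (c k)" for k using frame by (simp add: c_def)
  then have c: "net_coordinates 8 quaternion_square c"
    using net_coordinates_proportional[OF b latin_square_quaternion_square] by blast
  have cs: "c 3 = x - y" "c 13 = y - z" "c 16 = y + z" "c 20 = x + z" "c 23 = x - z" "c 6 = x + y"
    by (simp_all add: c_def)
  note klein = klein_subnet_of_net[OF c cs(1-5)]
  obtain p where p: "proportional (c 1) (z + p)" "proportional (c 2) (z - p)" "proportional (c 12) (x - p)"
    "proportional (c 15) (x + p)" "proportional (c 24) (y - p)" "proportional (c 21) (y + p)"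
    using klein[of 1 2 12 15 24 21] by (simp add: quaternion_square_def) blast
  obtain q where q: "proportional (c 4) (z + q)" "proportional (c 7) (z - q)" "proportional (c 9) (x - q)"
    "proportional (c 10) (x + q)" "proportional (c 19) (y - q)" "proportional (c 22) (y + q)"
    using klein[of 4 7 9 10 19 22] by (simp add: quaternion_square_def) blast
  obtain r where r: "proportional (c 8) (z + r)" "proportional (c 5) (z - r)" "proportional (c 11) (x - r)"
    "proportional (c 14) (x + r)" "proportional (c 18) (y - r)" "proportional (c 17) (y + r)"
    using klein[of 8 5 11 14 18 17] by (simp add: quaternion_square_def) blast
  let ?w = "frame_net 1 p q r"
  have w: "proportional (c k) (?w k)" if "k \<in> {1..24}" for k
    using that p q r cs unfolding atLeastAtMost_24
    by (elim insertE emptyE) (simp_all add: frame_net_def sums flip: xyz)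
  then have "net_coordinates 8 quaternion_square ?w"
    using net_coordinates_proportional[OF c latin_square_quaternion_square] by simp
  then obtain u where u: "nrm u \<noteq> 0" "rot_x u = nrm u *s p" "rot_y u = nrm u *s q" "rot_z u = nrm u *s r"
    using frame_net_rotation by blast
  have "proportional (?w k) (rotation_net u k)" if "k \<in> {1..24}" for k
  proof -
    have axes: "vector [nrm u, 0, 0] = nrm u *s x" "vector [0, nrm u, 0] = nrm u *s y"
      "vector [0, 0, nrm u] = nrm u *s z"
      by (simp_all add: xyz vec3_eq_iff)
    have "rotation_net u k = ?w k \<or> rotation_net u k = nrm u *s ?w k"
      using that unfolding atLeastAtMost_24
      by (elim insertE emptyE)
        (simp_all add: rotation_net_def frame_net_def u axes vector_add_ldistrib vector_ssub_ldistrib flip: xyz)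
    then show ?thesis using u(1) proportional_sym unfolding proportional_def
      by (metis one_neq_zero vector_smult_lid)
  qed
  then show ?thesis using bc w proportional_trans by blast
qed

section \<open>Standard position\<close>

text \<open>The coordinates of \<open>v\<close> with respect to the frame \<open>a\<close>, \<open>b\<close>, \<open>c\<close>, \<open>d\<close>, multiplied by their common
  denominator. In this form they are polynomials in the five vectors.\<close>

definition to_frame ::
    "'a::field ^ 3 \<Rightarrow> 'a ^ 3 \<Rightarrow> 'a ^ 3 \<Rightarrow> 'a ^ 3 \<Rightarrow> 'a ^ 3 \<Rightarrow> 'a ^ 3" where
  "to_frame a b c d v =
     vector [bracket v b c * bracket a d c * bracket a b d,
             bracket d b c * bracket a v c * bracket a b d,
             bracket d b c * bracket a d c * bracket a b v]"

definition general_position :: "'a::field ^ 3 \<Rightarrow> 'a ^ 3 \<Rightarrow> 'a ^ 3 \<Rightarrow> 'a ^ 3 \<Rightarrow> bool" where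
  "general_position a b c d \<longleftrightarrow>
     bracket a b c \<noteq> 0 \<and> bracket d b c \<noteq> 0 \<and> bracket a d c \<noteq> 0 \<and> bracket a b d \<noteq> 0"

lemma to_frame_matrix:
  assumes "general_position a b c d"
  obtains T where "invertible T" "\<And>v. to_frame a b c d v = T *v v"
proof -
  let ?d1 = "bracket d b c" and ?d2 = "bracket a d c" and ?d3 = "bracket a b d"
  define T :: "'a ^ 3 ^ 3" where
    "T = vector [(?d2 * ?d3) *s cross b c, (?d1 * ?d3) *s cross c a, (?d1 * ?d2) *s cross a b]"
  have c1: "bracket v b c = scalar_product (cross b c) v" "bracket a v c = scalar_product (cross c a) v"
    "bracket a b v = scalar_product (cross a b) v" for v
    by (simp_all add: bracket_def scalar_product_3 cross_def algebra_simps)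
  have "to_frame a b c d v = T *v v" for v
    by (simp add: to_frame_def c1 T_def vec3_eq_iff matrix_vector_mult_def sum_3 scalar_product_3
        algebra_simps)
  moreover have "det T = bracket (T$1) (T$2) (T$3)"
    by (simp add: det_3 bracket_def algebra_simps)
  then have "det T = (?d1 * ?d2 * ?d3)^2 * bracket (cross b c) (cross c a) (cross a b)"
    by (simp add: T_def bracket_smult power2_eq_square)
  moreover have "bracket (cross b c) (cross c a) (cross a b) = (bracket a b c)^2"
    by (simp add: bracket_def cross_def power2_eq_square algebra_simps)
  ultimately show thesis
    using assms that[of T] by (simp add: invertible_det_nz general_position_def)
qed

lemma to_frame_values:
  "to_frame a b c d a = (bracket a b c * bracket a d c * bracket a b d) *s vector [1, 0, 0]"
  "to_frame a b c d b = (bracket d b c * bracket a b c * bracket a b d) *s vector [0, 1, 0]"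
  "to_frame a b c d c = (bracket d b c * bracket a d c * bracket a b c) *s vector [0, 0, 1]"
  "to_frame a b c d d = (bracket d b c * bracket a d c * bracket a b d) *s vector [1, 1, 1]"
  by (simp_all add: to_frame_def vec3_eq_iff)

lemma to_frame_proportional:
  assumes "general_position a b c d"
  shows "proportional (to_frame a b c d a) (vector [1, 0, 0])"
    "proportional (to_frame a b c d b) (vector [0, 1, 0])"
    "proportional (to_frame a b c d c) (vector [0, 0, 1])"
    "proportional (to_frame a b c d d) (vector [1, 1, 1])"
  using assms unfolding to_frame_values proportional_def general_position_def
  by (metis mult_eq_0_iff)+

lemma obtain_frame_change:
  fixes a b c d a' b' c' d' :: "'a::field ^ 3"
  assumes "general_position a b c d" "general_position a' b' c' d'"
  obtains T :: "'a ^ 3 ^ 3" where "invertible T"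
    "proportional (T *v a) a'" "proportional (T *v b) b'" "proportional (T *v c) c'"
    "proportional (T *v d) d'"
proof -
  obtain S where S: "invertible S" "\<And>v. to_frame a b c d v = S *v v"
    using to_frame_matrix[OF assms(1)] by blast
  obtain S' where S': "invertible S'" "\<And>v. to_frame a' b' c' d' v = S' *v v"
    using to_frame_matrix[OF assms(2)] by blast
  obtain R where R: "S' ** R = mat 1" "R ** S' = mat 1" using S'(1) by (auto simp: invertible_def)
  have "invertible R" using R unfolding invertible_def by blast
  then have "invertible (R ** S)" using S(1) by (simp add: invertible_det_nz det_mul)
  moreover have "proportional ((R ** S) *v v) w"
    if "proportional (to_frame a b c d v) u" "proportional (to_frame a' b' c' d' w) u" for v u w
  proof -
    have "proportional (S *v v) (S' *v w)"
      using that S(2) S'(2) proportional_trans proportional_sym by metis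
    then have "proportional (R *v (S *v v)) (R *v (S' *v w))" by (rule matrix_proportional)
    then show ?thesis by (simp add: matrix_vector_mul_assoc R(2))
  qed
  ultimately show thesis
    using that to_frame_proportional[OF assms(1)] to_frame_proportional[OF assms(2)] by blast
qed

text \<open>The first three conditions make the matrix diagonal, the fourth one makes it a scalar matrix.\<close>

lemma fixes_frame:
  fixes T :: "'a::field ^ 3 ^ 3"
  assumes "proportional (T *v vector [1, 0, 0]) (vector [1, 0, 0])"
    "proportional (T *v vector [0, 1, 0]) (vector [0, 1, 0])"
    "proportional (T *v vector [0, 0, 1]) (vector [0, 0, 1])"
    "proportional (T *v vector [1, 1, 1]) (vector [1, 1, 1])"
  shows "proportional (T *v v) v"
proof -
  obtain s1 s2 s3 s where s: "T *v vector [1, 0, 0] = s1 *s vector [1, 0, 0]"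
    "T *v vector [0, 1, 0] = s2 *s vector [0, 1, 0]" "T *v vector [0, 0, 1] = s3 *s vector [0, 0, 1]"
    "T *v vector [1, 1, 1] = s *s vector [1, 1, 1]" "s \<noteq> 0"
    using assms unfolding proportional_def by blast
  have "T$i$j = (if i = j then s else 0)" for i j
    using s exhaust_3[of i] exhaust_3[of j]
    by (auto simp: vec3_eq_iff matrix_vector_mult_def sum_3)
  then have "T *v v = s *s v" by (simp add: vec3_eq_iff matrix_vector_mult_def sum_3)
  then show ?thesis using s(5) unfolding proportional_def by blast
qed

context
  fixes q :: nat and M :: "nat \<Rightarrow> nat \<Rightarrow> nat"
  assumes q: "2 \<le> q" and M: "latin_square q M"
begin

lemma net_of_in_nets: "net_coordinates q M a \<Longrightarrow> net_of q a \<in> nets_with_data q M"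
  using coordinates_imp_net[OF _ q M] by (simp add: net_of_def)

lemma net_of_proportional:
  "(\<And>k. k \<in> {1..3 * q} \<Longrightarrow> proportional (a k) (b k)) \<Longrightarrow> net_of q a = net_of q b"
  unfolding net_of_def by (intro restrict_ext line_of_proportional)

lemma proj_equiv_net_of:
  assumes a: "net_coordinates q M a"
  shows "(net_of q a, L) \<in> proj_equiv q M \<longleftrightarrow>
    (\<exists>T :: complex ^ 3 ^ 3. invertible T \<and> L = net_of q (\<lambda>k. T *v a k))"
proof
  assume L: "(net_of q a, L) \<in> proj_equiv q M"
  then obtain g :: "complex ^ 3 ^ 3" where g: "invertible g"
      "\<And>k. k \<in> {1..3 * q} \<Longrightarrow> L k = (\<lambda>v. g *v v) ` net_of q a k"
    by (auto simp: proj_equiv_def)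
  obtain T where T: "invertible T" "\<And>a. (\<lambda>v. g *v v) ` line_of a = line_of (T *v a)"
    using obtain_coordinates_of_image[OF g(1)] by blast
  have "L \<in> extensional {1..3 * q}"
    using L by (auto simp: proj_equiv_def nets_with_data_def labeled_net3_def PiE_def)
  then have "L k = net_of q (\<lambda>k. T *v a k) k" for k
    using g(2)[of k] T(2) by (cases "k \<in> {1..3 * q}") (auto simp: net_of_def extensional_def)
  then show "\<exists>T :: complex ^ 3 ^ 3. invertible T \<and> L = net_of q (\<lambda>k. T *v a k)" using T(1) by blast
next
  assume "\<exists>T :: complex ^ 3 ^ 3. invertible T \<and> L = net_of q (\<lambda>k. T *v a k)"
  then obtain T where T: "invertible T" "L = net_of q (\<lambda>k. T *v a k)" by blast
  obtain g where "invertible g" "\<And>a. (\<lambda>v. g *v v) ` line_of a = line_of (T *v a)"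
    using obtain_image_of_lines[OF T(1)] by blast
  then show "(net_of q a, L) \<in> proj_equiv q M"
    using T(2) net_of_in_nets[OF a] net_of_in_nets[OF net_coordinates_matrix[OF a T(1)]]
    by (auto simp: proj_equiv_def net_of_def intro!: exI[of _ g])
qed

lemma equiv_proj_equiv: "equiv (nets_with_data q M) (proj_equiv q M)"
proof (rule equivI)
  show "proj_equiv q M \<subseteq> nets_with_data q M \<times> nets_with_data q M"
    by (auto simp: proj_equiv_def)
  show "refl_on (nets_with_data q M) (proj_equiv q M)"
  proof (rule refl_onI)
    fix L :: "nat \<Rightarrow> (complex ^ 3) set" assume "L \<in> nets_with_data q M"
    then obtain a where a: "net_coordinates q M a" "L = net_of q a"
      using obtain_net_coordinates M by blast
    have "invertible (mat 1 :: complex ^ 3 ^ 3)" by (simp add: invertible_det_nz)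
    then show "(L, L) \<in> proj_equiv q M"
      unfolding a(2) proj_equiv_net_of[OF a(1)] by (intro exI[of _ "mat 1"]) simp
  qed
  show "sym (proj_equiv q M)"
  proof (rule symI)
    fix L L' :: "nat \<Rightarrow> (complex ^ 3) set" assume LL: "(L, L') \<in> proj_equiv q M"
    then have "L \<in> nets_with_data q M" by (simp add: proj_equiv_def)
    then obtain a where a: "net_coordinates q M a" "L = net_of q a"
      using obtain_net_coordinates M by blast
    obtain T where T: "invertible T" "L' = net_of q (\<lambda>k. T *v a k)"
      using LL proj_equiv_net_of[OF a(1)] a(2) by blast
    obtain S where S: "T ** S = mat 1" "S ** T = mat 1" using T(1) by (auto simp: invertible_def)
    then have "invertible S" unfolding invertible_def by blast
    moreover have "L = net_of q (\<lambda>k. S *v (T *v a k))"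
      by (simp add: a(2) matrix_vector_mul_assoc S)
    ultimately show "(L', L) \<in> proj_equiv q M"
      unfolding T(2) proj_equiv_net_of[OF net_coordinates_matrix[OF a(1) T(1)]] by blast
  qed
  show "trans (proj_equiv q M)"
  proof (rule transI)
    fix L L' L'' :: "nat \<Rightarrow> (complex ^ 3) set"
    assume LL: "(L, L') \<in> proj_equiv q M" "(L', L'') \<in> proj_equiv q M"
    then have "L \<in> nets_with_data q M" by (simp add: proj_equiv_def)
    then obtain a where a: "net_coordinates q M a" "L = net_of q a"
      using obtain_net_coordinates M by blast
    obtain T where T: "invertible T" "L' = net_of q (\<lambda>k. T *v a k)"
      using LL(1) proj_equiv_net_of[OF a(1)] a(2) by blast
    obtain S where S: "invertible S" "L'' = net_of q (\<lambda>k. S *v (T *v a k))"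
      using LL(2) proj_equiv_net_of[OF net_coordinates_matrix[OF a(1) T(1)]] T(2) by blast
    have "L'' = net_of q (\<lambda>k. (S ** T) *v a k)" using S(2) by (simp add: matrix_vector_mul_assoc)
    moreover have "invertible (S ** T)" using S(1) T(1) by (simp add: invertible_det_nz det_mul)
    ultimately show "(L, L'') \<in> proj_equiv q M"
      unfolding a(2) proj_equiv_net_of[OF a(1)] by blast
  qed
qed

definition standard_coordinates :: "(nat \<Rightarrow> 'a::field ^ 3) \<Rightarrow> nat \<Rightarrow> 'a ^ 3" where
  "standard_coordinates a k = to_frame (a 1) (a 2) (a (q + 1)) (a (q + 2)) (a k)"

lemma net_general_position:
  assumes a: "net_coordinates q M a"
  shows "general_position (a 1) (a 2) (a (q + 1)) (a (q + 2))"
proof -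
  have d: "1 div q = 0" "(q + 1) div q = 1" using q by (auto simp: div_nat_eqI)
  note ne = net_bracket_ne_0[OF a q]
  have "bracket (a 1) (a 2) (a (q + 1)) \<noteq> 0" by (rule ne) (use q d in auto)
  moreover have "bracket (a 1) (a 2) (a (q + 2)) \<noteq> 0" by (rule ne) (use q d in auto)
  moreover have "bracket (a (q + 1)) (a (q + 2)) (a 1) \<noteq> 0" by (rule ne) (use q d in auto)
  moreover have "bracket (a (q + 1)) (a (q + 2)) (a 2) \<noteq> 0" by (rule ne) (use q d in auto)
  moreover have "bracket (a (q + 2)) (a 2) (a (q + 1)) = - bracket (a (q + 1)) (a (q + 2)) (a 2) * (- 1)"
    "bracket (a 1) (a (q + 2)) (a (q + 1)) = - bracket (a (q + 1)) (a (q + 2)) (a 1)"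
    by (simp_all add: bracket_def algebra_simps)
  ultimately show ?thesis by (simp add: general_position_def)
qed

text \<open>The coordinates with respect to the frame of the four distinguished lines are obtained by a linear
  map, and a net in standard position is unique because a projective map that fixes a frame is the
  identity.\<close>

lemma standard_net_class:
  assumes a: "net_coordinates q M a"
  shows "standard_net q (proj_equiv q M `` {net_of q a}) = net_of q (standard_coordinates a)"
proof -
  note gp = net_general_position[OF a]
  obtain S where S: "invertible S" "\<And>v. to_frame (a 1) (a 2) (a (q + 1)) (a (q + 2)) v = S *v v"
    using to_frame_matrix[OF gp] by blast
  have st: "standard_coordinates a = (\<lambda>k. S *v a k)"
    unfolding standard_coordinates_def S(2) ..
  have frame: "proportional (S *v a 1) (vector [1, 0, 0])" "proportional (S *v a 2) (vector [0, 1, 0])"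
    "proportional (S *v a (q + 1)) (vector [0, 0, 1])" "proportional (S *v a (q + 2)) (vector [1, 1, 1])"
    using to_frame_proportional[OF gp] unfolding S(2) .
  have in3: "1 \<in> {1..3 * q}" "2 \<in> {1..3 * q}" "q + 1 \<in> {1..3 * q}" "q + 2 \<in> {1..3 * q}"
    using q by auto
  show ?thesis
    unfolding standard_net_def
  proof (rule the_equality)
    have "net_of q (standard_coordinates a) \<in> proj_equiv q M `` {net_of q a}"
      unfolding Image_singleton_iff proj_equiv_net_of[OF a] st using S(1) by blast
    moreover have "in_standard_position q (net_of q (standard_coordinates a))"
      unfolding in_standard_position_def net_of_def restrict_apply'[OF in3(1)]
        restrict_apply'[OF in3(2)] restrict_apply'[OF in3(3)] restrict_apply'[OF in3(4)] st
      using frame by (simp add: line_of_proportional)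
    ultimately show "net_of q (standard_coordinates a) \<in> proj_equiv q M `` {net_of q a} \<and>
        in_standard_position q (net_of q (standard_coordinates a))" by blast
  next
    fix L assume L: "L \<in> proj_equiv q M `` {net_of q a} \<and> in_standard_position q L"
    then obtain T where T: "invertible T" "L = net_of q (\<lambda>k. T *v a k)"
      using proj_equiv_net_of[OF a] by blast
    obtain R where R: "S ** R = mat 1" "R ** S = mat 1" using S(1) by (auto simp: invertible_def)
    have RS: "R *v (S *v v) = v" for v by (simp add: matrix_vector_mul_assoc R)
    note aT = net_coordinates_ne_0[OF net_coordinates_matrix[OF a T(1)] q]
    have pos: "line_of (T *v a 1) = line_of (vector [1, 0, 0])"
      "line_of (T *v a 2) = line_of (vector [0, 1, 0])"
      "line_of (T *v a (q + 1)) = line_of (vector [0, 0, 1])"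
      "line_of (T *v a (q + 2)) = line_of (vector [1, 1, 1])"
      using L unfolding in_standard_position_def T(2) net_of_def restrict_apply'[OF in3(1)]
        restrict_apply'[OF in3(2)] restrict_apply'[OF in3(3)] restrict_apply'[OF in3(4)] by auto
    have frameT: "proportional (T *v a 1) (vector [1, 0, 0])" "proportional (T *v a 2) (vector [0, 1, 0])"
      "proportional (T *v a (q + 1)) (vector [0, 0, 1])" "proportional (T *v a (q + 2)) (vector [1, 1, 1])"
      using pos aT in3 by (simp_all add: line_of_eq_iff vec3_eq_iff)
    have fr: "proportional ((T ** R) *v e) e"
      if "proportional (S *v v) e" "proportional (T *v v) e" for v e
    proof -
      have "proportional ((T ** R) *v e) ((T ** R) *v (S *v v))"
        using that(1) by (intro matrix_proportional) (rule proportional_sym)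
      also have "(T ** R) *v (S *v v) = T *v v"
        by (simp add: matrix_vector_mul_assoc[symmetric] RS)
      finally show ?thesis using that(2) proportional_trans by blast
    qed
    have "proportional (T *v a k) (S *v a k)" for k
      using fixes_frame[of "T ** R" "S *v a k", OF fr[OF frame(1) frameT(1)] fr[OF frame(2) frameT(2)]
          fr[OF frame(3) frameT(3)] fr[OF frame(4) frameT(4)]]
      by (simp add: matrix_vector_mul_assoc[symmetric] RS)
    then show "L = net_of q (standard_coordinates a)"
      unfolding T(2) st by (intro net_of_proportional) blast
  qed
qed

end

section \<open>Polynomials and the Zariski topology of affine space\<close>

lemma affine_const: "affine_polynomial (\<lambda>x. c)"
  and affine_coord: "affine_polynomial (\<lambda>x. x $ i)"
  and affine_add: "affine_polynomial p \<Longrightarrow> affine_polynomial q \<Longrightarrow> affine_polynomial (\<lambda>x. p x + q x)"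
  and affine_mult: "affine_polynomial p \<Longrightarrow> affine_polynomial q \<Longrightarrow> affine_polynomial (\<lambda>x. p x * q x)"
  unfolding affine_polynomial_def by (auto intro: polynomial_fun.intros)

lemma affine_uminus: "affine_polynomial p \<Longrightarrow> affine_polynomial (\<lambda>x. - p x)"
  using affine_mult[OF affine_const[of "- 1"]] by simp

lemma affine_diff: "affine_polynomial p \<Longrightarrow> affine_polynomial q \<Longrightarrow> affine_polynomial (\<lambda>x. p x - q x)"
  using affine_add[OF _ affine_uminus] by simp

lemma affine_power: "affine_polynomial p \<Longrightarrow> affine_polynomial (\<lambda>x. p x ^ k)"
  by (induction k) (simp_all add: affine_const affine_mult)

lemma affine_sum: "(\<And>i. i \<in> A \<Longrightarrow> affine_polynomial (p i)) \<Longrightarrow> affine_polynomial (\<lambda>x. \<Sum>i\<in>A. p i x)"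
  by (induction A rule: infinite_finite_induct) (simp_all add: affine_const affine_add)

lemma affine_prod: "(\<And>i. i \<in> A \<Longrightarrow> affine_polynomial (p i)) \<Longrightarrow> affine_polynomial (\<lambda>x. \<Prod>i\<in>A. p i x)"
  by (induction A rule: infinite_finite_induct) (simp_all add: affine_const affine_mult)

lemmas affine_intros =
  affine_const affine_coord affine_add affine_mult affine_uminus affine_diff affine_power affine_sum affine_prod

lemma openin_basic: "affine_polynomial p \<Longrightarrow> openin zariski_affine {x. p x \<noteq> 0}"
  unfolding zariski_affine_def by (rule topology_generated_by_Basis) blast

lemma openin_zariski_affine:
  "openin zariski_affine S \<longleftrightarrow>
    (\<forall>x\<in>S. \<exists>p. affine_polynomial p \<and> p x \<noteq> 0 \<and> (\<forall>y. p y \<noteq> 0 \<longrightarrow> y \<in> S))"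
proof
  assume "openin zariski_affine S"
  then have "generate_topology_on {{x. p x \<noteq> 0} | p. affine_polynomial p} S"
    by (simp add: zariski_affine_def openin_topology_generated_by_iff)
  then show "\<forall>x\<in>S. \<exists>p. affine_polynomial p \<and> p x \<noteq> 0 \<and> (\<forall>y. p y \<noteq> 0 \<longrightarrow> y \<in> S)"
  proof induction
    case (Int a b)
    show ?case
    proof
      fix x assume "x \<in> a \<inter> b"
      then obtain p q where "affine_polynomial p" "p x \<noteq> 0" "\<forall>y. p y \<noteq> 0 \<longrightarrow> y \<in> a"
        "affine_polynomial q" "q x \<noteq> 0" "\<forall>y. q y \<noteq> 0 \<longrightarrow> y \<in> b"
        using Int.IH by blast
      then show "\<exists>p. affine_polynomial p \<and> p x \<noteq> 0 \<and> (\<forall>y. p y \<noteq> 0 \<longrightarrow> y \<in> a \<inter> b)"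
        by (intro exI[of _ "\<lambda>x. p x * q x"]) (auto intro: affine_mult)
    qed
  next
    case (UN K)
    show ?case
    proof
      fix x assume "x \<in> \<Union> K"
      then obtain k where k: "k \<in> K" "x \<in> k" by blast
      then obtain p where "affine_polynomial p" "p x \<noteq> 0" "\<forall>y. p y \<noteq> 0 \<longrightarrow> y \<in> k"
        using UN.IH by blast
      then show "\<exists>p. affine_polynomial p \<and> p x \<noteq> 0 \<and> (\<forall>y. p y \<noteq> 0 \<longrightarrow> y \<in> \<Union> K)"
        using k(1) by blast
    qed
  qed auto
next
  assume *: "\<forall>x\<in>S. \<exists>p. affine_polynomial p \<and> p x \<noteq> 0 \<and> (\<forall>y. p y \<noteq> 0 \<longrightarrow> y \<in> S)"
  show "openin zariski_affine S"
  proof (subst openin_subopen, intro ballI)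
    fix x assume "x \<in> S"
    then obtain p where "affine_polynomial p" "p x \<noteq> 0" "\<forall>y. p y \<noteq> 0 \<longrightarrow> y \<in> S" using * by blast
    then show "\<exists>T. openin zariski_affine T \<and> x \<in> T \<and> T \<subseteq> S"
      by (intro exI[of _ "{x. p x \<noteq> 0}"]) (auto intro: openin_basic)
  qed
qed

lemma topspace_zariski_affine [simp]: "topspace zariski_affine = UNIV"
proof -
  have "openin zariski_affine (UNIV :: (complex ^ 'n) set)"
    unfolding openin_zariski_affine by (auto intro!: exI[of _ "\<lambda>x. 1"] affine_const)
  then show ?thesis using openin_subset by blast
qed

lemma closedin_zariski_affine:
  "closedin (subtopology zariski_affine U) A \<longleftrightarrow>
    A \<subseteq> U \<and> (\<forall>x\<in>U - A. \<exists>p. affine_polynomial p \<and> p x \<noteq> 0 \<and> (\<forall>a\<in>A. p a = 0))"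
proof
  assume A: "closedin (subtopology zariski_affine U) A"
  then have "openin (subtopology zariski_affine U) (U - A)" "A \<subseteq> U" by (auto simp: closedin_def)
  then obtain W where W: "openin zariski_affine W" "U - A = W \<inter> U" by (auto simp: openin_subtopology)
  have "\<exists>p. affine_polynomial p \<and> p x \<noteq> 0 \<and> (\<forall>a\<in>A. p a = 0)" if "x \<in> U - A" for x
  proof -
    have "x \<in> W" using that W(2) by blast
    then obtain p where p: "affine_polynomial p" "p x \<noteq> 0" "\<And>y. p y \<noteq> 0 \<Longrightarrow> y \<in> W"
      using W(1) unfolding openin_zariski_affine by blast
    have "p a = 0" if "a \<in> A" for a using p(3)[of a] that W(2) \<open>A \<subseteq> U\<close> by blast
    then show ?thesis using p by blast
  qed
  then show "A \<subseteq> U \<and> (\<forall>x\<in>U - A. \<exists>p. affine_polynomial p \<and> p x \<noteq> 0 \<and> (\<forall>a\<in>A. p a = 0))"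
    using \<open>A \<subseteq> U\<close> by blast
next
  assume A: "A \<subseteq> U \<and> (\<forall>x\<in>U - A. \<exists>p. affine_polynomial p \<and> p x \<noteq> 0 \<and> (\<forall>a\<in>A. p a = 0))"
  define W where "W = {x. \<exists>p. affine_polynomial p \<and> p x \<noteq> 0 \<and> (\<forall>a\<in>A. p a = 0)}"
  have "openin zariski_affine W" unfolding openin_zariski_affine W_def by blast
  moreover have "U - A = W \<inter> U" using A by (auto simp: W_def)
  ultimately show "closedin (subtopology zariski_affine U) A"
    using A by (auto simp: closedin_def openin_subtopology)
qed

text \<open>The zero loci of \<open>p\<close> and \<open>q\<close> are closed and cover \<open>Z\<close>.\<close>

lemma irreducible_in_prime:
  assumes "irreducible_in (subtopology zariski_affine U) Z" "affine_polynomial p" "affine_polynomial q"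
    "\<forall>x\<in>Z. p x * q x = 0"
  shows "(\<forall>x\<in>Z. p x = 0) \<or> (\<forall>x\<in>Z. q x = 0)"
proof -
  have cl: "closedin (subtopology zariski_affine U) {x\<in>U. r x = 0}" if "affine_polynomial r" for r
    using that by (auto simp: closedin_zariski_affine)
  have "Z \<subseteq> {x\<in>U. p x = 0} \<union> {x\<in>U. q x = 0}"
    using assms(1,4) by (auto simp: irreducible_in_def)
  then have "Z \<subseteq> {x\<in>U. p x = 0} \<or> Z \<subseteq> {x\<in>U. q x = 0}"
    using assms(1) cl[OF assms(2)] cl[OF assms(3)] unfolding irreducible_in_def by blast
  then show ?thesis by blast
qed

section \<open>The dimension of an open subset of affine space\<close>

text \<open>On \<open>Z\<close> only the constant term survives, so it vanishes identically. What remains is divisible by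
  \<open>h\<close>, which can be cancelled on the irreducible set \<open>Z'\<close> because it does not vanish there.\<close>

lemma coefficients_vanish:
  assumes irr: "irreducible_in (subtopology zariski_affine U) Z'" and "Z \<subseteq> Z'"
    and h: "affine_polynomial h" "\<forall>x\<in>Z. h x = 0" "\<not> (\<forall>x\<in>Z'. h x = 0)"
    and g: "\<And>k. affine_polynomial (g k)" "\<And>k. \<forall>x\<in>Z. g k x = 0 \<Longrightarrow> \<forall>x. g k x = 0"
    and sum: "\<forall>x\<in>Z'. (\<Sum>k<K. g k x * h x ^ k) = 0"
  shows "\<forall>k<K. \<forall>x\<in>Z. g k x = 0"
  using g sum
proof (induction K arbitrary: g)
  case (Suc K)
  let ?s = "\<lambda>x. \<Sum>k<K. g (Suc k) x * h x ^ k"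
  have split: "(\<Sum>k<Suc K. g k x * h x ^ k) = g 0 x + h x * ?s x" for x
    by (simp add: sum.lessThan_Suc_shift sum_distrib_left algebra_simps del: sum.lessThan_Suc)
  have sum0: "\<forall>x\<in>Z'. g 0 x + h x * ?s x = 0" using Suc.prems(3) unfolding split .
  have g0: "\<forall>x\<in>Z. g 0 x = 0"
  proof
    fix x assume "x \<in> Z"
    then have "g 0 x + h x * ?s x = 0" "h x = 0" using sum0 h(2) \<open>Z \<subseteq> Z'\<close> by blast+
    then show "g 0 x = 0" by simp
  qed
  then have "\<forall>x. g 0 x = 0" by (rule Suc.prems(2))
  then have "\<forall>x\<in>Z'. h x * ?s x = 0" using sum0 by simp
  moreover have "affine_polynomial ?s"
    using Suc.prems(1) h(1) by (intro affine_intros)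
  ultimately have "\<forall>x\<in>Z'. ?s x = 0" using irreducible_in_prime[OF irr h(1)] h(3) by blast
  then have "\<forall>k<K. \<forall>x\<in>Z. g (Suc k) x = 0"
    using Suc.prems(1,2) by (intro Suc.IH) auto
  then show ?case using g0 by (metis less_Suc_eq_0_disj)
qed simp

text \<open>Polynomials that vanish on one member of a chain of irreducible closed sets, but not on the next,
  are algebraically independent: sort a relation between them by powers of the last polynomial;
  the coefficients are relations between the others, which hold on the previous member.\<close>

lemma chain_algebraically_independent:
  fixes f :: "nat \<Rightarrow> complex ^ 'n \<Rightarrow> complex"
  assumes irr: "\<And>i. i \<le> m \<Longrightarrow> irreducible_in (subtopology zariski_affine U) (Z i)"
    and mono: "\<And>i. i < m \<Longrightarrow> Z i \<subseteq> Z (Suc i)"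
    and f: "\<And>i. affine_polynomial (f i)" "\<And>i. i < m \<Longrightarrow> \<forall>x\<in>Z i. f i x = 0"
      "\<And>i. i < m \<Longrightarrow> \<not> (\<forall>x\<in>Z (Suc i). f i x = 0)"
    and "j \<le> m"
    and sum: "\<forall>x\<in>Z j. (\<Sum>\<alpha>\<in>{..<j} \<rightarrow>\<^sub>E {..D}. c \<alpha> * (\<Prod>i<j. f i x ^ \<alpha> i)) = 0"
  shows "\<forall>\<alpha>\<in>{..<j} \<rightarrow>\<^sub>E {..D}. c \<alpha> = 0"
  using \<open>j \<le> m\<close> sum
proof (induction j arbitrary: c)
  case 0
  obtain x where "x \<in> Z 0" using irr[of 0] by (auto simp: irreducible_in_def)
  then show ?case using 0 by auto
next
  case (Suc j)
  define g where "g k x = (\<Sum>\<beta>\<in>{..<j} \<rightarrow>\<^sub>E {..D}. c (\<beta>(j := k)) * (\<Prod>i<j. f i x ^ \<beta> i))" for k x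
  have Pi: "{..<Suc j} \<rightarrow>\<^sub>E {..D} = (\<lambda>(k, \<beta>). \<beta>(j := k)) ` ({..D} \<times> ({..<j} \<rightarrow>\<^sub>E {..D}))"
    by (simp add: lessThan_Suc PiE_insert_eq)
  have inj: "inj_on (\<lambda>(k, \<beta>). \<beta>(j := k)) ({..D} \<times> ({..<j} \<rightarrow>\<^sub>E {..D}))"
    by (rule inj_combinator) simp
  have split: "(\<Sum>\<alpha>\<in>{..<Suc j} \<rightarrow>\<^sub>E {..D}. c \<alpha> * (\<Prod>i<Suc j. f i x ^ \<alpha> i)) =
      (\<Sum>k<Suc D. g k x * f j x ^ k)" for x
  proof -
    have "(\<Sum>\<alpha>\<in>{..<Suc j} \<rightarrow>\<^sub>E {..D}. c \<alpha> * (\<Prod>i<Suc j. f i x ^ \<alpha> i)) =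
        (\<Sum>(k, \<beta>)\<in>{..D} \<times> ({..<j} \<rightarrow>\<^sub>E {..D}). c (\<beta>(j := k)) * (\<Prod>i<Suc j. f i x ^ (\<beta>(j := k)) i))"
      unfolding Pi by (subst sum.reindex[OF inj]) (simp add: case_prod_unfold)
    also have "\<dots> = (\<Sum>(k, \<beta>)\<in>{..D} \<times> ({..<j} \<rightarrow>\<^sub>E {..D}). c (\<beta>(j := k)) * (\<Prod>i<j. f i x ^ \<beta> i) * f j x ^ k)"
      by (intro sum.cong) (auto simp: case_prod_unfold)
    also have "\<dots> = (\<Sum>k\<le>D. \<Sum>\<beta>\<in>{..<j} \<rightarrow>\<^sub>E {..D}. c (\<beta>(j := k)) * (\<Prod>i<j. f i x ^ \<beta> i) * f j x ^ k)"
      by (simp add: sum.cartesian_product)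
    also have "\<dots> = (\<Sum>k<Suc D. g k x * f j x ^ k)"
      by (simp add: g_def sum_distrib_right lessThan_Suc_atMost)
    finally show ?thesis .
  qed
  have zero: "\<forall>\<beta>\<in>{..<j} \<rightarrow>\<^sub>E {..D}. c (\<beta>(j := k)) = 0" if "\<forall>x\<in>Z j. g k x = 0" for k
  proof (rule Suc.IH)
    show "j \<le> m" using Suc.prems(1) by simp
    show "\<forall>x\<in>Z j. (\<Sum>\<beta>\<in>{..<j} \<rightarrow>\<^sub>E {..D}. c (\<beta>(j := k)) * (\<Prod>i<j. f i x ^ \<beta> i)) = 0"
      using that unfolding g_def .
  qed
  have "\<forall>k<Suc D. \<forall>x\<in>Z j. g k x = 0"
  proof (rule coefficients_vanish)
    show "irreducible_in (subtopology zariski_affine U) (Z (Suc j))" using irr Suc.prems(1) by blast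
    show "Z j \<subseteq> Z (Suc j)" "affine_polynomial (f j)" "\<forall>x\<in>Z j. f j x = 0" "\<not> (\<forall>x\<in>Z (Suc j). f j x = 0)"
      using mono f Suc.prems(1) by auto
    show "affine_polynomial (g k)" for k unfolding g_def using f(1) by (intro affine_intros)
    show "\<forall>x. g k x = 0" if "\<forall>x\<in>Z j. g k x = 0" for k using zero[OF that] by (simp add: g_def)
    show "\<forall>x\<in>Z (Suc j). (\<Sum>k<Suc D. g k x * f j x ^ k) = 0" using Suc.prems(2) by (simp only: split)
  qed
  then show ?case using zero unfolding Pi by auto
qed

lemma sum_of_functions: "(\<Sum>i\<in>A. f i) x = (\<Sum>i\<in>A. f i x)" for f :: "'i \<Rightarrow> 'x \<Rightarrow> complex"
  by (induction A rule: infinite_finite_induct) auto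

interpretation function_space: vector_space "\<lambda>(c :: complex) (f :: 'x \<Rightarrow> complex) x. c * f x"
  by unfold_locales (auto simp: algebra_simps)

text \<open>The bound \<open>e\<close> concerns the exponent of each single variable, so that the number of monomials is
  a power of \<open>e + 1\<close>.\<close>

definition monomials :: "nat \<Rightarrow> (complex ^ 'n \<Rightarrow> complex) set" where
  "monomials e = (\<lambda>\<gamma> x. \<Prod>i\<in>UNIV. x $ i ^ \<gamma> i) ` {\<gamma>. \<forall>i. \<gamma> i \<le> e}"

lemma monomials_box: "{\<gamma> :: 'n \<Rightarrow> nat. \<forall>i. \<gamma> i \<le> e} = UNIV \<rightarrow>\<^sub>E {..e}"
  by (auto simp: PiE_def)

lemma finite_monomials: "finite (monomials e :: (complex ^ 'n \<Rightarrow> complex) set)"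
  unfolding monomials_def monomials_box by (intro finite_imageI finite_PiE) auto

lemma card_monomials: "card (monomials e :: (complex ^ 'n \<Rightarrow> complex) set) \<le> (e + 1) ^ CARD('n)"
proof -
  have "card (monomials e :: (complex ^ 'n \<Rightarrow> complex) set) \<le> card ((UNIV :: 'n set) \<rightarrow>\<^sub>E {..e})"
    unfolding monomials_def monomials_box by (intro card_image_le finite_PiE) auto
  then show ?thesis by (simp add: card_PiE)
qed

lemma monomials_mono: "e \<le> e' \<Longrightarrow> monomials e \<subseteq> monomials e'"
  unfolding monomials_def by (intro image_mono) (auto intro: order_trans)

abbreviation "polynomials_up_to e \<equiv> function_space.span (monomials e)"

lemma polynomials_mono: "p \<in> polynomials_up_to e \<Longrightarrow> e \<le> e' \<Longrightarrow> p \<in> polynomials_up_to e'"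
  using function_space.span_mono[OF monomials_mono] by blast

lemma polynomials_mult:
  assumes p: "p \<in> polynomials_up_to e" and q: "q \<in> polynomials_up_to e'"
  shows "(\<lambda>x. p x * q x) \<in> polynomials_up_to (e + e')"
  using p
proof (induction rule: function_space.span_induct_alt)
  case base
  have "(\<lambda>x. 0 x * q x) = 0" by (auto simp: fun_eq_iff)
  then show ?case by (simp add: function_space.span_zero)
next
  case (step c a p)
  have "(\<lambda>x. a x * q x) \<in> polynomials_up_to (e + e')"
    using q
  proof (induction rule: function_space.span_induct_alt)
    case base
    have "(\<lambda>x. a x * 0 x) = 0" by (auto simp: fun_eq_iff)
    then show ?case by (simp add: function_space.span_zero)
  next
    case (step d b q)
    obtain \<gamma> \<delta> where g: "a = (\<lambda>x. \<Prod>i\<in>UNIV. x $ i ^ \<gamma> i)" "\<forall>i. \<gamma> i \<le> e"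
      "b = (\<lambda>x. \<Prod>i\<in>UNIV. x $ i ^ \<delta> i)" "\<forall>i. \<delta> i \<le> e'"
      using \<open>a \<in> monomials e\<close> step(1) by (auto simp: monomials_def)
    have "(\<lambda>x. a x * b x) = (\<lambda>x. \<Prod>i\<in>UNIV. x $ i ^ (\<gamma> i + \<delta> i))"
      by (simp add: g power_add prod.distrib)
    moreover have "\<dots> \<in> monomials (e + e')"
      unfolding monomials_def using g by (intro imageI) (auto intro: add_mono)
    ultimately have "(\<lambda>x. a x * b x) \<in> polynomials_up_to (e + e')"
      using function_space.span_base by metis
    then have "(\<lambda>x. d * (a x * b x)) + (\<lambda>x. a x * q x) \<in> polynomials_up_to (e + e')"
      using step by (intro function_space.span_add function_space.span_scale)
    moreover have "(\<lambda>x. d * (a x * b x)) + (\<lambda>x. a x * q x) = (\<lambda>x. a x * ((\<lambda>x. d * b x) + q) x)"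
      by (auto simp: fun_eq_iff algebra_simps)
    ultimately show ?case by simp
  qed
  then have "(\<lambda>x. c * (a x * q x)) + (\<lambda>x. p x * q x) \<in> polynomials_up_to (e + e')"
    using step by (intro function_space.span_add function_space.span_scale)
  moreover have "(\<lambda>x. c * (a x * q x)) + (\<lambda>x. p x * q x) = (\<lambda>x. ((\<lambda>x. c * a x) + p) x * q x)"
    by (auto simp: fun_eq_iff algebra_simps)
  ultimately show ?case by simp
qed

lemma one_polynomial: "(\<lambda>x. 1) \<in> polynomials_up_to e"
proof -
  have "(\<lambda>x. 1) \<in> monomials e"
    unfolding monomials_def by (rule image_eqI[of _ _ "\<lambda>_. 0"]) auto
  then show ?thesis by (rule function_space.span_base)
qed

lemma affine_polynomial_bounded:
  assumes "affine_polynomial p"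
  shows "\<exists>e. p \<in> polynomials_up_to e"
  using assms unfolding affine_polynomial_def
proof induction
  case (coord f)
  then obtain i where f: "f = (\<lambda>x. x $ i)" by auto
  have "(\<lambda>x :: complex ^ 'a. x $ i) = (\<lambda>x. \<Prod>j\<in>UNIV. x $ j ^ (if j = i then 1 else 0))"
    by (auto simp: fun_eq_iff if_distrib prod.delta cong: if_cong)
  then have "f \<in> monomials 1"
    unfolding monomials_def f by (intro image_eqI[of _ _ "\<lambda>j. if j = i then 1 else 0"]) auto
  then show ?case using function_space.span_base by blast
next
  case (const c)
  have "(\<lambda>x. c * 1) \<in> polynomials_up_to 0"
    by (rule function_space.span_scale) (rule one_polynomial)
  then show ?case by auto
next
  case (add f g)
  then obtain e e' where "f \<in> polynomials_up_to e" "g \<in> polynomials_up_to e'" by blast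
  then have "f + g \<in> polynomials_up_to (max e e')"
    by (intro function_space.span_add) (auto intro: polynomials_mono)
  then show ?case by (auto simp: plus_fun_def)
next
  case (mult f g)
  then show ?case using polynomials_mult by blast
qed

lemma polynomials_power: "p \<in> polynomials_up_to e \<Longrightarrow> (\<lambda>x. p x ^ k) \<in> polynomials_up_to (k * e)"
proof (induction k)
  case (Suc k)
  then show ?case using polynomials_mult[OF Suc(2) Suc(1)[OF Suc(2)]] by simp
qed (simp add: one_polynomial)

lemma polynomials_prod:
  "(\<And>i. i < (m :: nat) \<Longrightarrow> p i \<in> polynomials_up_to e) \<Longrightarrow> (\<lambda>x. \<Prod>i<m. p i x) \<in> polynomials_up_to (m * e)"
proof (induction m)
  case (Suc m)
  have "(\<lambda>x. (\<Prod>i<m. p i x) * p m x) \<in> polynomials_up_to (m * e + e)"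
    using Suc by (intro polynomials_mult) auto
  then show ?case by (simp add: add.commute)
qed (simp add: one_polynomial)

lemma exponent_bound:
  fixes m n c :: nat
  assumes "\<And>D. (D + 1) ^ m \<le> (c * D + 1) ^ n"
  shows "m \<le> n"
proof (rule ccontr)
  assume "\<not> m \<le> n"
  then have "n < m" by simp
  \<comment> \<open>Dividing the two sides by \<open>(k + 1) ^ n\<close> leaves at least \<open>k + 1\<close> and at most \<open>(c + 1) ^ n\<close>.\<close>
  define k where "k = (c + 1) ^ n"
  have "(c * k + 1) \<le> (c + 1) * (k + 1)" by simp
  then have "(c * k + 1) ^ n \<le> ((c + 1) * (k + 1)) ^ n" by (rule power_mono) simp
  also have "\<dots> = k * (k + 1) ^ n" by (simp only: power_mult_distrib k_def)
  finally have "(k + 1) ^ m \<le> k * (k + 1) ^ n" using assms[of k] by simp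
  moreover have "(k + 1) ^ Suc n \<le> (k + 1) ^ m" using \<open>n < m\<close> by (intro power_increasing) auto
  ultimately have "(k + 1) ^ Suc n \<le> k * (k + 1) ^ n" by (metis order_trans)
  then have "(k + 1) ^ n \<le> 0" by simp
  then show False by simp
qed

text \<open>A chain of length \<open>m\<close> provides \<open>m\<close> algebraically independent polynomials. Their monomials with
  exponents at most \<open>D\<close> are \<open>(D + 1) ^ m\<close> linearly independent polynomials, whose exponents grow
  linearly with \<open>D\<close>. In \<open>n\<close> variables there is room for only about \<open>D ^ n\<close> of these, so \<open>m \<le> n\<close>.\<close>

lemma chain_length_le:
  fixes Z :: "nat \<Rightarrow> (complex ^ 'n) set"
  assumes Z: "\<And>i. i \<le> m \<Longrightarrow> closedin (subtopology zariski_affine U) (Z i)"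
    "\<And>i. i \<le> m \<Longrightarrow> irreducible_in (subtopology zariski_affine U) (Z i)"
    "\<And>i. i < m \<Longrightarrow> Z i \<subset> Z (Suc i)"
  shows "m \<le> CARD('n)"
proof -
  have "\<exists>p. affine_polynomial p \<and> (\<forall>x\<in>Z i. p x = 0) \<and> \<not> (\<forall>x\<in>Z (Suc i). p x = 0)" if i: "i < m" for i
  proof -
    obtain x where x: "x \<in> Z (Suc i)" "x \<notin> Z i" using Z(3)[OF i] by blast
    have "closedin (subtopology zariski_affine U) (Z (Suc i))" using Z(1)[of "Suc i"] i by simp
    then have "x \<in> U" using x(1) unfolding closedin_zariski_affine by blast
    moreover have "closedin (subtopology zariski_affine U) (Z i)" using Z(1)[of i] i by simp
    ultimately show ?thesis using x unfolding closedin_zariski_affine by blast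
  qed
  then obtain f0 where f0: "\<And>i. i < m \<Longrightarrow> affine_polynomial (f0 i) \<and> (\<forall>x\<in>Z i. f0 i x = 0) \<and>
      \<not> (\<forall>x\<in>Z (Suc i). f0 i x = 0)"
    by metis
  define f where "f i = (if i < m then f0 i else (\<lambda>x. 0))" for i
  have f: "affine_polynomial (f i)" for i using f0 by (simp add: f_def affine_const)
  have f': "\<forall>x\<in>Z i. f i x = 0" "\<not> (\<forall>x\<in>Z (Suc i). f i x = 0)" if "i < m" for i
    using f0[OF that] that by (auto simp: f_def)
  have mono: "Z i \<subseteq> Z (Suc i)" if "i < m" for i using Z(3)[OF that] by blast
  have "\<forall>i. \<exists>e. f i \<in> polynomials_up_to e" using affine_polynomial_bounded f by blast
  then obtain e0 where e0: "\<And>i. f i \<in> polynomials_up_to (e0 i)" by metis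
  define e where "e = (\<Sum>i<m. e0 i)"
  have e: "f i \<in> polynomials_up_to e" if "i < m" for i
    using e0[of i] by (rule polynomials_mono) (use that in \<open>auto simp: e_def intro: member_le_sum\<close>)
  have "(D + 1) ^ m \<le> ((m * e) * D + 1) ^ CARD('n)" for D
  proof -
    let ?P = "{..<m} \<rightarrow>\<^sub>E {..D}"
    define F where "F \<alpha> x = (\<Prod>i<m. f i x ^ \<alpha> i)" for \<alpha> :: "nat \<Rightarrow> nat" and x
    have fin: "finite ?P" by (intro finite_PiE) auto
    have zero: "\<forall>\<alpha>\<in>?P. c \<alpha> = 0" if "\<forall>x. (\<Sum>\<alpha>\<in>?P. c \<alpha> * F \<alpha> x) = 0" for c
      using that unfolding F_def
      by (intro chain_algebraically_independent[where U = U and Z = Z and f = f and m = m and j = m])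
        (use Z(2) mono f f' in blast)+
    have inj: "inj_on F ?P"
    proof (rule inj_onI, rule ccontr)
      fix \<alpha> \<beta> assume ab: "\<alpha> \<in> ?P" "\<beta> \<in> ?P" "F \<alpha> = F \<beta>" "\<alpha> \<noteq> \<beta>"
      define c where "c \<gamma> = (if \<gamma> = \<alpha> then 1 else 0) - (if \<gamma> = \<beta> then 1 else 0 :: complex)" for \<gamma>
      have "(\<Sum>\<gamma>\<in>?P. c \<gamma> * F \<gamma> x) = F \<alpha> x - F \<beta> x" for x
        using ab(1,2) fin by (simp add: c_def left_diff_distrib sum_subtractf if_distrib[of "\<lambda>y. y * _"] sum.delta cong: if_cong)
      then have "c \<alpha> = 0" using zero[of c] ab by simp
      then show False using ab(4) by (simp add: c_def)
    qed
    have "function_space.independent (F ` ?P)"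
    proof
      assume "function_space.dependent (F ` ?P)"
      then obtain u where u: "\<exists>v\<in>F ` ?P. u v \<noteq> 0" "(\<Sum>v\<in>F ` ?P. (\<lambda>x. u v * v x)) = 0"
        using function_space.dependent_finite[of "F ` ?P"] fin by auto
      have "(\<Sum>\<alpha>\<in>?P. u (F \<alpha>) * F \<alpha> x) = 0" for x
      proof -
        have "(\<Sum>\<alpha>\<in>?P. (\<lambda>x. u (F \<alpha>) * F \<alpha> x)) x = 0"
          using u(2) by (simp add: sum.reindex[OF inj])
        then show ?thesis by (simp add: sum_of_functions)
      qed
      then show False using zero[of "\<lambda>\<alpha>. u (F \<alpha>)"] u(1) by auto
    qed
    moreover have "F ` ?P \<subseteq> polynomials_up_to ((m * e) * D)"
    proof (rule image_subsetI)
      fix \<alpha> assume a: "\<alpha> \<in> ?P"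
      have "(\<lambda>x. f i x ^ \<alpha> i) \<in> polynomials_up_to (D * e)" if "i < m" for i
        using polynomials_power[OF e[OF that]]
        by (rule polynomials_mono) (use a that in \<open>auto intro!: mult_right_mono dest: PiE_mem\<close>)
      then have "F \<alpha> \<in> polynomials_up_to (m * (D * e))"
        unfolding F_def by (rule polynomials_prod)
      then show "F \<alpha> \<in> polynomials_up_to ((m * e) * D)" by (simp add: mult_ac)
    qed
    ultimately have "card (F ` ?P) \<le> card (monomials ((m * e) * D) :: (complex ^ 'n \<Rightarrow> complex) set)"
      using function_space.independent_span_bound[OF finite_monomials] by blast
    also have "\<dots> \<le> ((m * e) * D + 1) ^ CARD('n)" by (rule card_monomials)
    finally show ?thesis by (simp add: card_image[OF inj] card_PiE)
  qed
  then show ?thesis by (rule exponent_bound)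
qed

lemma affine_polynomial_on_line:
  assumes "affine_polynomial p"
  shows "\<exists>P. \<forall>t. p (a + t *s v) = poly P t"
  using assms unfolding affine_polynomial_def
proof induction
  case (coord f)
  then obtain i where "f = (\<lambda>x. x $ i)" by auto
  then show ?case by (intro exI[of _ "[:a $ i, v $ i:]"]) simp
next
  case (const c)
  show ?case by (intro exI[of _ "[:c:]"]) simp
next
  case (add f g)
  then show ?case by (metis poly_add)
next
  case (mult f g)
  then show ?case by (metis poly_mult)
qed

text \<open>On a line the three polynomials become nonzero polynomials in one variable.\<close>

lemma common_nonzero_on_line:
  assumes "affine_polynomial p" "affine_polynomial q" "affine_polynomial r"
    and "p (a + t1 *s v) \<noteq> 0" "q (a + t2 *s v) \<noteq> 0" "r (a + t3 *s v) \<noteq> 0"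
  shows "\<exists>t. t \<noteq> 0 \<and> p (a + t *s v) \<noteq> 0 \<and> q (a + t *s v) \<noteq> 0 \<and> r (a + t *s v) \<noteq> 0"
proof -
  obtain P Q R where P: "\<And>t. p (a + t *s v) = poly P t" "\<And>t. q (a + t *s v) = poly Q t"
      "\<And>t. r (a + t *s v) = poly R t"
    using affine_polynomial_on_line assms(1-3) by metis
  have "P \<noteq> 0" "Q \<noteq> 0" "R \<noteq> 0" using assms(4-6) P by auto
  \<comment> \<open>The factor \<open>[:0, 1:]\<close> excludes the root 0.\<close>
  then have "[:0, 1:] * (P * Q * R) \<noteq> 0" by simp
  then have "finite {t. poly ([:0, 1:] * (P * Q * R)) t = 0}" by (rule poly_roots_finite)
  then obtain t where "poly ([:0, 1:] * (P * Q * R)) t \<noteq> 0"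
    using infinite_UNIV_char_0[where 'a = complex] by (metis (mono_tags) UNIV_eq_I mem_Collect_eq)
  then show ?thesis using P by (intro exI[of _ t]) auto
qed

text \<open>If two closed sets miss one point each, then on the line through these points only finitely many
  points belong to either of them, or lie outside of \<open>U\<close>.\<close>

lemma irreducible_affine_subspace:
  fixes U :: "(complex ^ 'n) set"
  assumes U: "openin zariski_affine U" and u: "u \<in> U"
  shows "irreducible_in (subtopology zariski_affine U) {x\<in>U. \<forall>j\<in>J. x $ j = u $ j}"
  unfolding irreducible_in_def
proof (intro conjI allI impI)
  let ?Z = "{x\<in>U. \<forall>j\<in>J. x $ j = u $ j}"
  show "?Z \<noteq> {}" using u by auto
  show "?Z \<subseteq> topspace (subtopology zariski_affine U)" by auto
  fix A B assume AB: "closedin (subtopology zariski_affine U) A \<and>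
      closedin (subtopology zariski_affine U) B \<and> ?Z \<subseteq> A \<union> B"
  show "?Z \<subseteq> A \<or> ?Z \<subseteq> B"
  proof (rule ccontr)
    assume "\<not> (?Z \<subseteq> A \<or> ?Z \<subseteq> B)"
    then obtain x y where x: "x \<in> ?Z" "x \<notin> A" and y: "y \<in> ?Z" "y \<notin> B" by blast
    obtain p where p: "affine_polynomial p" "p x \<noteq> 0" "\<forall>a\<in>A. p a = 0"
      using AB x unfolding closedin_zariski_affine by blast
    obtain q where q: "affine_polynomial q" "q y \<noteq> 0" "\<forall>a\<in>B. q a = 0"
      using AB y unfolding closedin_zariski_affine by blast
    obtain r where r: "affine_polynomial r" "r x \<noteq> 0" "\<forall>z. r z \<noteq> 0 \<longrightarrow> z \<in> U"
      using U x unfolding openin_zariski_affine by blast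
    have 0: "x + 0 *s (y - x) = x" and 1: "x + 1 *s (y - x) = y" by simp_all
    obtain t where t: "p (x + t *s (y - x)) \<noteq> 0" "q (x + t *s (y - x)) \<noteq> 0" "r (x + t *s (y - x)) \<noteq> 0"
      using common_nonzero_on_line[OF p(1) q(1) r(1), of x 0 "y - x" 1 0] p(2) q(2) r(2)
      unfolding 0 1 by blast
    then have "x + t *s (y - x) \<in> ?Z" using r(3) x(1) y(1) by auto
    then show False using AB p(3) q(3) t by blast
  qed
qed

text \<open>The upper bound is the bound on the length of chains; a flag of affine subspaces through a point
  of \<open>U\<close> attains it.\<close>

theorem krull_dim_open_affine:
  fixes U :: "(complex ^ 'n) set"
  assumes U: "openin zariski_affine U" "U \<noteq> {}"
  shows "krull_dim (subtopology zariski_affine U) = enat CARD('n)"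
proof (rule antisym)
  show "krull_dim (subtopology zariski_affine U) \<le> enat CARD('n)"
    unfolding krull_dim_def
  proof (rule Sup_least)
    fix x assume "x \<in> {enat n | n. \<exists>Z. (\<forall>i\<le>n. closedin (subtopology zariski_affine U) (Z i) \<and>
        irreducible_in (subtopology zariski_affine U) (Z i)) \<and> (\<forall>i<n. Z i \<subset> Z (Suc i))}"
    then obtain n Z where x: "x = enat n" and Z: "\<forall>i\<le>n. closedin (subtopology zariski_affine U) (Z i) \<and>
        irreducible_in (subtopology zariski_affine U) (Z i)" "\<forall>i<n. Z i \<subset> Z (Suc i)"
      by blast
    have "n \<le> CARD('n)" by (rule chain_length_le[of n U Z]) (use Z in blast)+
    then show "x \<le> enat CARD('n)" by (simp add: x)
  qed
next
  obtain u where u: "u \<in> U" using U(2) by blast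
  obtain h where h: "bij_betw h {..<CARD('n)} (UNIV :: 'n set)"
    using ex_bij_betw_nat_finite[of "UNIV :: 'n set"] by (auto simp: atLeast0LessThan)
  define Z where "Z i = {x\<in>U. \<forall>j\<in>h ` {i..<CARD('n)}. x $ j = u $ j}" for i
  have "closedin (subtopology zariski_affine U) (Z i)" for i
    unfolding closedin_zariski_affine
  proof (intro conjI ballI)
    fix x assume "x \<in> U - Z i"
    then obtain j where j: "j \<in> h ` {i..<CARD('n)}" "x $ j \<noteq> u $ j" by (auto simp: Z_def)
    then show "\<exists>p. affine_polynomial p \<and> p x \<noteq> 0 \<and> (\<forall>a\<in>Z i. p a = 0)"
      by (intro exI[of _ "\<lambda>x. x $ j - u $ j"]) (auto simp: Z_def intro!: affine_intros)
  qed (auto simp: Z_def)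
  moreover have "irreducible_in (subtopology zariski_affine U) (Z i)" for i
    unfolding Z_def by (rule irreducible_affine_subspace[OF U(1) u])
  moreover have "Z i \<subset> Z (Suc i)" if i: "i < CARD('n)" for i
  proof
    show "Z i \<subseteq> Z (Suc i)" by (auto simp: Z_def)
    obtain r where r: "affine_polynomial r" "r u \<noteq> 0" "\<forall>z. r z \<noteq> 0 \<longrightarrow> z \<in> U"
      using U(1) u unfolding openin_zariski_affine by blast
    define v :: "complex ^ 'n" where "v = axis (h i) 1"
    obtain t where t: "t \<noteq> 0" "r (u + t *s v) \<noteq> 0"
      using common_nonzero_on_line[OF r(1) r(1) r(1), of u 0 v 0 0] r(2) by auto
    have "h j \<noteq> h i" if "j \<in> {Suc i..<CARD('n)}" for j
      using bij_betw_imp_inj_on[OF h] that i by (auto dest: inj_onD)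
    then have "u + t *s v \<in> Z (Suc i)" using r(3) t(2) by (auto simp: Z_def v_def axis_def)
    moreover have "u + t *s v \<notin> Z i" using i t(1) by (auto simp: Z_def v_def axis_def)
    ultimately show "Z i \<noteq> Z (Suc i)" by blast
  qed
  ultimately show "enat CARD('n) \<le> krull_dim (subtopology zariski_affine U)"
    unfolding krull_dim_def by (intro Sup_upper) blast
qed

section \<open>Homeomorphisms preserve the dimension\<close>

lemma irreducible_in_image:
  assumes f: "continuous_map X Y f" and Z: "irreducible_in X Z"
  shows "irreducible_in Y (f ` Z)"
  unfolding irreducible_in_def
proof (intro conjI allI impI)
  show "f ` Z \<noteq> {}" "f ` Z \<subseteq> topspace Y"
    using Z continuous_map_image_subset_topspace[OF f] by (auto simp: irreducible_in_def)
  fix A B assume AB: "closedin Y A \<and> closedin Y B \<and> f ` Z \<subseteq> A \<union> B"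
  have "Z \<subseteq> {x \<in> topspace X. f x \<in> A} \<union> {x \<in> topspace X. f x \<in> B}"
    using AB Z by (auto simp: irreducible_in_def)
  moreover have "closedin X {x \<in> topspace X. f x \<in> A}" "closedin X {x \<in> topspace X. f x \<in> B}"
    using AB f by (auto intro: closedin_continuous_map_preimage)
  ultimately have "Z \<subseteq> {x \<in> topspace X. f x \<in> A} \<or> Z \<subseteq> {x \<in> topspace X. f x \<in> B}"
    using Z unfolding irreducible_in_def by blast
  then show "f ` Z \<subseteq> A \<or> f ` Z \<subseteq> B" by blast
qed

lemma krull_dim_homeomorphic_le:
  assumes f: "homeomorphic_map X Y f"
  shows "krull_dim X \<le> krull_dim Y"
  unfolding krull_dim_def
proof (rule Sup_subset_mono, rule subsetI)
  fix d assume "d \<in> {enat n | n. \<exists>Z. (\<forall>i\<le>n. closedin X (Z i) \<and> irreducible_in X (Z i)) \<and> (\<forall>i<n. Z i \<subset> Z (Suc i))}"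
  then obtain n Z where n: "d = enat n" and Z: "\<forall>i\<le>n. closedin X (Z i) \<and> irreducible_in X (Z i)"
    "\<forall>i<n. Z i \<subset> Z (Suc i)" by blast
  have c: "closedin Y (f ` Z i) \<and> irreducible_in Y (f ` Z i)" if "i \<le> n" for i
    using Z(1) that f by (metis homeomorphic_imp_closed_map closed_map_def
        homeomorphic_imp_continuous_map irreducible_in_image)
  have m: "f ` Z i \<subset> f ` Z (Suc i)" if "i < n" for i
  proof -
    have "inj_on f (topspace X)" using f by (simp add: homeomorphic_eq_everything_map)
    moreover have "Z (Suc i) \<subseteq> topspace X"
      using Z(1) that by (intro closedin_subset) (simp add: Suc_le_eq)
    moreover have "Z i \<subset> Z (Suc i)" using Z(2) that by blast
    ultimately show ?thesis
      by (metis inj_on_image_eq_iff image_mono psubset_eq subset_trans)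
  qed
  have "\<exists>Z. (\<forall>i\<le>n. closedin Y (Z i) \<and> irreducible_in Y (Z i)) \<and> (\<forall>i<n. Z i \<subset> Z (Suc i))"
    by (rule exI[of _ "\<lambda>i. f ` Z i"]) (use c m in blast)
  then show "d \<in> {enat n | n. \<exists>Z. (\<forall>i\<le>n. closedin Y (Z i) \<and> irreducible_in Y (Z i)) \<and>
      (\<forall>i<n. Z i \<subset> Z (Suc i))}"
    using n by blast
qed

section \<open>Multihomogeneous functions\<close>

definition multihomogeneous :: "nat set \<Rightarrow> (nat \<Rightarrow> nat) \<Rightarrow> ((nat \<Rightarrow> complex ^ 3) \<Rightarrow> complex) \<Rightarrow> bool" where
  "multihomogeneous I d F \<longleftrightarrow>
     polynomial_fun {\<lambda>a. a k $ i | k i. k \<in> I} F \<and>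
     (\<forall>s a. F (\<lambda>k. s k *s a k) = (\<Prod>k\<in>I. s k ^ d k) * F a)"

lemma multihomogeneous_polynomial_iff:
  "multihomogeneous_polynomial I F \<longleftrightarrow> (\<exists>d. multihomogeneous I d F)"
  by (auto simp: multihomogeneous_polynomial_def multihomogeneous_def)

lemma multihomogeneous_const: "multihomogeneous I (\<lambda>_. 0) (\<lambda>a. c)"
  by (simp add: multihomogeneous_def polynomial_fun.const)

lemma multihomogeneous_add:
  "multihomogeneous I d F \<Longrightarrow> multihomogeneous I d G \<Longrightarrow> multihomogeneous I d (\<lambda>a. F a + G a)"
  by (auto simp: multihomogeneous_def polynomial_fun.add algebra_simps)

lemma multihomogeneous_mult:
  "multihomogeneous I d F \<Longrightarrow> multihomogeneous I e G \<Longrightarrow>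
    multihomogeneous I (\<lambda>k. d k + e k) (\<lambda>a. F a * G a)"
  by (auto simp: multihomogeneous_def polynomial_fun.mult power_add prod.distrib)

lemma polynomial_fun_cong:
  assumes "polynomial_fun {\<lambda>a :: nat \<Rightarrow> complex ^ 3. a k $ i | k i. k \<in> I} F" "\<And>k. k \<in> I \<Longrightarrow> a k = b k"
  shows "F a = F b"
  using assms by induction auto

lemma polynomial_fun_compose:
  assumes "polynomial_fun {\<lambda>a :: nat \<Rightarrow> complex ^ 3. a k $ i | k i. k \<in> I} F"
    and "\<And>k i. k \<in> I \<Longrightarrow> affine_polynomial (\<lambda>x. p x k $ i)"
  shows "affine_polynomial (\<lambda>x. F (p x))"
  using assms by induction (auto intro: affine_intros)

lemma polynomial_fun_bracket:
  assumes "i \<in> I" "j \<in> I" "k \<in> I"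
  shows "polynomial_fun {\<lambda>a :: nat \<Rightarrow> complex ^ 3. a k $ i | k i. k \<in> I} (\<lambda>a. bracket (a i) (a j) (a k))"
proof -
  let ?P = "polynomial_fun {\<lambda>a :: nat \<Rightarrow> complex ^ 3. a k $ i | k i. k \<in> I}"
  have c: "?P (\<lambda>a. a i $ m)" "?P (\<lambda>a. a j $ m)" "?P (\<lambda>a. a k $ m)" for m
    using assms by (auto intro!: polynomial_fun.coord)
  have d: "?P (\<lambda>a. F a - G a)" if "?P F" "?P G" for F G
  proof -
    have "?P (\<lambda>a. F a + (- 1) * G a)"
      using that by (intro polynomial_fun.add polynomial_fun.mult polynomial_fun.const)
    then show ?thesis by simp
  qed
  show ?thesis unfolding bracket_def
    by (intro polynomial_fun.add polynomial_fun.mult d c)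
qed

text \<open>Any two families of coordinates of the same lines differ by nonzero factors, which come out of a
  multihomogeneous function.\<close>

lemma multihomogeneous_nonzero_iff:
  assumes F: "multihomogeneous I d F" and I: "finite I" and a: "coordinates_of I a L"
  shows "(\<forall>b. coordinates_of I b L \<longrightarrow> F b \<noteq> 0) \<longleftrightarrow> F a \<noteq> 0"
proof
  assume "F a \<noteq> 0"
  show "\<forall>b. coordinates_of I b L \<longrightarrow> F b \<noteq> 0"
  proof (intro allI impI)
    fix b assume b: "coordinates_of I b L"
    have "\<forall>k\<in>I. \<exists>s. s \<noteq> 0 \<and> b k = s *s a k"
    proof
      fix k assume "k \<in> I"
      then have "a k \<noteq> 0" "b k \<noteq> 0" "line_of (b k) = line_of (a k)"
        using a b by (auto simp: coordinates_of_def)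
      then show "\<exists>s. s \<noteq> 0 \<and> b k = s *s a k" by (simp add: line_of_eq_iff proportional_def)
    qed
    then obtain s where s: "\<And>k. k \<in> I \<Longrightarrow> s k \<noteq> 0 \<and> b k = s k *s a k" by metis
    have "F b = F (\<lambda>k. s k *s a k)"
      using F s by (intro polynomial_fun_cong[of I]) (auto simp: multihomogeneous_def)
    also have "\<dots> = (\<Prod>k\<in>I. s k ^ d k) * F a" using F by (simp add: multihomogeneous_def)
    finally show "F b \<noteq> 0" using \<open>F a \<noteq> 0\<close> s I by simp
  qed
qed (use a in blast)

lemma multihomogeneous_indicator:
  assumes "polynomial_fun {\<lambda>a. a k $ i | k i. k \<in> I} F" "finite I" "J \<subseteq> I"
    and "\<And>s a. F (\<lambda>k. s k *s a k) = (\<Prod>k\<in>J. s k) * F a"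
  shows "multihomogeneous I (\<lambda>k. if k \<in> J then 1 else 0) F"
proof -
  have "(\<Prod>k\<in>I. s k ^ (if k \<in> J then 1 else 0)) = (\<Prod>k\<in>J. s k)" for s :: "nat \<Rightarrow> complex"
    using assms(2,3) by (intro prod.mono_neutral_cong_right) auto
  then show ?thesis using assms by (simp add: multihomogeneous_def)
qed

section \<open>The parameters of a net as projective invariants\<close>

text \<open>The quotients of the components of \<^term>\<open>param_num a\<close> and \<^term>\<open>param_den a\<close> recover \<open>u\<close> from the lines
  \<^term>\<open>rotation_net u\<close>, up to proportionality and projective maps. The lines 15, 22 and 8 are given
  by \<open>x + p\<close>, \<open>y + q\<close> and \<open>z + r\<close>, the rows of the sum of the identity matrix and the rotation. The
  inverse of this sum is half the sum of the identity matrix and a skew-symmetric matrix with entries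
  \<open>\<plusminus> u$i\<close>; so the lines 22 and 8 meet in the point \<open>(1, - u$3, u$2)\<close>, and 15 and 22 meet in
  \<open>(- u$2, u$1, 1)\<close>. A quotient of two coordinates is then obtained from the values of \<open>x \<plusminus> y\<close>,
  \<open>y \<plusminus> z\<close> or \<open>x \<plusminus> z\<close>, which are brackets; the second factor of each product makes up for the
  scaling of these forms.\<close>

definition param_num :: "(nat \<Rightarrow> 'a::field ^ 3) \<Rightarrow> 'a ^ 3" where
  "param_num a = vector
     [bracket (a 16) (a 15) (a 22) * bracket (a 13) (a 3) (a 6) - bracket (a 13) (a 15) (a 22) * bracket (a 16) (a 3) (a 6),
      bracket (a 20) (a 22) (a 8) * bracket (a 23) (a 3) (a 6) + bracket (a 23) (a 22) (a 8) * bracket (a 20) (a 3) (a 6),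
      bracket (a 3) (a 22) (a 8) * bracket (a 6) (a 13) (a 16) - bracket (a 6) (a 22) (a 8) * bracket (a 3) (a 13) (a 16)]"

definition param_den :: "(nat \<Rightarrow> 'a::field ^ 3) \<Rightarrow> 'a ^ 3" where
  "param_den a = vector
     [bracket (a 16) (a 15) (a 22) * bracket (a 13) (a 3) (a 6) + bracket (a 13) (a 15) (a 22) * bracket (a 16) (a 3) (a 6),
      bracket (a 20) (a 22) (a 8) * bracket (a 23) (a 3) (a 6) - bracket (a 23) (a 22) (a 8) * bracket (a 20) (a 3) (a 6),
      bracket (a 3) (a 22) (a 8) * bracket (a 6) (a 13) (a 16) + bracket (a 6) (a 22) (a 8) * bracket (a 3) (a 13) (a 16)]"

lemma param_rotation_net:
  "param_num (rotation_net u) = (16 * nrm u) *s vector [- u$1, - u$2, u$3]"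
  "param_den (rotation_net u) = (16 * nrm u) *s vector [- 1, - 1, 1]"
proof -
  have mid: "bracket v (rotation_net u 22) (rotation_net u 8) = 4 * nrm u * (v$1 - u$3 * v$2 + u$2 * v$3)"
    "bracket v (rotation_net u 15) (rotation_net u 22) = 4 * nrm u * (- u$2 * v$1 + u$1 * v$2 + v$3)" for v
    by (simp_all add: rotation_net_def frame_net_def Let_def vector3_arith bracket_def rot_x_def rot_y_def
        rot_z_def nrm_def; algebra)+
  have special: "rotation_net u 3 = vector [1, -1, 0]" "rotation_net u 6 = vector [1, 1, 0]"
    "rotation_net u 13 = vector [0, 1, -1]" "rotation_net u 16 = vector [0, 1, 1]"
    "rotation_net u 20 = vector [1, 0, 1]" "rotation_net u 23 = vector [1, 0, -1]"
    by (simp_all add: rotation_net_def frame_net_def)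
  show "param_num (rotation_net u) = (16 * nrm u) *s vector [- u$1, - u$2, u$3]"
    "param_den (rotation_net u) = (16 * nrm u) *s vector [- 1, - 1, 1]"
    unfolding param_num_def param_den_def mid
    by (simp_all add: special bracket_def vec3_eq_iff algebra_simps)
qed

lemma param_rotation_net_component:
  obtains e :: "'a::field_char_0" where "e \<noteq> 0"
    "\<And>u :: 'a ^ 3. param_den (rotation_net u) $ i = e * nrm u"
    "\<And>u :: 'a ^ 3. param_num (rotation_net u) $ i = e * nrm u * u $ i"
proof
  let ?e = "if i = 3 then 16 else - 16 :: 'a"
  show "?e \<noteq> 0" by simp
  show "param_den (rotation_net u) $ i = ?e * nrm u" "param_num (rotation_net u) $ i = ?e * nrm u * u $ i"
    for u :: "'a ^ 3"
    using exhaust_3[of i] by (auto simp: param_rotation_net)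
qed

text \<open>In each component all products of brackets contain the same six lines, so numerator and
  denominator are multiplied by the same factor.\<close>

lemma param_invariant:
  fixes T :: "'a::field ^ 3 ^ 3"
  assumes T: "invertible T" and ab: "\<And>k. k \<in> {1..24} \<Longrightarrow> proportional (a k) (T *v b k)"
  shows "\<exists>c. c \<noteq> 0 \<and> param_num a $ i = c * param_num b $ i \<and> param_den a $ i = c * param_den b $ i"
proof -
  have "\<forall>k\<in>{1..24}. \<exists>s. s \<noteq> 0 \<and> a k = s *s (T *v b k)" using ab by (simp add: proportional_def)
  then obtain s where s: "\<And>k. k \<in> {1..24} \<Longrightarrow> s k \<noteq> 0 \<and> a k = s k *s (T *v b k)" by metis
  have k: "a 3 = s 3 *s (T *v b 3)" "a 6 = s 6 *s (T *v b 6)" "a 8 = s 8 *s (T *v b 8)"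
    "a 13 = s 13 *s (T *v b 13)" "a 15 = s 15 *s (T *v b 15)" "a 16 = s 16 *s (T *v b 16)"
    "a 20 = s 20 *s (T *v b 20)" "a 22 = s 22 *s (T *v b 22)" "a 23 = s 23 *s (T *v b 23)"
    using s by simp_all
  have nz: "s 3 \<noteq> 0" "s 6 \<noteq> 0" "s 8 \<noteq> 0" "s 13 \<noteq> 0" "s 15 \<noteq> 0" "s 16 \<noteq> 0" "s 20 \<noteq> 0" "s 22 \<noteq> 0"
    "s 23 \<noteq> 0" "det T \<noteq> 0"
    using s T by (simp_all add: invertible_det_nz)
  note e = param_num_def param_den_def k bracket_smult bracket_matrix vector_3
  consider "i = 1" | "i = 2" | "i = 3" using exhaust_3 by blast
  then show ?thesis
  proof cases
    case 1
    show ?thesis unfolding 1 e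
      by (rule exI[of _ "s 16 * s 15 * s 22 * s 13 * s 3 * s 6 * (det T)^2"])
        (simp add: nz power2_eq_square algebra_simps)
  next
    case 2
    show ?thesis unfolding 2 e
      by (rule exI[of _ "s 20 * s 22 * s 8 * s 23 * s 3 * s 6 * (det T)^2"])
        (simp add: nz power2_eq_square algebra_simps)
  next
    case 3
    show ?thesis unfolding 3 e
      by (rule exI[of _ "s 3 * s 22 * s 8 * s 6 * s 13 * s 16 * (det T)^2"])
        (simp add: nz power2_eq_square algebra_simps)
  qed
qed

lemma param_multihomogeneous:
  "\<exists>d. multihomogeneous {1..24} d (\<lambda>a. param_num a $ i) \<and> multihomogeneous {1..24} d (\<lambda>a. param_den a $ i)"
proof -
  let ?P = "polynomial_fun {\<lambda>a :: nat \<Rightarrow> complex ^ 3. a k $ i | k i. k \<in> {1..24}}"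
  have b: "?P (\<lambda>a. bracket (a i) (a j) (a k))" if "i \<in> {1..24}" "j \<in> {1..24}" "k \<in> {1..24}" for i j k
    using that by (rule polynomial_fun_bracket)
  have d: "?P (\<lambda>a. F a - G a)" if "?P F" "?P G" for F G
  proof -
    have "?P (\<lambda>a. F a + (- 1) * G a)"
      using that by (intro polynomial_fun.add polynomial_fun.mult polynomial_fun.const)
    then show ?thesis by simp
  qed
  have poly: "?P (\<lambda>a. param_num a $ i)" "?P (\<lambda>a. param_den a $ i)"
  proof -
    have "?P (\<lambda>a. param_num a $ 1)" "?P (\<lambda>a. param_num a $ 2)" "?P (\<lambda>a. param_num a $ 3)"
      "?P (\<lambda>a. param_den a $ 1)" "?P (\<lambda>a. param_den a $ 2)" "?P (\<lambda>a. param_den a $ 3)"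
      unfolding param_num_def param_den_def vector_3
      by (intro d polynomial_fun.add polynomial_fun.mult b; simp)+
    then show "?P (\<lambda>a. param_num a $ i)" "?P (\<lambda>a. param_den a $ i)" using exhaust_3[of i] by auto
  qed
  consider "i = 1" | "i = 2" | "i = 3" using exhaust_3 by blast
  then show ?thesis
  proof cases
    case 1
    show ?thesis
      by (rule exI[of _ "\<lambda>k. if k \<in> {3, 6, 13, 15, 16, 22} then 1 else 0"],
          intro conjI multihomogeneous_indicator poly)
        (simp_all add: 1 param_num_def param_den_def bracket_smult algebra_simps)
  next
    case 2
    show ?thesis
      by (rule exI[of _ "\<lambda>k. if k \<in> {3, 6, 8, 20, 22, 23} then 1 else 0"],
          intro conjI multihomogeneous_indicator poly)
        (simp_all add: 2 param_num_def param_den_def bracket_smult algebra_simps)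
  next
    case 3
    show ?thesis
      by (rule exI[of _ "\<lambda>k. if k \<in> {3, 6, 8, 13, 16, 22} then 1 else 0"],
          intro conjI multihomogeneous_indicator poly)
        (simp_all add: 3 param_num_def param_den_def bracket_smult algebra_simps)
  qed
qed

text \<open>By clearing denominators, a polynomial in the parameters becomes a quotient of multihomogeneous
  functions of equal degrees. This makes the inverse of the parametrization continuous.\<close>

lemma polynomial_in_parameters:
  assumes "affine_polynomial p"
  shows "\<exists>d F G. multihomogeneous {1..24} d F \<and> multihomogeneous {1..24} d G \<and>
    (\<forall>a v. (\<forall>i. param_den a $ i \<noteq> 0 \<and> param_num a $ i = v $ i * param_den a $ i) \<longrightarrow>
       G a \<noteq> 0 \<and> F a = G a * p v)"
  using assms unfolding affine_polynomial_def
proof induction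
  case (coord f)
  then obtain i where f: "f = (\<lambda>x. x $ i)" by auto
  obtain d where d: "multihomogeneous {1..24} d (\<lambda>a. param_num a $ i)"
    "multihomogeneous {1..24} d (\<lambda>a. param_den a $ i)"
    using param_multihomogeneous by blast
  show ?case unfolding f
    by (intro exI conjI, rule d(1), rule d(2)) (auto simp: mult.commute)
next
  case (const c)
  show ?case
    by (intro exI conjI, rule multihomogeneous_const[of _ c], rule multihomogeneous_const[of _ 1]) auto
next
  case (add f g)
  then obtain d F G e F' G' where
    F: "multihomogeneous {1..24} d F" "multihomogeneous {1..24} d G"
      "\<And>a v. (\<forall>i. param_den a $ i \<noteq> 0 \<and> param_num a $ i = v $ i * param_den a $ i) \<Longrightarrow>
        G a \<noteq> 0 \<and> F a = G a * f v" and
    F': "multihomogeneous {1..24} e F'" "multihomogeneous {1..24} e G'"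
      "\<And>a v. (\<forall>i. param_den a $ i \<noteq> 0 \<and> param_num a $ i = v $ i * param_den a $ i) \<Longrightarrow>
        G' a \<noteq> 0 \<and> F' a = G' a * g v"
    by blast
  have "multihomogeneous {1..24} (\<lambda>k. d k + e k) (\<lambda>a. F a * G' a + G a * F' a)"
    by (intro multihomogeneous_add multihomogeneous_mult F F')
  moreover have "multihomogeneous {1..24} (\<lambda>k. d k + e k) (\<lambda>a. G a * G' a)"
    by (intro multihomogeneous_mult F F')
  moreover have "G a * G' a \<noteq> 0 \<and> F a * G' a + G a * F' a = G a * G' a * (f v + g v)"
    if "\<forall>i. param_den a $ i \<noteq> 0 \<and> param_num a $ i = v $ i * param_den a $ i" for a v
    using F(3)[OF that] F'(3)[OF that] by (simp add: algebra_simps)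
  ultimately show ?case by blast
next
  case (mult f g)
  then obtain d F G e F' G' where
    F: "multihomogeneous {1..24} d F" "multihomogeneous {1..24} d G"
      "\<And>a v. (\<forall>i. param_den a $ i \<noteq> 0 \<and> param_num a $ i = v $ i * param_den a $ i) \<Longrightarrow>
        G a \<noteq> 0 \<and> F a = G a * f v" and
    F': "multihomogeneous {1..24} e F'" "multihomogeneous {1..24} e G'"
      "\<And>a v. (\<forall>i. param_den a $ i \<noteq> 0 \<and> param_num a $ i = v $ i * param_den a $ i) \<Longrightarrow>
        G' a \<noteq> 0 \<and> F' a = G' a * g v"
    by blast
  have "multihomogeneous {1..24} (\<lambda>k. d k + e k) (\<lambda>a. F a * F' a)"
    by (intro multihomogeneous_mult F F')
  moreover have "multihomogeneous {1..24} (\<lambda>k. d k + e k) (\<lambda>a. G a * G' a)"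
    by (intro multihomogeneous_mult F F')
  moreover have "G a * G' a \<noteq> 0 \<and> F a * F' a = G a * G' a * (f v * g v)"
    if "\<forall>i. param_den a $ i \<noteq> 0 \<and> param_num a $ i = v $ i * param_den a $ i" for a v
    using F(3)[OF that] F'(3)[OF that] by (simp add: algebra_simps)
  ultimately show ?case by blast
qed

section \<open>The moduli space\<close>

text \<open>Only nondegeneracy restricts \<open>u\<close>, as the incidences hold for all \<open>u\<close>.\<close>

definition rotation_params :: "(complex ^ 3) set" where
  "rotation_params = {u. net_coordinates 8 quaternion_square (rotation_net u)}"

definition rotation_class :: "complex ^ 3 \<Rightarrow> (nat \<Rightarrow> (complex ^ 3) set) set" where
  "rotation_class u = proj_equiv 8 quaternion_square `` {net_of 8 (rotation_net u)}"

text \<open>If the norm vanished, then the lines 9 and 10 would coincide.\<close>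

lemma nrm_ne_0:
  assumes "u \<in> rotation_params"
  shows "nrm u \<noteq> 0"
proof
  assume 0: "nrm u = 0"
  have "bracket (rotation_net u 9) (rotation_net u 10) (rotation_net u 1) \<noteq> 0"
    using assms quaternion_bracket_ne_0[of "rotation_net u" 9 10 1] by (simp add: rotation_params_def)
  moreover have "rotation_net u 9 = (- 1) *s rotation_net u 10"
    by (simp add: rotation_net_def frame_net_def 0 vec3_eq_iff)
  ultimately show False by (simp only: bracket_smult bracket_same) simp
qed

lemma rotation_class_surj:
  assumes "C \<in> moduli_space 8 quaternion_square"
  shows "\<exists>u\<in>rotation_params. C = rotation_class u"
proof -
  note M = latin_square_quaternion_square
  have q: "2 \<le> (8 :: nat)" by simp
  obtain L where L: "L \<in> nets_with_data 8 quaternion_square" "C = proj_equiv 8 quaternion_square `` {L}"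
    using assms unfolding moduli_space_def by (auto elim: quotientE)
  obtain a where a: "net_coordinates 8 quaternion_square a" "L = net_of 8 a"
    using obtain_net_coordinates[OF L(1) M] by blast
  note ne = quaternion_bracket_ne_0[OF a(1)]
  have gp: "general_position (a 3) (a 6) (a 13) (a 16)"
  proof -
    have "bracket (a 3) (a 6) (a 13) \<noteq> 0" "bracket (a 3) (a 6) (a 16) \<noteq> 0"
      "bracket (a 13) (a 16) (a 6) \<noteq> 0" "bracket (a 13) (a 16) (a 3) \<noteq> 0"
      using ne[of 3 6 13] ne[of 3 6 16] ne[of 13 16 6] ne[of 13 16 3] by simp_all
    moreover have "bracket (a 16) (a 6) (a 13) = bracket (a 13) (a 16) (a 6)"
      "bracket (a 3) (a 16) (a 13) = - bracket (a 13) (a 16) (a 3)"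
      by (simp_all add: bracket_def algebra_simps)
    ultimately show ?thesis by (simp add: general_position_def)
  qed
  have "general_position (vector [1, -1, 0]) (vector [1, 1, 0]) (vector [0, 1, -1]) (vector [0, 1, 1] :: complex ^ 3)"
    by (simp add: general_position_def bracket_def)
  then obtain T :: "complex ^ 3 ^ 3" where T: "invertible T"
    "proportional (T *v a 3) (vector [1, -1, 0])" "proportional (T *v a 6) (vector [1, 1, 0])"
    "proportional (T *v a 13) (vector [0, 1, -1])" "proportional (T *v a 16) (vector [0, 1, 1])"
    using obtain_frame_change[OF gp] by blast
  have b: "net_coordinates 8 quaternion_square (\<lambda>k. T *v a k)"
    using a(1) T(1) by (rule net_coordinates_matrix)
  obtain u where u: "\<And>k. k \<in> {1..24} \<Longrightarrow> proportional (T *v a k) (rotation_net u k)"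
    using rotation_net_normal_form[OF b T(2-5)] by blast
  then have "net_coordinates 8 quaternion_square (rotation_net u)"
    using net_coordinates_proportional[OF b M] by simp
  then have "u \<in> rotation_params" by (simp add: rotation_params_def)
  moreover have "net_of 8 (\<lambda>k. T *v a k) = net_of 8 (rotation_net u)"
    using u by (intro net_of_proportional[OF q M]) simp
  then have "(L, net_of 8 (rotation_net u)) \<in> proj_equiv 8 quaternion_square"
    unfolding a(2) proj_equiv_net_of[OF q M a(1)] using T(1) by metis
  then have "C = rotation_class u"
    unfolding L(2) rotation_class_def by (rule equiv_class_eq[OF equiv_proj_equiv[OF q M]])
  ultimately show ?thesis by blast
qed

lemma rotation_class_in_moduli_space:
  "u \<in> rotation_params \<Longrightarrow> rotation_class u \<in> moduli_space 8 quaternion_square"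
  unfolding moduli_space_def rotation_class_def rotation_params_def
  using net_of_in_nets[of 8 quaternion_square "rotation_net u"] latin_square_quaternion_square
  by (auto intro: quotientI)

lemma rotation_class_inj: "inj_on rotation_class rotation_params"
proof (rule inj_onI)
  note M = latin_square_quaternion_square
  have q: "2 \<le> (8 :: nat)" by simp
  fix u v assume uv: "u \<in> rotation_params" "v \<in> rotation_params" "rotation_class u = rotation_class v"
  have nu: "net_coordinates 8 quaternion_square (rotation_net u)"
    and nv: "net_coordinates 8 quaternion_square (rotation_net v)"
    using uv by (auto simp: rotation_params_def)
  have "(net_of 8 (rotation_net u), net_of 8 (rotation_net v)) \<in> proj_equiv 8 quaternion_square"
    using uv(3) net_of_in_nets[OF q M nv] unfolding rotation_class_def
    by (intro eq_equiv_class[OF _ equiv_proj_equiv[OF q M]])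
  then obtain T :: "complex ^ 3 ^ 3" where T: "invertible T"
    "net_of 8 (rotation_net v) = net_of 8 (\<lambda>k. T *v rotation_net u k)"
    unfolding proj_equiv_net_of[OF q M nu] by blast
  have same_lines: "proportional (rotation_net v k) (T *v rotation_net u k)" if k: "k \<in> {1..24}" for k
  proof -
    have "line_of (rotation_net v k) = line_of (T *v rotation_net u k)"
      using fun_cong[OF T(2), of k] k by (simp add: net_of_def)
    moreover have "rotation_net v k \<noteq> 0" "T *v rotation_net u k \<noteq> 0"
      using net_coordinates_ne_0[OF nv q, of k] k
        net_coordinates_ne_0[OF net_coordinates_matrix[OF nu T(1)] q, of k] by simp_all
    ultimately show ?thesis by (simp add: line_of_eq_iff)
  qed
  have inv: "\<exists>c. c \<noteq> 0 \<and> param_num (rotation_net v) $ i = c * param_num (rotation_net u) $ i \<and>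
      param_den (rotation_net v) $ i = c * param_den (rotation_net u) $ i" for i
    by (rule param_invariant[OF T(1) same_lines])
  have N: "nrm u \<noteq> 0" "nrm v \<noteq> 0" using uv nrm_ne_0 by blast+
  have "u $ i = v $ i" for i
  proof -
    obtain e :: complex where e: "e \<noteq> 0" "\<And>u. param_den (rotation_net u) $ i = e * nrm u"
      "\<And>u. param_num (rotation_net u) $ i = e * nrm u * u $ i"
      using param_rotation_net_component by blast
    from inv[of i] obtain c where c: "param_num (rotation_net v) $ i = c * param_num (rotation_net u) $ i"
      "param_den (rotation_net v) $ i = c * param_den (rotation_net u) $ i"
      by blast
    have "e * nrm v * v $ i = c * (e * nrm u) * u $ i" using c(1) by (simp only: e mult.assoc)
    also have "\<dots> = e * nrm v * u $ i" using c(2) by (simp only: e)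
    finally show ?thesis using e(1) N by simp
  qed
  then show "u = v" by (simp add: vec_eq_iff)
qed

lemma standard_coordinates_matrix:
  assumes q: "2 \<le> q" and M: "latin_square q M" and a: "net_coordinates q M a"
  shows "\<exists>T. invertible T \<and> standard_coordinates q a = (\<lambda>k. T *v a k)"
proof -
  obtain T where T: "invertible T"
    "\<And>v. to_frame (a 1) (a 2) (a (q + 1)) (a (q + 2)) v = T *v v"
    using to_frame_matrix[OF net_general_position[OF q M a]] by blast
  then show ?thesis unfolding standard_coordinates_def[OF q M] by blast
qed

lemma affine_bracket:
  assumes "\<And>i. affine_polynomial (\<lambda>x. a x $ i)" "\<And>i. affine_polynomial (\<lambda>x. b x $ i)"
    "\<And>i. affine_polynomial (\<lambda>x. c x $ i)"
  shows "affine_polynomial (\<lambda>x. bracket (a x) (b x) (c x))"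
  unfolding bracket_def by (intro affine_add affine_mult affine_diff assms)

lemma affine_vector:
  assumes "affine_polynomial a" "affine_polynomial b" "affine_polynomial c"
  shows "affine_polynomial (\<lambda>x. vector [a x, b x, c x] $ (i :: 3))"
  using exhaust_3[of i] assms by auto

lemma affine_rotation_net:
  assumes "k \<in> {1..24}"
  shows "affine_polynomial (\<lambda>u. rotation_net u k $ i)"
  using assms unfolding atLeastAtMost_24
  by (elim insertE emptyE)
    (simp_all add: rotation_net_def frame_net_def Let_def vector3_arith rot_x_def rot_y_def rot_z_def nrm_def,
      (intro affine_vector affine_intros)+)

lemma affine_standard_coordinates:
  assumes "k \<in> {1..24}"
  shows "affine_polynomial (\<lambda>u. standard_coordinates 8 (rotation_net u) k $ i)"
proof -
  have q: "2 \<le> (8 :: nat)" by simp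
  show ?thesis
    unfolding standard_coordinates_def[OF q latin_square_quaternion_square] to_frame_def
    by (intro affine_vector affine_mult affine_bracket affine_rotation_net) (use assms in auto)
qed

lemma openin_rotation_params: "openin zariski_affine rotation_params"
  unfolding openin_zariski_affine
proof
  fix u assume u: "u \<in> rotation_params"
  define S where "S = {(k, k', m). k \<in> {1..24} \<and> k' \<in> {1..24} \<and> m \<in> {1..24} \<and>
    (k - 1) div 8 = (k' - 1) div 8 \<and> k \<noteq> k' \<and> (m - 1) div 8 \<noteq> (k - 1) div (8 :: nat)}"
  have "S \<subseteq> {1..24} \<times> {1..24} \<times> {1..24}" by (auto simp: S_def)
  then have fin: "finite S" by (rule finite_subset) auto
  define b where "b v = (\<lambda>(k, k', m). bracket (rotation_net v k) (rotation_net v k') (rotation_net v m))"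
    for v :: "complex ^ 3"
  have params: "v \<in> rotation_params \<longleftrightarrow> (\<forall>t\<in>S. b v t \<noteq> 0)" for v
    using rotation_net_concurrent[of _ _ v]
    by (auto simp: rotation_params_def net_coordinates_def S_def b_def)
  have "affine_polynomial (\<lambda>v. b v t)" if "t \<in> S" for t
    using that unfolding b_def S_def
    by (auto simp: case_prod_unfold intro!: affine_bracket affine_rotation_net)
  then have "affine_polynomial (\<lambda>v. \<Prod>t\<in>S. b v t)" by (rule affine_prod)
  moreover have "(\<Prod>t\<in>S. b v t) \<noteq> 0 \<longleftrightarrow> v \<in> rotation_params" for v
    using fin by (simp add: params)
  ultimately show "\<exists>p. affine_polynomial p \<and> p u \<noteq> 0 \<and> (\<forall>y. p y \<noteq> 0 \<longrightarrow> y \<in> rotation_params)"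
    using u by blast
qed

lemma standard_net_rotation_class:
  assumes "u \<in> rotation_params"
  shows "standard_net 8 (rotation_class u) = net_of 8 (standard_coordinates 8 (rotation_net u))"
    and "coordinates_of {1..24} (standard_coordinates 8 (rotation_net u)) (standard_net 8 (rotation_class u))"
    and "standard_net 8 (rotation_class u) \<in> {1..24} \<rightarrow>\<^sub>E proj_lines"
proof -
  note M = latin_square_quaternion_square
  have q: "2 \<le> (8 :: nat)" by simp
  have a: "net_coordinates 8 quaternion_square (rotation_net u)"
    using assms by (simp add: rotation_params_def)
  show st: "standard_net 8 (rotation_class u) = net_of 8 (standard_coordinates 8 (rotation_net u))"
    unfolding rotation_class_def by (rule standard_net_class[OF q M a])
  obtain T where T: "invertible T" "standard_coordinates 8 (rotation_net u) = (\<lambda>k. T *v rotation_net u k)"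
    using standard_coordinates_matrix[OF q M a] by blast
  have nz: "standard_coordinates 8 (rotation_net u) k \<noteq> 0" if "k \<in> {1..24}" for k
    unfolding T(2) using net_coordinates_ne_0[OF net_coordinates_matrix[OF a T(1)] q, of k] that by simp
  then show "coordinates_of {1..24} (standard_coordinates 8 (rotation_net u)) (standard_net 8 (rotation_class u))"
    unfolding st by (simp add: coordinates_of_def net_of_def)
  show "standard_net 8 (rotation_class u) \<in> {1..24} \<rightarrow>\<^sub>E proj_lines"
    unfolding st using nz by (auto simp: net_of_def proj_lines_def)
qed

lemma param_of_standard_coordinates:
  assumes "u \<in> rotation_params"
  shows "\<forall>i. param_den (standard_coordinates 8 (rotation_net u)) $ i \<noteq> 0 \<and>
    param_num (standard_coordinates 8 (rotation_net u)) $ i =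
      u $ i * param_den (standard_coordinates 8 (rotation_net u)) $ i"
proof
  fix i
  note M = latin_square_quaternion_square
  have q: "2 \<le> (8 :: nat)" by simp
  have a: "net_coordinates 8 quaternion_square (rotation_net u)"
    using assms by (simp add: rotation_params_def)
  obtain T where T: "invertible T" "standard_coordinates 8 (rotation_net u) = (\<lambda>k. T *v rotation_net u k)"
    using standard_coordinates_matrix[OF q M a] by blast
  obtain e :: complex where e: "e \<noteq> 0" "\<And>u. param_den (rotation_net u) $ i = e * nrm u"
    "\<And>u. param_num (rotation_net u) $ i = e * nrm u * u $ i"
    using param_rotation_net_component by blast
  have "\<exists>c. c \<noteq> 0 \<and>
      param_num (standard_coordinates 8 (rotation_net u)) $ i = c * param_num (rotation_net u) $ i \<and>
      param_den (standard_coordinates 8 (rotation_net u)) $ i = c * param_den (rotation_net u) $ i"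
    by (rule param_invariant[OF T(1)]) (simp add: T(2))
  then obtain c where c: "c \<noteq> 0"
    "param_num (standard_coordinates 8 (rotation_net u)) $ i = c * param_num (rotation_net u) $ i"
    "param_den (standard_coordinates 8 (rotation_net u)) $ i = c * param_den (rotation_net u) $ i"
    by blast
  show "param_den (standard_coordinates 8 (rotation_net u)) $ i \<noteq> 0 \<and>
    param_num (standard_coordinates 8 (rotation_net u)) $ i =
      u $ i * param_den (standard_coordinates 8 (rotation_net u)) $ i"
    using c(1) e(1) nrm_ne_0[OF assms] by (simp add: c(2,3) e(2,3))
qed

lemma topspace_zariski_lines: "{1..24} \<rightarrow>\<^sub>E proj_lines \<subseteq> topspace (zariski_lines {1..24})"
proof -
  have one: "multihomogeneous_polynomial {1..24} (\<lambda>a. 1)"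
    using multihomogeneous_const[of _ 1] multihomogeneous_polynomial_iff by blast
  have "openin (zariski_lines {1..24})
      {L \<in> {1..24} \<rightarrow>\<^sub>E proj_lines. \<forall>a. coordinates_of {1..24} a L \<longrightarrow> (1 :: complex) \<noteq> 0}"
    unfolding zariski_lines_def
    by (rule topology_generated_by_Basis, rule CollectI, rule exI[of _ "\<lambda>a. 1"], rule conjI[OF refl one])
  then show ?thesis using openin_subset by fastforce
qed

lemma rotation_class_image: "rotation_class ` rotation_params = moduli_space 8 quaternion_square"
  using rotation_class_surj rotation_class_in_moduli_space by blast

lemma topspace_moduli: "topspace (moduli_topology 8 quaternion_square) = moduli_space 8 quaternion_square"
proof -
  have "standard_net 8 C \<in> {1..24} \<rightarrow>\<^sub>E proj_lines" if "C \<in> moduli_space 8 quaternion_square" for C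
    using that rotation_class_surj standard_net_rotation_class(3) by blast
  then have "standard_net 8 C \<in> topspace (zariski_lines {1..24})"
    if "C \<in> moduli_space 8 quaternion_square" for C
    using that topspace_zariski_lines by blast
  then show ?thesis by (auto simp: moduli_topology_def topspace_pullback_topology)
qed

text \<open>Both directions compare basic open sets. A multihomogeneous function of the standard coordinates
  is a polynomial in \<open>u\<close>; conversely, a polynomial in \<open>u\<close> has the same zeros as a multihomogeneous
  function of the lines, because the parameters are quotients of such functions.\<close>

lemma homeomorphic_rotation_class:
  "homeomorphic_map (subtopology zariski_affine rotation_params)
    (moduli_topology 8 quaternion_square) rotation_class"
proof (rule bijective_open_imp_homeomorphic_map)
  let ?X = "subtopology zariski_affine rotation_params" and ?Y = "moduli_topology 8 quaternion_square"
  let ?I = "{1..24 :: nat}"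
  let ?a = "\<lambda>u. standard_coordinates 8 (rotation_net u)"
  have Y: "?Y = pullback_topology (moduli_space 8 quaternion_square) (standard_net 8) (zariski_lines ?I)"
    by (simp add: moduli_topology_def)
  have basic: "standard_net 8 (rotation_class u) \<in>
      {L \<in> ?I \<rightarrow>\<^sub>E proj_lines. \<forall>a. coordinates_of ?I a L \<longrightarrow> F a \<noteq> 0} \<longleftrightarrow> F (?a u) \<noteq> 0"
    if "u \<in> rotation_params" "multihomogeneous ?I d F" for u d F
    using standard_net_rotation_class(2,3)[OF that(1)]
      multihomogeneous_nonzero_iff[OF that(2) finite_atLeastAtMost standard_net_rotation_class(2)[OF that(1)]]
    by blast
  show "continuous_map ?X ?Y rotation_class"
    unfolding Y
  proof (rule continuous_map_pullback')
    show "topspace ?X \<subseteq> rotation_class -` moduli_space 8 quaternion_square"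
      using rotation_class_in_moduli_space by auto
    show "continuous_map ?X (zariski_lines ?I) (standard_net 8 \<circ> rotation_class)"
      unfolding zariski_lines_def
    proof (rule continuous_on_generated_topo)
      fix W assume "W \<in> {{L \<in> ?I \<rightarrow>\<^sub>E proj_lines. \<forall>a. coordinates_of ?I a L \<longrightarrow> F a \<noteq> 0} | F.
          multihomogeneous_polynomial ?I F}"
      then obtain F d where F: "multihomogeneous ?I d F"
        and W: "W = {L \<in> ?I \<rightarrow>\<^sub>E proj_lines. \<forall>a. coordinates_of ?I a L \<longrightarrow> F a \<noteq> 0}"
        unfolding multihomogeneous_polynomial_iff by blast
      have "(standard_net 8 \<circ> rotation_class) -` W \<inter> topspace ?X = {u. F (?a u) \<noteq> 0} \<inter> rotation_params"
        using basic[OF _ F] unfolding W by auto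
      moreover have poly: "polynomial_fun {\<lambda>a. a k $ i | k i. k \<in> ?I} F"
        using F unfolding multihomogeneous_def by blast
      have "openin zariski_affine {u. F (?a u) \<noteq> 0}"
        by (rule openin_basic) (rule polynomial_fun_compose[OF poly affine_standard_coordinates])
      ultimately show "openin ?X ((standard_net 8 \<circ> rotation_class) -` W \<inter> topspace ?X)"
        unfolding openin_subtopology by blast
    next
      show "(standard_net 8 \<circ> rotation_class) ` topspace ?X \<subseteq>
          \<Union> {{L \<in> ?I \<rightarrow>\<^sub>E proj_lines. \<forall>a. coordinates_of ?I a L \<longrightarrow> F a \<noteq> 0} | F.
          multihomogeneous_polynomial ?I F}"
        unfolding topology_generated_by_topspace[symmetric] zariski_lines_def[symmetric]
      proof (rule image_subsetI)
        fix u assume "u \<in> topspace ?X"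
        then have "u \<in> rotation_params" by simp
        then show "(standard_net 8 \<circ> rotation_class) u \<in> topspace (zariski_lines ?I)"
          using standard_net_rotation_class(3) topspace_zariski_lines unfolding o_apply by blast
      qed
    qed
  qed
  show "open_map ?X ?Y rotation_class"
    unfolding open_map_def
  proof (intro allI impI)
    fix S assume "openin ?X S"
    then obtain W where W: "openin zariski_affine W" "S = W \<inter> rotation_params"
      by (auto simp: openin_subtopology)
    show "openin ?Y (rotation_class ` S)"
    proof (subst openin_subopen, intro ballI)
      fix C assume "C \<in> rotation_class ` S"
      then obtain u where u: "u \<in> W" "u \<in> rotation_params" "C = rotation_class u" using W(2) by blast
      then obtain p where p: "affine_polynomial p" "p u \<noteq> 0" "\<And>y. p y \<noteq> 0 \<Longrightarrow> y \<in> W"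
        using W(1) unfolding openin_zariski_affine by blast
      obtain d F G where F: "multihomogeneous ?I d F"
        "\<And>a v. (\<forall>i. param_den a $ i \<noteq> 0 \<and> param_num a $ i = v $ i * param_den a $ i) \<Longrightarrow>
          G a \<noteq> 0 \<and> F a = G a * p v"
        using polynomial_in_parameters[OF p(1)] by blast
      have Fp: "F (?a v) \<noteq> 0 \<longleftrightarrow> p v \<noteq> 0" if "v \<in> rotation_params" for v
        using F(2)[OF param_of_standard_coordinates[OF that]] by auto
      let ?N = "{L \<in> ?I \<rightarrow>\<^sub>E proj_lines. \<forall>a. coordinates_of ?I a L \<longrightarrow> F a \<noteq> 0}"
      let ?T = "standard_net 8 -` ?N \<inter> moduli_space 8 quaternion_square"
      have "openin (zariski_lines ?I) ?N"
        unfolding zariski_lines_def using F(1) multihomogeneous_polynomial_iff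
        by (intro topology_generated_by_Basis) blast
      then have "openin ?Y ?T" unfolding Y openin_pullback_topology by blast
      have mem: "rotation_class v \<in> ?T \<longleftrightarrow> p v \<noteq> 0" if "v \<in> rotation_params" for v
        using basic[OF that F(1)] Fp[OF that] rotation_class_in_moduli_space[OF that] by blast
      have "C \<in> ?T" unfolding u(3) using p(2) by (rule mem[OF u(2), THEN iffD2])
      moreover have "?T \<subseteq> rotation_class ` S"
      proof
        fix D assume D: "D \<in> ?T"
        then obtain v where v: "v \<in> rotation_params" "D = rotation_class v"
          using rotation_class_surj[OF IntD2] by blast
        have "p v \<noteq> 0" using D unfolding v(2) by (rule mem[OF v(1), THEN iffD1])
        then have "v \<in> S" using p(3) v(1) W(2) by blast
        then show "D \<in> rotation_class ` S" unfolding v(2) by (rule imageI)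
      qed
      ultimately show "\<exists>T. openin ?Y T \<and> C \<in> T \<and> T \<subseteq> rotation_class ` S"
        using \<open>openin ?Y ?T\<close> by (intro exI[of _ ?T] conjI)
    qed
  qed
  show "rotation_class ` topspace ?X = topspace ?Y"
    by (simp add: topspace_moduli rotation_class_image)
  show "inj_on rotation_class (topspace ?X)"
    using rotation_class_inj by simp
qed

section \<open>A net over the rational numbers and the theorem\<close>

definition int_bracket :: "int \<times> int \<times> int \<Rightarrow> int \<times> int \<times> int \<Rightarrow> int \<times> int \<times> int \<Rightarrow> int" where
  "int_bracket = (\<lambda>(a1, a2, a3) (b1, b2, b3) (c1, c2, c3).
     a1 * (b2 * c3 - b3 * c2) + a2 * (b3 * c1 - b1 * c3) + a3 * (b1 * c2 - b2 * c1))"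

definition int_vector :: "int \<times> int \<times> int \<Rightarrow> complex ^ 3" where
  "int_vector = (\<lambda>(a1, a2, a3). vector [of_int a1, of_int a2, of_int a3])"

text \<open>The lines of \<^term>\<open>rotation_net u\<close> for \<open>u = (- 5, - 4, 3)\<close>. All integral points whose components
  have absolute value at most 4 give degenerate nets.\<close>

definition int_lines :: "(int \<times> int \<times> int) list" where
  "int_lines = [
     (1, 34, 13), (- 1, - 34, 89), (1, - 1, 0), (46, - 17, 37),
     (22, 34, 82), (1, 1, 0), (- 46, 17, 65), (- 22, - 34, 20),
     (5, 17, 14), (97, - 17, - 14), (73, 34, 31), (50, - 34, 38),
     (0, 1, - 1), (29, - 34, - 31), (52, 34, - 38), (0, 1, 1),
     (- 22, 17, - 31), (22, 85, 31), (- 46, 68, 14), (1, 0, 1),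
     (1, 85, - 38), (46, 34, - 14), (1, 0, - 1), (- 1, 17, 38)]"

lemma bracket_int_vector: "bracket (int_vector a) (int_vector b) (int_vector c) = of_int (int_bracket a b c)"
  by (cases a; cases b; cases c) (simp add: int_vector_def bracket_def int_bracket_def)

lemma int_lines_nondegenerate:
  "\<forall>(A, B) \<in> set [(A, B). A \<leftarrow> [0, 1, 2], B \<leftarrow> [0, 1, 2], A \<noteq> B].
     \<forall>i \<in> set [0..<8]. \<forall>j \<in> set [0..<8]. i \<noteq> j \<longrightarrow> (\<forall>k \<in> set [0..<8].
       int_bracket (int_lines ! (8 * A + i)) (int_lines ! (8 * A + j)) (int_lines ! (8 * B + k)) \<noteq> 0)"
  by code_simp

abbreviation sample_point :: "complex ^ 3" where
  "sample_point \<equiv> vector [- 5, - 4, 3]"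

lemma rotation_net_sample:
  assumes "k \<in> {1..24}"
  shows "rotation_net sample_point k = int_vector (int_lines ! (k - 1))"
  using assms unfolding atLeastAtMost_24
  by (elim insertE emptyE)
    (simp_all add: rotation_net_def frame_net_def Let_def vector3_arith rot_x_def rot_y_def rot_z_def
      nrm_def int_vector_def int_lines_def)

lemma sample_point_in_rotation_params: "sample_point \<in> rotation_params"
proof -
  have "bracket (rotation_net sample_point k) (rotation_net sample_point k') (rotation_net sample_point m) \<noteq> 0"
    if k: "k \<in> {1..24}" "k' \<in> {1..24}" "m \<in> {1..24}"
      and c: "(k - 1) div 8 = (k' - 1) div 8" "k \<noteq> k'" "(m - 1) div 8 \<noteq> (k - 1) div 8" for k k' m
  proof -
    define A B i j l where "A = (k - 1) div 8" and "B = (m - 1) div 8" and "i = (k - 1) mod 8"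
      and "j = (k' - 1) mod 8" and "l = (m - 1) mod 8"
    have "k' - 1 = 8 * A + j" unfolding A_def c(1) j_def by simp
    moreover have "k - 1 = 8 * A + i" "m - 1 = 8 * B + l"
      unfolding A_def B_def i_def l_def by simp_all
    ultimately have e: "k - 1 = 8 * A + i" "k' - 1 = 8 * A + j" "m - 1 = 8 * B + l" by blast+
    have lt: "i < 8" "j < 8" "l < 8" "A < 3" "B < 3"
      using k by (auto simp: A_def B_def i_def j_def l_def)
    have "i \<noteq> j" using e c(2) k by auto
    moreover have "(A, B) \<in> set [(A, B). A \<leftarrow> [0, 1, 2], B \<leftarrow> [0, 1, 2], A \<noteq> B]"
    proof -
      have "A = 0 \<or> A = 1 \<or> A = 2" "B = 0 \<or> B = 1 \<or> B = 2" using lt by linarith+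
      moreover have "A \<noteq> B" using c(3) by (simp add: A_def B_def)
      ultimately show ?thesis by auto
    qed
    ultimately have "int_bracket (int_lines ! (8 * A + i)) (int_lines ! (8 * A + j)) (int_lines ! (8 * B + l)) \<noteq> 0"
      using int_lines_nondegenerate lt by fastforce
    then show ?thesis
      by (simp only: rotation_net_sample[OF k(1)] rotation_net_sample[OF k(2)] rotation_net_sample[OF k(3)]
          e bracket_int_vector of_int_eq_0_iff simp_thms)
  qed
  note nondegenerate = this
  have "3 * 8 = (24 :: nat)" by simp
  then show ?thesis
    unfolding rotation_params_def net_coordinates_def mem_Collect_eq
    by (simp only:) (intro conjI ballI impI rotation_net_concurrent nondegenerate)
qed

theorem mainTheorem4:
  shows "realizable TYPE(complex) 8 quaternion_square \<and>
    krull_dim (moduli_topology 8 quaternion_square) = 3 \<and>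
    (\<exists>(U :: (complex ^ 3) set) f.
       openin zariski_affine U \<and> U \<noteq> {} \<and>
       moduli_morphism 8 quaternion_square U f \<and>
       bij_betw f U (moduli_space 8 quaternion_square)) \<and>
    (\<exists>L \<in> nets_with_data 8 quaternion_square. defined_over (\<rat> :: complex set) 8 L)"
proof (intro conjI)
  note sample = sample_point_in_rotation_params
  have net: "net_of 8 (rotation_net sample_point) \<in> nets_with_data 8 quaternion_square"
    using sample latin_square_quaternion_square by (intro net_of_in_nets) (auto simp: rotation_params_def)
  then show "realizable TYPE(complex) 8 quaternion_square" by (auto simp: realizable_def)
  have open': "openin zariski_affine rotation_params" by (rule openin_rotation_params)
  have ne: "rotation_params \<noteq> {}" using sample by blast
  obtain g where g: "homeomorphic_map (moduli_topology 8 quaternion_square)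
      (subtopology zariski_affine rotation_params) g"
    using homeomorphic_rotation_class by (meson homeomorphic_map_maps homeomorphic_maps_map)
  have "krull_dim (moduli_topology 8 quaternion_square) = krull_dim (subtopology zariski_affine rotation_params)"
    using krull_dim_homeomorphic_le[OF homeomorphic_rotation_class] krull_dim_homeomorphic_le[OF g]
    by (rule antisym[rotated])
  then show "krull_dim (moduli_topology 8 quaternion_square) = 3"
    using krull_dim_open_affine[OF open' ne] by (simp add: numeral_eq_enat)
  have "regular_to_lines {1..24} rotation_params (\<lambda>u. standard_net 8 (rotation_class u))"
    unfolding regular_to_lines_def
  proof (intro conjI ballI)
    show "(\<lambda>u. standard_net 8 (rotation_class u)) ` rotation_params \<subseteq> {1..24} \<rightarrow>\<^sub>E proj_lines"
      using standard_net_rotation_class(3) by blast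
    fix u assume "u \<in> rotation_params"
    show "\<exists>W p. openin zariski_affine W \<and> u \<in> W \<and>
        (\<forall>k\<in>{1..24}. \<forall>i. affine_polynomial (\<lambda>x. p x k $ i)) \<and>
        (\<forall>x\<in>rotation_params \<inter> W. coordinates_of {1..24} (p x) (standard_net 8 (rotation_class x)))"
      using affine_standard_coordinates standard_net_rotation_class(2) openin_topspace[of zariski_affine]
      by (intro exI[of _ UNIV] exI[of _ "\<lambda>u. standard_coordinates 8 (rotation_net u)"]) auto
  qed
  then have "moduli_morphism 8 quaternion_square rotation_params rotation_class"
    using rotation_class_image by (simp add: moduli_morphism_def)
  moreover have "bij_betw rotation_class rotation_params (moduli_space 8 quaternion_square)"
    using rotation_class_inj rotation_class_image by (simp add: bij_betw_def)
  ultimately show "\<exists>(U :: (complex ^ 3) set) f. openin zariski_affine U \<and> U \<noteq> {} \<and>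
      moduli_morphism 8 quaternion_square U f \<and> bij_betw f U (moduli_space 8 quaternion_square)"
    using open' ne by blast
  have "rotation_net sample_point k \<noteq> 0 \<and> (\<forall>i. rotation_net sample_point k $ i \<in> \<rat>)" if "k \<in> {1..24}" for k
  proof
    show "rotation_net sample_point k \<noteq> 0"
      using net_coordinates_ne_0[of 8 quaternion_square "rotation_net sample_point" k] sample that
      by (simp add: rotation_params_def)
    obtain a b c where "int_lines ! (k - 1) = (a, b, c)" by (cases "int_lines ! (k - 1)") auto
    then have "rotation_net sample_point k = vector [of_int a, of_int b, of_int c]"
      by (simp only: rotation_net_sample[OF that] int_vector_def case_prod_conv)
    then show "\<forall>i. rotation_net sample_point k $ i \<in> \<rat>" by (simp add: forall_3)
  qed
  note rational = this
  have "defined_over \<rat> 8 (net_of 8 (rotation_net sample_point))"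
    unfolding defined_over_def
  proof
    fix k :: nat assume "k \<in> {1..3 * 8}"
    then have k: "k \<in> {1..24}" by simp
    then have "net_of 8 (rotation_net sample_point) k = line_of (rotation_net sample_point k)"
      by (simp add: net_of_def)
    then show "\<exists>a. a \<noteq> 0 \<and> (\<forall>i. a $ i \<in> \<rat>) \<and> net_of 8 (rotation_net sample_point) k = line_of a"
      using rational[OF k] by blast
  qed
  then show "\<exists>L \<in> nets_with_data 8 quaternion_square. defined_over (\<rat> :: complex set) 8 L"
    using net by blast
qed

end
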